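(* The closure $\mathcal{L}$ of the operator $L: \mathcal{D}(L) = C^\infty_{c,\mathrm{rad}}(\mathbb{R}^n) \subseteq \mathcal{H} \to \mathcal{H}$ is self-adjoint, has compact resolvent, and generates a strongly continuous semigroup $\{S(\tau): \tau \geq 0\}$ on $\mathcal{H}$. For the spectrum of $\mathcal{L}$, which consists only of eigenvalues, we have $$\sigma(\mathcal{L}) \subseteq (-\infty,0) \cup \{1\}.$$ The spectral point $\lambda = 1$ is a simple eigenvalue with an eigenfunction $\mathbf{g} = g/\|g\|_{L^2_\sigma(\mathbb{R}^n)}$, where $g(x) = (a|x|^2+b)^{-2}$.
   Context: Fix an integer $d$ with $5 \leq d \leq 9$ and set $n = d+2$, $a = \frac{\sqrt{n-4}}{2\sqrt2}$, $b = n\left(3-\tfrac12\sqrt{2n-8}\right) - 12$. Let $\sigma(x) = e^{-|x|^2/4}$ be a weight on $\mathbb{R}^n$ (not to be confused with the spectrum $\sigma(\mathcal L)$), and let $\mathcal{H} := \{f \in L^2_\sigma(\mathbb{R}^n) : f \text{ real and radial}\}$ with inner product $(f|g)_{L^2_\sigma(\mathbb{R}^n)} = \int_{\mathbb{R}^n} f(x)g(x)\sigma(x)\,dx$. $C^\infty_{c,\mathrm{rad}}(\mathbb{R}^n)$ is the space of smooth, radial, compactly supported (real) functions. The operator $L$ is $$Lf(x) := \Delta f(x) - \tfrac12 x\cdot\nabla f(x) - f(x) + V(|x|) f(x), \qquad V(\rho) = \frac{3(n-4)\left(2b+(2a-1)\rho^2\right)}{(b+a\rho^2)^2}.$$ 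*)

theory Defs
  imports "HOL-Analysis.Analysis"
begin

section \<open>The real Hilbert space of radial functions in the weighted space $L^2_\sigma$\<close>

definition wgt :: "(real ^ 'n) \<Rightarrow> real" where
  "wgt x = exp (- (norm x)\<^sup>2 / 4)"

definition radial :: "(real ^ 'n \<Rightarrow> real) \<Rightarrow> bool" where
  "radial f \<longleftrightarrow> (\<forall>x y. norm x = norm y \<longrightarrow> f x = f y)"

definition L2rad :: "(real ^ 'n \<Rightarrow> real) set" where
  "L2rad = {f. f \<in> borel_measurable lborel \<and> radial f \<and>
               integrable lborel (\<lambda>x. (f x)\<^sup>2 * wgt x)}"

definition L2rad_rel :: "(real ^ 'n \<Rightarrow> real) \<Rightarrow> (real ^ 'n \<Rightarrow> real) \<Rightarrow> bool" where
  "L2rad_rel f g \<longleftrightarrow> f \<in> L2rad \<and> g \<in> L2rad \<and> (AE x in lborel. f x = g x)"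

lemma wgt_pos: "wgt x > 0"
  by (simp add: wgt_def)

lemma wgt_measurable [measurable]: "wgt \<in> borel_measurable borel"
  unfolding wgt_def[abs_def] by measurable

lemma L2rad_zero: "(\<lambda>x. 0) \<in> L2rad"
  by (simp add: L2rad_def radial_def)

lemma L2rad_mult_integrable:
  assumes "f \<in> L2rad" "g \<in> L2rad"
  shows "integrable lborel (\<lambda>x. f x * g x * wgt x)"
proof (rule Bochner_Integration.integrable_bound)
  show "integrable lborel (\<lambda>x. (f x)\<^sup>2 * wgt x + (g x)\<^sup>2 * wgt x)"
    using assms by (simp add: L2rad_def)
  have [measurable]: "f \<in> borel_measurable borel" "g \<in> borel_measurable borel"
    using assms by (auto simp: L2rad_def)
  show "(\<lambda>x. f x * g x * wgt x) \<in> borel_measurable lborel"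
    by measurable
  have "\<bar>f x * g x * wgt x\<bar> \<le> (f x)\<^sup>2 * wgt x + (g x)\<^sup>2 * wgt x" for x
  proof -
    have "2 * (\<bar>f x\<bar> * \<bar>g x\<bar>) \<le> (f x)\<^sup>2 + (g x)\<^sup>2"
      using sum_squares_bound[of "\<bar>f x\<bar>" "\<bar>g x\<bar>"] by simp
    moreover have "0 \<le> \<bar>f x\<bar> * \<bar>g x\<bar>" by simp
    ultimately have "\<bar>f x * g x\<bar> \<le> (f x)\<^sup>2 + (g x)\<^sup>2"
      unfolding abs_mult by linarith
    then have "\<bar>f x * g x\<bar> * wgt x \<le> ((f x)\<^sup>2 + (g x)\<^sup>2) * wgt x"
      by (intro mult_right_mono) (auto simp: wgt_def)
    then show ?thesis
      using wgt_pos[of x] by (simp add: abs_mult distrib_right)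
  qed
  then show "AE x in lborel. norm (f x * g x * wgt x) \<le> norm ((f x)\<^sup>2 * wgt x + (g x)\<^sup>2 * wgt x)"
    by (auto intro!: AE_I2 order_trans[OF _ abs_ge_self])
qed

lemma L2rad_add:
  assumes "f \<in> L2rad" "g \<in> L2rad"
  shows "(\<lambda>x. f x + g x) \<in> L2rad"
proof -
  have "integrable lborel (\<lambda>x. (f x)\<^sup>2 * wgt x + 2 * (f x * g x * wgt x) + (g x)\<^sup>2 * wgt x)"
    using assms L2rad_mult_integrable[OF assms] by (simp add: L2rad_def)
  then have "integrable lborel (\<lambda>x. (f x + g x)\<^sup>2 * wgt x)"
    by (rule back_subst[of "integrable lborel"])
       (auto simp: fun_eq_iff power2_eq_square algebra_simps)
  moreover have "radial (\<lambda>x. f x + g x)"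
    using assms unfolding L2rad_def radial_def mem_Collect_eq by metis
  ultimately show ?thesis
    using assms by (auto simp: L2rad_def)
qed

lemma L2rad_scale:
  assumes "f \<in> L2rad"
  shows "(\<lambda>x. c * f x) \<in> L2rad"
proof -
  have "integrable lborel (\<lambda>x. c\<^sup>2 * ((f x)\<^sup>2 * wgt x))"
    using assms by (simp add: L2rad_def)
  moreover have "radial (\<lambda>x. c * f x)"
    using assms unfolding L2rad_def radial_def mem_Collect_eq by metis
  ultimately show ?thesis
    using assms by (auto simp: L2rad_def power_mult_distrib mult.assoc)
qed

lemma L2rad_uminus: "f \<in> L2rad \<Longrightarrow> (\<lambda>x. - f x) \<in> L2rad"
  using L2rad_scale[of f "-1"] by simp

lemma L2rad_minus: "f \<in> L2rad \<Longrightarrow> g \<in> L2rad \<Longrightarrow> (\<lambda>x. f x - g x) \<in> L2rad"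
  using L2rad_add[of f "\<lambda>x. - g x"] L2rad_uminus[of g] by simp

lemma part_equivp_L2rad_rel: "part_equivp L2rad_rel"
proof (rule part_equivpI)
  show "\<exists>x. L2rad_rel x x"
    by (rule exI[of _ "\<lambda>x. 0"]) (simp add: L2rad_rel_def L2rad_zero)
  show "symp L2rad_rel"
    by (auto simp: symp_def L2rad_rel_def)
  show "transp L2rad_rel"
    by (auto simp: transp_def L2rad_rel_def elim: AE_mp)
qed

text \<open>Elements of \<open>'n radL2\<close> are classes, modulo equality almost everywhere, of square-integrable
  Borel functions; radiality means that the class has a representative that is radial everywhere.\<close>

quotient_type 'n radL2 = "real ^ 'n \<Rightarrow> real" / partial: L2rad_rel
  by (rule part_equivp_L2rad_rel)

text \<open>The class of \<open>f\<close>; arguments outside \<open>L2rad\<close> are sent to \<open>0\<close> only to make the function total.\<close>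

lift_definition toH :: "(real ^ 'n \<Rightarrow> real) \<Rightarrow> 'n radL2" is
  "\<lambda>f. if f \<in> L2rad then f else (\<lambda>x. 0)"
  by (auto simp: L2rad_rel_def L2rad_zero)

instantiation radL2 :: (finite) real_vector
begin

lift_definition zero_radL2 :: "'a radL2" is "\<lambda>x. 0"
  by (simp add: L2rad_rel_def L2rad_zero)

lift_definition plus_radL2 :: "'a radL2 \<Rightarrow> 'a radL2 \<Rightarrow> 'a radL2" is "\<lambda>f g x. f x + g x"
  by (auto simp: L2rad_rel_def L2rad_add)

lift_definition minus_radL2 :: "'a radL2 \<Rightarrow> 'a radL2 \<Rightarrow> 'a radL2" is "\<lambda>f g x. f x - g x"
  by (auto simp: L2rad_rel_def L2rad_minus)

lift_definition uminus_radL2 :: "'a radL2 \<Rightarrow> 'a radL2" is "\<lambda>f x. - f x"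
  by (auto simp: L2rad_rel_def L2rad_uminus)

lift_definition scaleR_radL2 :: "real \<Rightarrow> 'a radL2 \<Rightarrow> 'a radL2" is "\<lambda>c f x. c * f x"
  by (auto simp: L2rad_rel_def L2rad_scale)

instance
proof
  fix u v w :: "'a radL2" and r s :: real
  show "u + v + w = u + (v + w)"
    by transfer (auto simp: L2rad_rel_def L2rad_add add.assoc)
  show "u + v = v + u"
    by transfer (auto simp: L2rad_rel_def L2rad_add add.commute)
  show "0 + u = u"
    by transfer (auto simp: L2rad_rel_def)
  show "- u + u = 0"
    by transfer (auto simp: L2rad_rel_def L2rad_zero)
  show "u - v = u + - v"
    by transfer (auto simp: L2rad_rel_def L2rad_minus)
  show "r *\<^sub>R (u + v) = r *\<^sub>R u + r *\<^sub>R v"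
    by transfer (auto simp: L2rad_rel_def distrib_left intro!: L2rad_add L2rad_scale)
  show "(r + s) *\<^sub>R u = r *\<^sub>R u + s *\<^sub>R u"
    by transfer (auto simp: L2rad_rel_def distrib_right intro!: L2rad_add L2rad_scale)
  show "r *\<^sub>R s *\<^sub>R u = (r * s) *\<^sub>R u"
    by transfer (auto simp: L2rad_rel_def mult.assoc intro!: L2rad_scale)
  show "1 *\<^sub>R u = u"
    by transfer (auto simp: L2rad_rel_def)
qed

end

instantiation radL2 :: (finite) real_inner
begin

lift_definition inner_radL2 :: "'a radL2 \<Rightarrow> 'a radL2 \<Rightarrow> real" is
  "\<lambda>f g. LINT x|lborel. f x * g x * wgt x"
  by (rule integral_cong_AE) (auto simp: L2rad_rel_def L2rad_def)

definition norm_radL2 :: "'a radL2 \<Rightarrow> real" where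
  "norm_radL2 u = sqrt (u \<bullet> u)"

definition sgn_radL2 :: "'a radL2 \<Rightarrow> 'a radL2" where
  "sgn_radL2 u = u /\<^sub>R norm u"

definition dist_radL2 :: "'a radL2 \<Rightarrow> 'a radL2 \<Rightarrow> real" where
  "dist_radL2 u v = norm (u - v)"

definition uniformity_radL2 :: "('a radL2 \<times> 'a radL2) filter" where
  "uniformity_radL2 = (INF e\<in>{0 <..}. principal {(x, y). dist x y < e})"

definition open_radL2 :: "'a radL2 set \<Rightarrow> bool" where
  "open_radL2 U \<longleftrightarrow> (\<forall>x\<in>U. eventually (\<lambda>(x', y). x' = x \<longrightarrow> y \<in> U) uniformity)"

instance
proof
  fix u v w :: "'a radL2" and r :: real
  show "sgn u = u /\<^sub>R norm u"
    by (rule sgn_radL2_def)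
  show "dist u v = norm (u - v)"
    by (rule dist_radL2_def)
  show "uniformity = (INF e\<in>{0 <..}. principal {(x, y :: 'a radL2). dist x y < e})"
    by (rule uniformity_radL2_def)
  show "open U \<longleftrightarrow> (\<forall>x\<in>U. eventually (\<lambda>(x', y). x' = x \<longrightarrow> y \<in> U) uniformity)"
    for U :: "'a radL2 set"
    by (rule open_radL2_def)
  show "u \<bullet> v = v \<bullet> u"
    by transfer (simp add: mult.commute)
  show "(u + v) \<bullet> w = u \<bullet> w + v \<bullet> w"
    by transfer
       (auto simp: L2rad_rel_def distrib_right L2rad_mult_integrable
             intro!: Bochner_Integration.integral_add)
  show "r *\<^sub>R u \<bullet> v = r * (u \<bullet> v)"
    by transfer (simp add: mult.assoc)
  show "0 \<le> u \<bullet> u"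
    by transfer (auto intro!: integral_nonneg_AE AE_I2 simp: wgt_def)
  show "u \<bullet> u = 0 \<longleftrightarrow> u = 0"
  proof (transfer, goal_cases)
    case (1 u)
    then have u: "u \<in> L2rad"
      by (simp add: L2rad_rel_def)
    have "(LINT x|lborel. u x * u x * wgt x) = 0 \<longleftrightarrow> (AE x in lborel. u x * u x * wgt x = 0)"
      by (rule integral_nonneg_eq_0_iff_AE[OF L2rad_mult_integrable[OF u u]])
         (auto intro!: AE_I2 simp: wgt_def)
    also have "\<dots> \<longleftrightarrow> (AE x in lborel. u x = 0)"
      by (simp add: wgt_def)
    finally show ?case
      using u by (simp add: L2rad_rel_def L2rad_zero)
  qed
  show "norm u = sqrt (u \<bullet> u)"
    by (rule norm_radL2_def)
qed

end

section \<open>Unbounded operators on a real Hilbert space, as graphs\<close>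

type_synonym 'a operator = "('a \<times> 'a) set"

definition adjoint_op :: "'a::real_inner operator \<Rightarrow> 'a operator" where
  "adjoint_op T = {(y, z). \<forall>(x, w)\<in>T. w \<bullet> y = x \<bullet> z}"

definition selfadjoint_op :: "'a::real_inner operator \<Rightarrow> bool" where
  "selfadjoint_op T \<longleftrightarrow> single_valued T \<and> closure (Domain T) = UNIV \<and> adjoint_op T = T"

text \<open>The spectrum of an operator on a real Hilbert space is the spectrum, a subset of the complex
  plane, of its complexification; \<open>(x, y)\<close> in \<open>'a \<times> 'a\<close> stands for $x + i y$.\<close>

definition complexify_op :: "'a operator \<Rightarrow> ('a \<times> 'a) operator" where
  "complexify_op T = {((x, y), (u, v)). (x, u) \<in> T \<and> (y, v) \<in> T}"

definition cscale :: "complex \<Rightarrow> 'a::real_vector \<times> 'a \<Rightarrow> 'a \<times> 'a" where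
  "cscale c = (\<lambda>(x, y). (Re c *\<^sub>R x - Im c *\<^sub>R y, Im c *\<^sub>R x + Re c *\<^sub>R y))"

text \<open>The graph of $(\lambda - T)^{-1}$, as a relation for arbitrary $\lambda$.\<close>

definition resolvent_op :: "'a::real_vector operator \<Rightarrow> complex \<Rightarrow> ('a \<times> 'a) operator" where
  "resolvent_op T \<zeta> = {(cscale \<zeta> z - w, z) | z w. (z, w) \<in> complexify_op T}"

definition resolvent_set :: "'a::real_normed_vector operator \<Rightarrow> complex set" where
  "resolvent_set T = {\<zeta>. \<exists>R. bounded_linear R \<and> resolvent_op T \<zeta> = {(x, R x) | x. True}}"

definition spectrum_op :: "'a::real_normed_vector operator \<Rightarrow> complex set" where
  "spectrum_op T = - resolvent_set T"

definition compact_resolvent :: "'a::real_normed_vector operator \<Rightarrow> bool" where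
  "compact_resolvent T \<longleftrightarrow> resolvent_set T \<noteq> {} \<and>
     (\<forall>\<zeta>\<in>resolvent_set T. compact (closure (resolvent_op T \<zeta> `` cball 0 1)))"

definition eigenvalue_op :: "'a::real_vector operator \<Rightarrow> real \<Rightarrow> bool" where
  "eigenvalue_op T \<mu> \<longleftrightarrow> (\<exists>u. u \<noteq> 0 \<and> (u, \<mu> *\<^sub>R u) \<in> T)"

text \<open>A simple eigenvalue is one of algebraic multiplicity one: the union of the kernels of
  $(T - \mu)^k$ over all $k$ is one-dimensional.\<close>

definition simple_eigenvalue_op :: "'a::real_vector operator \<Rightarrow> real \<Rightarrow> bool" where
  "simple_eigenvalue_op T \<mu> \<longleftrightarrow> eigenvalue_op T \<mu> \<and>
     dim {u. \<exists>k. (u, 0) \<in> {(x, y - \<mu> *\<^sub>R x) | x y. (x, y) \<in> T} ^^ k} = 1"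

definition C0_semigroup :: "(real \<Rightarrow> 'a::real_normed_vector \<Rightarrow> 'a) \<Rightarrow> bool" where
  "C0_semigroup S \<longleftrightarrow>
     (\<forall>t\<ge>0. bounded_linear (S t)) \<and> (\<forall>x. S 0 x = x) \<and>
     (\<forall>s\<ge>0. \<forall>t\<ge>0. \<forall>x. S (s + t) x = S s (S t x)) \<and>
     (\<forall>x. continuous_on {0..} (\<lambda>t. S t x))"

definition generator :: "(real \<Rightarrow> 'a::real_normed_vector \<Rightarrow> 'a) \<Rightarrow> 'a operator" where
  "generator S = {(x, y). ((\<lambda>t. (S t x - x) /\<^sub>R t) \<longlongrightarrow> y) (at_right 0)}"

section \<open>The differential operator\<close>

definition dir_deriv :: "real ^ 'n \<Rightarrow> (real ^ 'n \<Rightarrow> real) \<Rightarrow> real ^ 'n \<Rightarrow> real" where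
  "dir_deriv e f x = deriv (\<lambda>t. f (x + t *\<^sub>R e)) 0"

abbreviation pdiff :: "'n \<Rightarrow> (real ^ 'n \<Rightarrow> real) \<Rightarrow> real ^ 'n \<Rightarrow> real" where
  "pdiff i \<equiv> dir_deriv (axis i 1)"

text \<open>Smoothness: all iterated partial derivatives exist and are (Frechet) differentiable,
  in particular continuous.\<close>

definition smooth_fun :: "(real ^ 'n \<Rightarrow> real) \<Rightarrow> bool" where
  "smooth_fun f \<longleftrightarrow> (\<forall>is x. foldr pdiff is f differentiable (at x))"

definition Cc_rad :: "(real ^ 'n \<Rightarrow> real) set" where
  "Cc_rad = {f. smooth_fun f \<and> radial f \<and> compact (closure {x. f x \<noteq> 0})}"

definition coeff_a :: "nat \<Rightarrow> real" where
  "coeff_a n = sqrt (real n - 4) / (2 * sqrt 2)"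

definition coeff_b :: "nat \<Rightarrow> real" where
  "coeff_b n = real n * (3 - 1/2 * sqrt (2 * real n - 8)) - 12"

definition potential :: "nat \<Rightarrow> real \<Rightarrow> real" where
  "potential n \<rho> = 3 * (real n - 4) * (2 * coeff_b n + (2 * coeff_a n - 1) * \<rho>\<^sup>2) /
     (coeff_b n + coeff_a n * \<rho>\<^sup>2)\<^sup>2"

definition L_fun :: "(real ^ 'n \<Rightarrow> real) \<Rightarrow> real ^ 'n \<Rightarrow> real" where
  "L_fun f x = (\<Sum>i\<in>UNIV. pdiff i (pdiff i f) x) - 1/2 * (\<Sum>i\<in>UNIV. x $ i * pdiff i f x)
     - f x + potential CARD('n) (norm x) * f x"

text \<open>For \<open>f\<close> in \<open>Cc_rad\<close>, \<open>L_fun f\<close> is again smooth, radial and compactly supported, so both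
  components below are classes of functions in \<open>L2rad\<close>.\<close>

definition L_op :: "'n::finite radL2 operator" where
  "L_op = {(toH f, toH (L_fun f)) | f. f \<in> Cc_rad}"

definition eigfun_g :: "real ^ 'n \<Rightarrow> real" where
  "eigfun_g x = 1 / (coeff_a CARD('n) * (norm x)\<^sup>2 + coeff_b CARD('n))\<^sup>2"

definition normalized :: "(real ^ 'n \<Rightarrow> real) \<Rightarrow> real ^ 'n \<Rightarrow> real" where
  "normalized f x = f x / sqrt (LINT y|lborel. (f y)\<^sup>2 * wgt y)"

definition eigenfunction :: "'n::finite radL2 operator \<Rightarrow> real \<Rightarrow> (real ^ 'n \<Rightarrow> real) \<Rightarrow> bool" where
  "eigenfunction T \<mu> f \<longleftrightarrow> f \<in> L2rad \<and> toH f \<noteq> 0 \<and> (toH f, \<mu> *\<^sub>R toH f) \<in> T"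

end

theory Submission
  imports Defs
begin

text \<open>
  The operator is a bounded perturbation of $L_0 = \Delta - \frac12 x\cdot\nabla - 1$, which the
  Laguerre polynomials in $|x|^2$ diagonalize, with eigenvalues $-(k+1)$. Multiplication by a smooth
  compactly supported cutoff shows that the polynomials lie in the domain of the closure of $L$, and
  one integration by parts shows that $L$ on test functions is contained in the perturbed diagonal
  operator; hence the closure is $L_0 + V$. Its resolvent at a large real point comes from a
  contraction argument and is compact, so the spectral theorem for compact operators turns the closure
  into a diagonal operator in an orthonormal basis, where self-adjointness, compactness of the
  resolvents, the semigroup $e^{\mu t}$ and the description of the spectrum are read off.

  For the location of the spectrum write $f = u g$ with the positive function $g$, for which $Lg = g$.
  With $m = r^{n-1} e^{-r^2/4} g^2$ and $p = m'/m$, one has $(1-L)f = -g (u'' + p u')$, so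
  $((1-L)f|f) = \int u'^2 m$ and
  $\|(1-L)f\|^2 = \int ((u''-u'/r)^2 + C u'^2)\, m$ with
  $C = -(rp)'/r = 1 + 16ab/(ar^2+b)^2 > 1$. For an eigenvector with eigenvalue in $[0,1]$ the two
  identities force the derivatives $u'$ of approximating test functions to vanish in the limit, so that
  the eigenvector is a multiple of $g$; eigenvalues above $1$ are excluded by the first identity.
\<close>

section \<open>Orthonormal bases and diagonal operators\<close>

text \<open>Put A = 1 - L. On test functions the two identities say A >= 0 and |A f|^2 >= (A f|f),
  which confines the spectrum of A to 0 and [1, infinity). The delicate point is A = 1, the
  eigenvalue 0 of L: there the inequality alone gives no contradiction, and only the strict excess C
  - 1 > 0 decides. Division by g turns the ground state into the constant u = 1, so passing to u'
  discards exactly this state. Eigenvectors are known only as elements of the closure; hence every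
  estimate is made on test functions and carried over as a limit, and neither regularity of an
  eigenvector nor a differential equation for it is ever used. The range of dimensions enters as b >
  0, since b vanishes precisely at n = 6 and n = 12 among n > 4; this positivity makes g and the
  potential smooth and C - 1 positive. Because the Hilbert space is real, the spectral theorem is
  proved over the reals, and nonreal spectral parameters appear only as pairs of real multipliers
  once a diagonal form is available.\<close>

lemma compact_closure_totally_bounded:
  fixes S :: "'a::complete_space set"
  assumes "\<And>\<epsilon>. \<epsilon> > 0 \<Longrightarrow> \<exists>k. finite k \<and> S \<subseteq> (\<Union>x\<in>k. ball x \<epsilon>)"
  shows "compact (closure S)"
  unfolding compact_eq_totally_bounded
proof (intro conjI allI impI)
  show "complete (closure S)"
    by (simp add: complete_eq_closed)
  fix \<epsilon> :: real assume "\<epsilon> > 0"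
  then obtain k where k: "finite k" "S \<subseteq> (\<Union>x\<in>k. ball x (\<epsilon>/2))"
    using assms[of "\<epsilon>/2"] by auto
  \<comment> \<open>A finite union of closed balls is closed, so it contains the closure too;
    halving the radius leaves room to return to open balls.\<close>
  have "S \<subseteq> (\<Union>x\<in>k. cball x (\<epsilon>/2))"
    using k(2) by (auto simp: subset_iff) (meson less_imp_le)
  then have "closure S \<subseteq> (\<Union>x\<in>k. cball x (\<epsilon>/2))"
    by (intro closure_minimal closed_UN k(1)) auto
  also have "\<dots> \<subseteq> (\<Union>x\<in>k. ball x \<epsilon>)"
    using \<open>\<epsilon> > 0\<close> by (intro UN_mono) auto
  finally show "\<exists>k. finite k \<and> closure S \<subseteq> (\<Union>x\<in>k. ball x \<epsilon>)"
    using k(1) by blast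
qed

text \<open>This is how norm limits of finite-rank operators become compact: the approximating
  compact sets will be boxes in finitely many coordinates, see \<open>compact_diag\<close>.\<close>

lemma compact_closure_approx:
  fixes S :: "'a::complete_space set"
  assumes "\<And>\<epsilon>. \<epsilon> > 0 \<Longrightarrow> \<exists>C. compact C \<and> (\<forall>x\<in>S. \<exists>y\<in>C. dist y x < \<epsilon>)"
  shows "compact (closure S)"
proof (rule compact_closure_totally_bounded)
  fix \<epsilon> :: real assume "\<epsilon> > 0"
  then obtain C where C: "compact C" "\<forall>x\<in>S. \<exists>y\<in>C. dist y x < \<epsilon>/2"
    using assms[of "\<epsilon>/2"] by auto
  obtain k where k: "finite k" "C \<subseteq> (\<Union>x\<in>k. ball x (\<epsilon>/2))"
    using C(1) \<open>\<epsilon> > 0\<close> unfolding compact_eq_totally_bounded by (meson half_gt_zero)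
  have "S \<subseteq> (\<Union>x\<in>k. ball x \<epsilon>)"
  proof
    fix x assume "x \<in> S"
    then obtain y where y: "y \<in> C" "dist y x < \<epsilon>/2" using C(2) by blast
    then obtain z where z: "z \<in> k" "dist z y < \<epsilon>/2" using k(2) by auto
    have "dist z x < \<epsilon>" using dist_triangle[of z x y] y z by linarith
    then show "x \<in> (\<Union>x\<in>k. ball x \<epsilon>)" using z by auto
  qed
  then show "\<exists>k. finite k \<and> S \<subseteq> (\<Union>x\<in>k. ball x \<epsilon>)"
    using k by blast
qed

text \<open>The index set is arbitrary, so that one development serves both Laguerre vectors indexed
  by numbers and eigenvectors indexed by themselves.\<close>

locale orthonormal =
  fixes e :: "'i \<Rightarrow> 'a::{real_inner,complete_space}" and I :: "'i set"
  assumes inner_basis: "i \<in> I \<Longrightarrow> j \<in> I \<Longrightarrow> e i \<bullet> e j = (if i = j then 1 else 0)"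
begin

lemma norm_basis [simp]: "i \<in> I \<Longrightarrow> norm (e i) = 1"
  using inner_basis[of i i] by (simp add: norm_eq_sqrt_inner)

lemma inner_sum_basis:
  assumes "finite F" "F \<subseteq> I" "j \<in> I"
  shows "(\<Sum>i\<in>F. c i *\<^sub>R e i) \<bullet> e j = (if j \<in> F then c j else 0)"
proof -
  have "(\<Sum>i\<in>F. c i *\<^sub>R e i) \<bullet> e j = (\<Sum>i\<in>F. if i = j then c i else 0)"
    unfolding inner_sum_left using assms by (intro sum.cong) (auto simp: inner_basis subset_iff)
  also have "\<dots> = (if j \<in> F then c j else 0)"
    using assms by simp
  finally show ?thesis .
qed

lemma norm_sum_basis:
  assumes "finite F" "F \<subseteq> I"
  shows "(norm (\<Sum>i\<in>F. c i *\<^sub>R e i))\<^sup>2 = (\<Sum>i\<in>F. (c i)\<^sup>2)"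
proof -
  have "(norm (\<Sum>i\<in>F. c i *\<^sub>R e i))\<^sup>2 = (\<Sum>j\<in>F. c j * ((\<Sum>i\<in>F. c i *\<^sub>R e i) \<bullet> e j))"
    unfolding power2_norm_eq_inner by (subst inner_sum_right) simp
  also have "\<dots> = (\<Sum>i\<in>F. (c i)\<^sup>2)"
    using assms by (intro sum.cong) (auto simp: inner_sum_basis subset_iff power2_eq_square)
  finally show ?thesis .
qed

lemma bessel:
  assumes "finite F" "F \<subseteq> I"
  shows "(\<Sum>i\<in>F. (x \<bullet> e i)\<^sup>2) \<le> (norm x)\<^sup>2"
proof -
  define p where "p = (\<Sum>i\<in>F. (x \<bullet> e i) *\<^sub>R e i)"
  have "p \<bullet> x = (\<Sum>i\<in>F. (x \<bullet> e i)\<^sup>2)"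
    by (simp add: p_def inner_sum_left power2_eq_square inner_commute[of "e i" x for i])
  moreover have "p \<bullet> p = (\<Sum>i\<in>F. (x \<bullet> e i)\<^sup>2)"
    unfolding p_def power2_norm_eq_inner[symmetric] by (rule norm_sum_basis[OF assms])
  moreover have "0 \<le> (x - p) \<bullet> (x - p)" by simp
  ultimately show ?thesis
    by (simp add: inner_diff_left inner_diff_right inner_commute power2_norm_eq_inner)
qed

text \<open>Sums over an arbitrary index set are limits along finite subsets, hence the Cauchy
  filter. Beyond a finite set \<open>F0\<close> that nearly exhausts the square sum, partial sums
  differ from the one over \<open>F0\<close> by vectors whose squared norms are pieces of the
  tail.\<close>

lemma riesz_fischer:
  assumes "\<And>F. finite F \<Longrightarrow> F \<subseteq> I \<Longrightarrow> (\<Sum>i\<in>F. (c i)\<^sup>2) \<le> B"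
  shows "(\<lambda>i. c i *\<^sub>R e i) summable_on I"
proof -
  let ?s = "\<lambda>F. \<Sum>i\<in>F. c i *\<^sub>R e i"
  have "(\<lambda>i. (c i)\<^sup>2) summable_on I"
    by (rule nonneg_bdd_above_summable_on) (auto simp: bdd_above_def intro: assms)
  then obtain L where L: "(sum (\<lambda>i. (c i)\<^sup>2) \<longlongrightarrow> L) (finite_subsets_at_top I)"
    unfolding summable_on_def has_sum_def by blast
  have "\<exists>P. eventually P (finite_subsets_at_top I) \<and> (\<forall>F1 F2. P F1 \<and> P F2 \<longrightarrow> dist (?s F1) (?s F2) < \<epsilon>)"
    if "\<epsilon> > 0" for \<epsilon>
  proof -
    \<comment> \<open>Two square sums within \<open>d\<close> of \<open>L\<close> differ by less
      than \<open>2 * d\<close>, which is the square of \<epsilon>/2.\<close>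
    define d where "d = (\<epsilon>/2)\<^sup>2 / 2"
    have d: "d > 0" using that by (simp add: d_def)
    have "\<forall>\<^sub>F F in finite_subsets_at_top I. dist (\<Sum>i\<in>F. (c i)\<^sup>2) L < d"
      using L d by (rule tendstoD)
    then obtain F0 where F0: "finite F0" "F0 \<subseteq> I"
      "\<And>F. finite F \<Longrightarrow> F0 \<subseteq> F \<Longrightarrow> F \<subseteq> I \<Longrightarrow> dist (\<Sum>i\<in>F. (c i)\<^sup>2) L < d"
      by (auto simp: eventually_finite_subsets_at_top)
    have near: "dist (?s F) (?s F0) < \<epsilon>/2" if F: "finite F" "F0 \<subseteq> F" "F \<subseteq> I" for F
    proof -
      have "?s F - ?s F0 = ?s (F - F0)"
        using F by (simp add: sum_diff)
      then have "(dist (?s F) (?s F0))\<^sup>2 = (\<Sum>i\<in>F - F0. (c i)\<^sup>2)"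
        using F by (simp add: dist_norm) (subst norm_sum_basis, auto)
      also have "\<dots> = (\<Sum>i\<in>F. (c i)\<^sup>2) - (\<Sum>i\<in>F0. (c i)\<^sup>2)"
        using F by (simp add: sum_diff)
      also have "\<dots> < 2 * d"
        using F0(3)[OF F] F0(3)[OF F0(1) order_refl F0(2)] by (auto simp: dist_real_def abs_less_iff)
      also have "\<dots> = (\<epsilon>/2)\<^sup>2" by (simp add: d_def)
      finally show ?thesis
        using \<open>\<epsilon> > 0\<close> by (intro power_less_imp_less_base[of _ 2 "\<epsilon>/2"]) auto
    qed
    show ?thesis
    proof (intro exI[of _ "\<lambda>F. finite F \<and> F0 \<subseteq> F \<and> F \<subseteq> I"] conjI allI impI)
      show "\<forall>\<^sub>F F in finite_subsets_at_top I. finite F \<and> F0 \<subseteq> F \<and> F \<subseteq> I"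
        unfolding eventually_finite_subsets_at_top using F0 by (intro exI[of _ F0]) auto
      fix F1 F2 assume *: "(finite F1 \<and> F0 \<subseteq> F1 \<and> F1 \<subseteq> I) \<and> (finite F2 \<and> F0 \<subseteq> F2 \<and> F2 \<subseteq> I)"
      show "dist (?s F1) (?s F2) < \<epsilon>"
        using near[of F1] near[of F2] * dist_triangle2[of "?s F1" "?s F2" "?s F0"] by fastforce
    qed
  qed
  then have "cauchy_filter (filtermap ?s (finite_subsets_at_top I))"
    by (simp add: cauchy_filter_metric_filtermap)
  then obtain L' where "(?s \<longlongrightarrow> L') (finite_subsets_at_top I)"
    using complete_uniform[where S="UNIV::'a set"] complete_UNIV by (force simp add: filterlim_def)
  then show ?thesis
    unfolding summable_on_def has_sum_def by blast
qed

lemma inner_has_sum_basis: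
  assumes "((\<lambda>i. c i *\<^sub>R e i) has_sum y) I" "j \<in> I"
  shows "y \<bullet> e j = c j"
proof -
  have "((\<lambda>i. (c i *\<^sub>R e i) \<bullet> e j) has_sum (y \<bullet> e j)) I"
    using has_sum_bounded_linear[OF bounded_linear_inner_left assms(1)] by simp
  moreover have "((\<lambda>i. (c i *\<^sub>R e i) \<bullet> e j) has_sum c j) I"
  proof (rule has_sum_cong_neutral[THEN iffD1])
    show "((\<lambda>i. (c i *\<^sub>R e i) \<bullet> e j) has_sum c j) {j}"
      using has_sum_finite[of "{j}" "\<lambda>i. (c i *\<^sub>R e i) \<bullet> e j"] assms(2) by (simp add: inner_basis)
  qed (use assms(2) in \<open>auto simp: inner_basis\<close>)
  ultimately show ?thesis by (rule has_sum_unique)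
qed

end

locale onb = orthonormal e I for e :: "'i \<Rightarrow> 'a::{real_inner,complete_space}" and I +
  assumes total: "(\<And>i. i \<in> I \<Longrightarrow> x \<bullet> e i = 0) \<Longrightarrow> x = 0"
begin

text \<open>Almost every identity between vectors below is checked one coefficient at a time through
  this rule.\<close>

lemma eqI: "(\<And>i. i \<in> I \<Longrightarrow> x \<bullet> e i = y \<bullet> e i) \<Longrightarrow> x = y"
  using total[of "x - y"] by (simp add: inner_diff_left)

lemma expansion: "((\<lambda>i. (x \<bullet> e i) *\<^sub>R e i) has_sum x) I"
proof -
  have "(\<lambda>i. (x \<bullet> e i) *\<^sub>R e i) summable_on I"
    by (rule riesz_fischer[where B="(norm x)\<^sup>2"]) (rule bessel)
  then obtain y where y: "((\<lambda>i. (x \<bullet> e i) *\<^sub>R e i) has_sum y) I"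
    by (auto simp: summable_on_def)
  then have "y = x"
    by (intro eqI) (simp add: inner_has_sum_basis)
  with y show ?thesis by simp
qed

lemma parseval: "((\<lambda>i. (x \<bullet> e i) * (y \<bullet> e i)) has_sum (x \<bullet> y)) I"
  using has_sum_bounded_linear[OF bounded_linear_inner_left[of y] expansion[of x]]
  by (simp add: inner_commute)

lemma norm_le_coeffs:
  assumes "\<And>i. i \<in> I \<Longrightarrow> \<bar>x \<bullet> e i\<bar> \<le> B * \<bar>y \<bullet> e i\<bar>" "B \<ge> 0"
  shows "norm x \<le> B * norm y"
proof -
  have "x \<bullet> x \<le> B\<^sup>2 * (y \<bullet> y)"
  proof (rule has_sum_mono[OF parseval])
    show "((\<lambda>i. B\<^sup>2 * ((y \<bullet> e i) * (y \<bullet> e i))) has_sum (B\<^sup>2 * (y \<bullet> y))) I"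
      by (intro has_sum_cmult_right parseval)
    fix i assume "i \<in> I"
    from power_mono[OF assms(1)[OF this], of 2]
    show "(x \<bullet> e i) * (x \<bullet> e i) \<le> B\<^sup>2 * ((y \<bullet> e i) * (y \<bullet> e i))"
      by (simp add: power2_eq_square abs_mult_self_eq algebra_simps)
  qed
  then have "(norm x)\<^sup>2 \<le> (B * norm y)\<^sup>2"
    by (simp add: power2_norm_eq_inner power_mult_distrib)
  then show ?thesis
    using assms(2) by (auto intro: power2_le_imp_le)
qed

section \<open>Functional calculus in an orthonormal basis\<close>

text \<open>An infinite sum that does not converge is 0 by default, so the facts about
  \<open>diag \<phi>\<close> carry the hypothesis \<open>bdd \<phi>\<close> or a bound that implies
  it.\<close>

definition diag :: "('i \<Rightarrow> real) \<Rightarrow> 'a \<Rightarrow> 'a" where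
  "diag \<phi> x = (\<Sum>\<^sub>\<infinity>i\<in>I. (\<phi> i * (x \<bullet> e i)) *\<^sub>R e i)"

definition bdd :: "('i \<Rightarrow> real) \<Rightarrow> bool" where
  "bdd \<phi> \<longleftrightarrow> (\<exists>B. \<forall>i\<in>I. \<bar>\<phi> i\<bar> \<le> B)"

lemma diag_coeff:
  assumes "bdd \<phi>" "j \<in> I"
  shows "diag \<phi> x \<bullet> e j = \<phi> j * (x \<bullet> e j)"
proof -
  obtain B where B: "\<And>i. i \<in> I \<Longrightarrow> \<bar>\<phi> i\<bar> \<le> B"
    using assms(1) unfolding bdd_def by blast
  have "(\<lambda>i. (\<phi> i * (x \<bullet> e i)) *\<^sub>R e i) summable_on I"
  proof (rule riesz_fischer)
    fix F assume F: "finite F" "F \<subseteq> I"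
    have "(\<phi> i)\<^sup>2 \<le> B\<^sup>2" if "i \<in> F" for i
      using power_mono[OF B[of i], of 2] that F(2) by auto
    then have "(\<Sum>i\<in>F. (\<phi> i * (x \<bullet> e i))\<^sup>2) \<le> (\<Sum>i\<in>F. B\<^sup>2 * (x \<bullet> e i)\<^sup>2)"
      unfolding power_mult_distrib by (intro sum_mono mult_right_mono) auto
    also have "\<dots> = B\<^sup>2 * (\<Sum>i\<in>F. (x \<bullet> e i)\<^sup>2)" by (simp add: sum_distrib_left)
    also have "\<dots> \<le> B\<^sup>2 * (norm x)\<^sup>2"
      by (intro mult_left_mono bessel F) auto
    finally show "(\<Sum>i\<in>F. (\<phi> i * (x \<bullet> e i))\<^sup>2) \<le> B\<^sup>2 * (norm x)\<^sup>2" .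
  qed
  then have "((\<lambda>i. (\<phi> i * (x \<bullet> e i)) *\<^sub>R e i) has_sum diag \<phi> x) I"
    unfolding diag_def by simp
  then show ?thesis
    using assms(2) by (rule inner_has_sum_basis)
qed

lemma norm_diag_le:
  assumes "\<And>i. i \<in> I \<Longrightarrow> \<bar>\<phi> i\<bar> \<le> B" "B \<ge> 0"
  shows "norm (diag \<phi> x) \<le> B * norm x"
proof -
  have "bdd \<phi>" using assms(1) by (auto simp: bdd_def)
  then show ?thesis
    by (intro norm_le_coeffs) (auto simp: diag_coeff abs_mult assms intro!: mult_right_mono)
qed

lemma bounded_linear_diag:
  assumes "bdd \<phi>"
  shows "bounded_linear (diag \<phi>)"
proof -
  obtain B where B: "\<And>i. i \<in> I \<Longrightarrow> \<bar>\<phi> i\<bar> \<le> B"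
    using assms unfolding bdd_def by blast
  show ?thesis
  proof (rule bounded_linear_intro)
    show "norm (diag \<phi> x) \<le> norm x * max B 0" for x
      using norm_diag_le[of \<phi> "max B 0" x] B by (simp add: mult.commute le_max_iff_disj)
  qed (auto intro!: eqI simp: diag_coeff[OF assms] inner_add_left distrib_left)
qed

text \<open>Dominated convergence for multipliers: the part of \<open>x\<close> outside a finite set
  of indices is small and stays small under the uniform bound, while pointwise convergence settles
  the finitely many other coefficients. The convergence is strong, not in operator norm, and this is
  what the semigroup and its generator require.\<close>

lemma diag_tendsto:
  assumes bound: "\<forall>\<^sub>F t in Fl. \<forall>i\<in>I. \<bar>\<phi> t i\<bar> \<le> B"
    and conv: "\<And>i. i \<in> I \<Longrightarrow> ((\<lambda>t. \<phi> t i) \<longlongrightarrow> \<psi> i) Fl"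
    and psi: "\<And>i. i \<in> I \<Longrightarrow> \<bar>\<psi> i\<bar> \<le> B"
  shows "((\<lambda>t. diag (\<phi> t) x) \<longlongrightarrow> diag \<psi> x) Fl"
proof (rule tendstoI)
  fix \<epsilon> :: real assume "\<epsilon> > 0"
  \<comment> \<open>\<open>B\<close> may be 0, and even negative when \<open>I\<close> is empty; the
    shift gives a positive bound that can be divided by.\<close>
  define B' where "B' = max B 0 + 1"
  have B': "B' > 0" "B' \<ge> B" by (auto simp: B'_def)
  define d where "d = \<epsilon> / (4 * B')"
  have d: "d > 0" using \<open>\<epsilon> > 0\<close> B' by (simp add: d_def)
  have "\<forall>\<^sub>F F in finite_subsets_at_top I. dist (\<Sum>i\<in>F. (x \<bullet> e i) *\<^sub>R e i) x < d"
    using expansion[of x] d unfolding has_sum_def by (rule tendstoD)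
  then obtain F where F: "finite F" "F \<subseteq> I" "dist (\<Sum>i\<in>F. (x \<bullet> e i) *\<^sub>R e i) x < d"
    by (auto simp: eventually_finite_subsets_at_top)
  define z where "z = x - (\<Sum>i\<in>F. (x \<bullet> e i) *\<^sub>R e i)"
  have z: "norm z < d" using F(3) by (simp add: z_def dist_norm norm_minus_commute)
  have zc: "z \<bullet> e i = (if i \<in> F then 0 else x \<bullet> e i)" if "i \<in> I" for i
    using F that by (simp add: z_def inner_diff_left inner_sum_basis)
  define S where "S t = (\<Sum>i\<in>F. ((\<phi> t i - \<psi> i) * (x \<bullet> e i)) *\<^sub>R e i)" for t
  have "(S \<longlongrightarrow> (\<Sum>i\<in>F. ((\<psi> i - \<psi> i) * (x \<bullet> e i)) *\<^sub>R e i)) Fl"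
    unfolding S_def using F(2) by (intro tendsto_intros conv) auto
  then have "(S \<longlongrightarrow> 0) Fl" by simp
  then have "\<forall>\<^sub>F t in Fl. dist (S t) 0 < \<epsilon>/2"
    using \<open>\<epsilon> > 0\<close> by (intro tendstoD) auto
  then show "\<forall>\<^sub>F t in Fl. dist (diag (\<phi> t) x) (diag \<psi> x) < \<epsilon>"
    using bound
  proof eventually_elim
    case (elim t)
    have b1: "bdd (\<phi> t)" "bdd \<psi>" using elim psi by (auto simp: bdd_def)
    have b2: "bdd (\<lambda>i. \<phi> t i - \<psi> i)"
      unfolding bdd_def using elim psi by (intro exI[of _ "2 * B"]) (fastforce simp: abs_le_iff)
    have "diag (\<phi> t) x - diag \<psi> x = S t + diag (\<lambda>i. \<phi> t i - \<psi> i) z"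
    proof (rule eqI)
      fix i assume i: "i \<in> I"
      have "S t \<bullet> e i = (if i \<in> F then (\<phi> t i - \<psi> i) * (x \<bullet> e i) else 0)"
        unfolding S_def by (rule inner_sum_basis[OF F(1,2) i])
      then show "(diag (\<phi> t) x - diag \<psi> x) \<bullet> e i = (S t + diag (\<lambda>i. \<phi> t i - \<psi> i) z) \<bullet> e i"
        using i by (simp add: inner_diff_left inner_add_left diag_coeff[OF b1(1)]
          diag_coeff[OF b1(2)] diag_coeff[OF b2] zc left_diff_distrib)
    qed
    then have "norm (diag (\<phi> t) x - diag \<psi> x) \<le> norm (S t) + norm (diag (\<lambda>i. \<phi> t i - \<psi> i) z)"
      by (simp add: norm_triangle_ineq)
    also have "norm (diag (\<lambda>i. \<phi> t i - \<psi> i) z) \<le> (2 * B') * norm z"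
    proof (rule norm_diag_le)
      show "\<bar>\<phi> t i - \<psi> i\<bar> \<le> 2 * B'" if "i \<in> I" for i
        using elim(2) psi that B'(2) by (smt (verit))
    qed (use B' in auto)
    also have "\<dots> \<le> 2 * B' * d"
      using z B' by (intro mult_left_mono) auto
    also have "\<dots> = \<epsilon>/2" using B' by (simp add: d_def)
    finally show ?case using elim(1) by (simp add: dist_norm)
  qed
qed

lemma compact_finite_combinations:
  assumes "finite F"
  shows "compact {\<Sum>i\<in>F. a i *\<^sub>R e i | a. \<forall>i\<in>F. \<bar>a i\<bar> \<le> r}"
  using assms
proof (induction F rule: finite_induct)
  case empty
  then show ?case by simp
next
  case (insert i F)
  let ?A = "(\<lambda>t. t *\<^sub>R e i) ` {-r..r}" and ?B = "{\<Sum>i\<in>F. a i *\<^sub>R e i | a. \<forall>i\<in>F. \<bar>a i\<bar> \<le> r}"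
  have "compact ?A"
    by (intro compact_continuous_image continuous_intros) auto
  then have "compact {x + y |x y. x \<in> ?A \<and> y \<in> ?B}"
    using insert.IH by (rule compact_sums)
  also have "{x + y |x y. x \<in> ?A \<and> y \<in> ?B} = {\<Sum>i\<in>insert i F. a i *\<^sub>R e i | a. \<forall>i\<in>insert i F. \<bar>a i\<bar> \<le> r}"
  proof (intro equalityI subsetI)
    fix v assume "v \<in> {x + y |x y. x \<in> ?A \<and> y \<in> ?B}"
    then obtain t a where v: "v = t *\<^sub>R e i + (\<Sum>i\<in>F. a i *\<^sub>R e i)" "\<bar>t\<bar> \<le> r" "\<forall>i\<in>F. \<bar>a i\<bar> \<le> r"
      by auto
    have "v = (\<Sum>j\<in>insert i F. (a(i:=t)) j *\<^sub>R e j)"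
      using insert.hyps v(1) by (simp, intro sum.cong) auto
    moreover have "\<forall>j\<in>insert i F. \<bar>(a(i:=t)) j\<bar> \<le> r" using v by auto
    ultimately show "v \<in> {\<Sum>i\<in>insert i F. a i *\<^sub>R e i | a. \<forall>i\<in>insert i F. \<bar>a i\<bar> \<le> r}" by blast
  next
    fix v assume "v \<in> {\<Sum>i\<in>insert i F. a i *\<^sub>R e i | a. \<forall>i\<in>insert i F. \<bar>a i\<bar> \<le> r}"
    then obtain a where a: "v = (\<Sum>j\<in>insert i F. a j *\<^sub>R e j)" "\<forall>j\<in>insert i F. \<bar>a j\<bar> \<le> r" by blast
    then have "v = a i *\<^sub>R e i + (\<Sum>j\<in>F. a j *\<^sub>R e j)" "a i *\<^sub>R e i \<in> ?A" "(\<Sum>j\<in>F. a j *\<^sub>R e j) \<in> ?B"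
      using insert.hyps by (auto simp: abs_le_iff)
    then show "v \<in> {x + y |x y. x \<in> ?A \<and> y \<in> ?B}" by blast
  qed
  finally show ?case .
qed

text \<open>A multiplier tending to 0 along \<open>I\<close> is the norm limit of its truncations to
  the finite sets where it is at least \<open>d\<close>, and each truncation maps the ball into a
  compact box.\<close>

lemma compact_diag:
  assumes "bdd \<phi>" and fin: "\<And>\<epsilon>. \<epsilon> > 0 \<Longrightarrow> finite {i\<in>I. \<bar>\<phi> i\<bar> \<ge> \<epsilon>}"
  shows "compact (closure (diag \<phi> ` cball 0 r))"
proof (rule compact_closure_approx)
  fix \<epsilon> :: real assume "\<epsilon> > 0"
  obtain B where B: "\<And>i. i \<in> I \<Longrightarrow> \<bar>\<phi> i\<bar> \<le> B"
    using assms unfolding bdd_def by blast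
  define d where "d = \<epsilon> / (\<bar>r\<bar> + 1)"
  have d: "d > 0" using \<open>\<epsilon> > 0\<close> by (simp add: d_def add_nonneg_pos)
  define F where "F = {i\<in>I. \<bar>\<phi> i\<bar> \<ge> d}"
  have F: "finite F" "F \<subseteq> I" using fin[OF d] by (auto simp: F_def)
  define C where "C = {\<Sum>i\<in>F. a i *\<^sub>R e i | a. \<forall>i\<in>F. \<bar>a i\<bar> \<le> \<bar>B\<bar> * \<bar>r\<bar>}"
  have "\<exists>y\<in>C. dist y (diag \<phi> x) < \<epsilon>" if x: "norm x \<le> r" for x
  proof (rule bexI)
    let ?y = "\<Sum>i\<in>F. (\<phi> i * (x \<bullet> e i)) *\<^sub>R e i"
    have "\<bar>\<phi> i * (x \<bullet> e i)\<bar> \<le> \<bar>B\<bar> * \<bar>r\<bar>" if "i \<in> F" for i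
    proof -
      have "\<bar>x \<bullet> e i\<bar> \<le> \<bar>r\<bar>"
        using Cauchy_Schwarz_ineq2[of x "e i"] x that F(2) by (auto simp: subset_iff)
      then show ?thesis
        unfolding abs_mult using B[of i] that F(2) by (intro mult_mono) auto
    qed
    then show "?y \<in> C" unfolding C_def by (intro CollectI exI conjI) auto
    have "norm (diag \<phi> x - ?y) \<le> d * norm x"
    proof (rule norm_le_coeffs)
      fix i assume i: "i \<in> I"
      show "\<bar>(diag \<phi> x - ?y) \<bullet> e i\<bar> \<le> d * \<bar>x \<bullet> e i\<bar>"
        using d i F by (auto simp: inner_diff_left inner_sum_basis diag_coeff[OF assms(1)] abs_mult F_def
          intro!: mult_right_mono)
    qed (use d in auto)
    also have "\<dots> \<le> d * \<bar>r\<bar>" using x d by (intro mult_left_mono) auto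
    also have "\<dots> < \<epsilon>" using \<open>\<epsilon> > 0\<close> by (simp add: d_def field_simps)
    finally show "dist ?y (diag \<phi> x) < \<epsilon>"
      by (simp add: dist_norm norm_minus_commute)
  qed
  moreover have "compact C" unfolding C_def by (rule compact_finite_combinations[OF F(1)])
  ultimately show "\<exists>C. compact C \<and> (\<forall>x\<in>diag \<phi> ` cball 0 r. \<exists>y\<in>C. dist y x < \<epsilon>)"
    by (auto simp: dist_norm)
qed

end

section \<open>Diagonal operators: self-adjointness, resolvents, spectrum\<close>

lemma closure_eq_UNIV_I:
  fixes S :: "'a::metric_space set"
  assumes "\<And>x \<epsilon>. \<epsilon> > 0 \<Longrightarrow> \<exists>y\<in>S. dist y x < \<epsilon>"
  shows "closure S = UNIV"
  using assms by (auto simp: closure_approachable)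

text \<open>\<open>T\<close> is the maximal multiplication operator: as \<open>y\<close> is a vector
  of the space, the coefficient equations already contain the summability that puts \<open>x\<close>
  into the domain. Together with the upper bound, \<open>discrete\<close> says that the eigenvalues
  can accumulate only at minus infinity and have finite multiplicity.\<close>

locale diagonal_operator = onb e I for e :: "'i \<Rightarrow> 'a::{real_inner,complete_space}" and I +
  fixes \<mu> :: "'i \<Rightarrow> real" and c :: real and T :: "'a operator"
  assumes upper: "i \<in> I \<Longrightarrow> \<mu> i < c"
    and discrete: "finite {i\<in>I. \<mu> i \<ge> M}"
    and T_def: "T = {(x, y). \<forall>i\<in>I. y \<bullet> e i = \<mu> i * (x \<bullet> e i)}"
begin

lemma mem_T: "(x, y) \<in> T \<longleftrightarrow> (\<forall>i\<in>I. y \<bullet> e i = \<mu> i * (x \<bullet> e i))"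
  by (simp add: T_def)

lemma basis_in_T: "i \<in> I \<Longrightarrow> (e i, \<mu> i *\<^sub>R e i) \<in> T"
  by (auto simp: mem_T inner_basis)

lemma sum_basis_in_T:
  assumes "finite F" "F \<subseteq> I"
  shows "(\<Sum>i\<in>F. a i *\<^sub>R e i, \<Sum>i\<in>F. (\<mu> i * a i) *\<^sub>R e i) \<in> T"
  using assms by (auto simp: mem_T inner_sum_basis)

lemma dense_domain: "closure (Domain T) = UNIV"
proof (rule closure_eq_UNIV_I)
  fix x :: 'a and \<epsilon> :: real assume "\<epsilon> > 0"
  then have "\<forall>\<^sub>F F in finite_subsets_at_top I. dist (\<Sum>i\<in>F. (x \<bullet> e i) *\<^sub>R e i) x < \<epsilon>"
    using expansion[of x] unfolding has_sum_def by (intro tendstoD)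
  then obtain F where F: "finite F" "F \<subseteq> I" "dist (\<Sum>i\<in>F. (x \<bullet> e i) *\<^sub>R e i) x < \<epsilon>"
    by (auto simp: eventually_finite_subsets_at_top)
  then show "\<exists>y\<in>Domain T. dist y x < \<epsilon>"
    using DomainI[OF sum_basis_in_T[OF F(1,2), of "\<lambda>i. x \<bullet> e i"]] by blast
qed

lemma symmetric:
  assumes "(x, w) \<in> T" "(y, z) \<in> T"
  shows "w \<bullet> y = x \<bullet> z"
proof -
  have "((\<lambda>i. (x \<bullet> e i) * (z \<bullet> e i)) has_sum (w \<bullet> y)) I"
    by (rule has_sum_cong[THEN iffD1, OF _ parseval[of w y]]) (use assms in \<open>auto simp: mem_T\<close>)
  then show ?thesis using parseval has_sum_unique by blast
qed

text \<open>A pair in the adjoint is tested on the basis vectors only; the coefficient equations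
  that result are the definition of the maximal operator.\<close>

lemma selfadjoint: "selfadjoint_op T"
  unfolding selfadjoint_op_def
proof (intro conjI dense_domain)
  show "single_valued T"
    by (auto simp: single_valued_def mem_T intro!: eqI)
  show "adjoint_op T = T"
  proof (intro equalityI subsetI)
    fix p assume "p \<in> T"
    then show "p \<in> adjoint_op T"
      by (cases p) (auto simp: adjoint_op_def symmetric)
  next
    fix p assume p: "p \<in> adjoint_op T"
    obtain y z where yz: "p = (y, z)" by (cases p)
    have "z \<bullet> e i = \<mu> i * (y \<bullet> e i)" if "i \<in> I" for i
      using p basis_in_T[OF that] by (auto simp: yz adjoint_op_def inner_commute)
    then show "p \<in> T" by (simp add: yz mem_T)
  qed
qed

lemma resolvent_coeff:
  "\<bar>1 / (c - \<mu> i)\<bar> = 1 / (c - \<mu> i)" if "i \<in> I"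
  using upper[OF that] by simp

lemma finite_ge_ex_max:
  assumes "finite {i\<in>I. (\<phi> i :: real) \<ge> K}"
  shows "\<exists>B. \<forall>i\<in>I. \<phi> i \<le> B"
proof -
  have "\<phi> i \<le> Max (insert K (\<phi> ` {i\<in>I. \<phi> i \<ge> K}))" if "i \<in> I" for i
    using assms that by (cases "\<phi> i \<ge> K") (auto intro!: Max_ge simp: Max_ge_iff)
  then show ?thesis by blast
qed

text \<open>The strict bound \<open>\<mu> i < c\<close> alone does not keep
  \<open>c - \<mu> i\<close> away from 0. Discreteness does, since only finitely many eigenvalues
  reach \<open>c - 1\<close>.\<close>

lemma bdd_resolvent: "bdd (\<lambda>i. 1 / (c - \<mu> i))"
proof -
  have "{i\<in>I. 1 / (c - \<mu> i) \<ge> 1} \<subseteq> {i\<in>I. \<mu> i \<ge> c - 1}"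
    using upper by (auto simp: field_simps)
  then have "finite {i\<in>I. 1 / (c - \<mu> i) \<ge> 1}"
    using discrete finite_subset by blast
  from finite_ge_ex_max[OF this] show ?thesis
    unfolding bdd_def using resolvent_coeff by simp
qed

lemma compact_resolvent_c: "compact (closure (diag (\<lambda>i. 1 / (c - \<mu> i)) ` cball 0 r))"
proof (rule compact_diag[OF bdd_resolvent])
  fix \<epsilon> :: real assume "\<epsilon> > 0"
  have "{i\<in>I. \<bar>1 / (c - \<mu> i)\<bar> \<ge> \<epsilon>} \<subseteq> {i\<in>I. \<mu> i \<ge> c - 1 / \<epsilon>}"
  proof safe
    fix i assume i: "i \<in> I" "\<epsilon> \<le> \<bar>1 / (c - \<mu> i)\<bar>"
    then show "c - 1 / \<epsilon> \<le> \<mu> i"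
      using upper[OF i(1)] resolvent_coeff[OF i(1)] \<open>\<epsilon> > 0\<close> by (simp add: field_simps)
  qed
  then show "finite {i\<in>I. \<bar>1 / (c - \<mu> i)\<bar> \<ge> \<epsilon>}"
    using discrete finite_subset by blast
qed

lemma T_resolvent_c:
  assumes "(x, y) \<in> T"
  shows "x = diag (\<lambda>i. 1 / (c - \<mu> i)) (c *\<^sub>R x - y)"
proof (rule eqI)
  fix i assume i: "i \<in> I"
  have "(c *\<^sub>R x - y) \<bullet> e i = (c - \<mu> i) * (x \<bullet> e i)"
    using assms i by (simp add: mem_T inner_diff_left left_diff_distrib)
  then show "x \<bullet> e i = diag (\<lambda>i. 1 / (c - \<mu> i)) (c *\<^sub>R x - y) \<bullet> e i"
    using upper[OF i] by (simp add: diag_coeff[OF bdd_resolvent i])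
qed

definition no_eigenvalue :: "complex \<Rightarrow> bool" where
  "no_eigenvalue \<zeta> \<longleftrightarrow> (\<forall>i\<in>I. \<zeta> \<noteq> of_real (\<mu> i))"

lemma bdd_complex_resolvent:
  assumes "no_eigenvalue \<zeta>"
  shows "bdd (\<lambda>i. Re (1 / (\<zeta> - of_real (\<mu> i))))" "bdd (\<lambda>i. Im (1 / (\<zeta> - of_real (\<mu> i))))"
proof -
  let ?\<phi> = "\<lambda>i. cmod (1 / (\<zeta> - of_real (\<mu> i)))"
  have "{i\<in>I. ?\<phi> i \<ge> 1} \<subseteq> {i\<in>I. \<mu> i \<ge> Re \<zeta> - 1}"
  proof safe
    fix i assume i: "i \<in> I" "1 \<le> ?\<phi> i"
    have "\<zeta> - of_real (\<mu> i) \<noteq> 0" using assms i by (auto simp: no_eigenvalue_def)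
    then have "cmod (\<zeta> - of_real (\<mu> i)) \<le> 1"
      using i(2) by (simp add: norm_divide field_simps)
    then show "\<mu> i \<ge> Re \<zeta> - 1"
      using abs_Re_le_cmod[of "\<zeta> - of_real (\<mu> i)"] by simp
  qed
  then have "finite {i\<in>I. ?\<phi> i \<ge> 1}"
    using discrete finite_subset by blast
  then obtain B where B: "\<And>i. i \<in> I \<Longrightarrow> ?\<phi> i \<le> B"
    using finite_ge_ex_max[of 1 ?\<phi>] by blast
  show "bdd (\<lambda>i. Re (1 / (\<zeta> - of_real (\<mu> i))))" "bdd (\<lambda>i. Im (1 / (\<zeta> - of_real (\<mu> i))))"
    unfolding bdd_def
    by (meson B abs_Re_le_cmod abs_Im_le_cmod order_trans)+
qed

lemma in_resolvent_set:
  assumes "no_eigenvalue \<zeta>"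
  shows "\<zeta> \<in> resolvent_set T"
proof -
  \<comment> \<open>The complex multiplier 1/(\<zeta> - \<mu>) acts on pairs standing for x + iy as
    a 2 x 2 matrix of real multipliers, with entries \<alpha> and \<beta>. The facts
    \<open>inv1\<close> and \<open>inv2\<close> are the real and imaginary parts of the identity
    that defines the inverse.\<close>
  define \<alpha> where "\<alpha> i = Re (1 / (\<zeta> - of_real (\<mu> i)))" for i
  define \<beta> where "\<beta> i = Im (1 / (\<zeta> - of_real (\<mu> i)))" for i
  have ab: "bdd \<alpha>" "bdd \<beta>"
    unfolding \<alpha>_def \<beta>_def using bdd_complex_resolvent[OF assms] by auto
  have inv1: "\<alpha> i * (Re \<zeta> - \<mu> i) - \<beta> i * Im \<zeta> = 1" 
    and inv2: "\<beta> i * (Re \<zeta> - \<mu> i) + \<alpha> i * Im \<zeta> = 0" if "i \<in> I" for i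
  proof -
    have "\<zeta> - of_real (\<mu> i) \<noteq> 0" using assms that by (auto simp: no_eigenvalue_def)
    then have "(1 / (\<zeta> - of_real (\<mu> i))) * (\<zeta> - of_real (\<mu> i)) = 1" by simp
    then have "Re ((1 / (\<zeta> - of_real (\<mu> i))) * (\<zeta> - of_real (\<mu> i))) = 1"
      "Im ((1 / (\<zeta> - of_real (\<mu> i))) * (\<zeta> - of_real (\<mu> i))) = 0" by simp_all
    then show "\<alpha> i * (Re \<zeta> - \<mu> i) - \<beta> i * Im \<zeta> = 1" "\<beta> i * (Re \<zeta> - \<mu> i) + \<alpha> i * Im \<zeta> = 0"
      by (simp_all only: times_complex.sel \<alpha>_def[symmetric] \<beta>_def[symmetric]) auto
  qed
  define R where "R p = (diag \<alpha> (fst p) - diag \<beta> (snd p), diag \<beta> (fst p) + diag \<alpha> (snd p))" for p :: "'a \<times> 'a"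
  have "bounded_linear R"
    unfolding R_def
    by (intro bounded_linear_Pair bounded_linear_sub bounded_linear_add
        bounded_linear_compose[OF bounded_linear_diag] ab bounded_linear_fst bounded_linear_snd)
  moreover have "resolvent_op T \<zeta> = {(p, R p) | p. True}"
  proof (intro equalityI subsetI)
    fix q assume "q \<in> resolvent_op T \<zeta>"
    then obtain x y u v where q: "q = (cscale \<zeta> (x, y) - (u, v), (x, y))" "(x, u) \<in> T" "(y, v) \<in> T"
      by (auto simp: resolvent_op_def complexify_op_def)
    have "R (cscale \<zeta> (x, y) - (u, v)) = (x, y)"
    proof -
      have "diag \<alpha> (Re \<zeta> *\<^sub>R x - Im \<zeta> *\<^sub>R y - u) - diag \<beta> (Im \<zeta> *\<^sub>R x + Re \<zeta> *\<^sub>R y - v) = x"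
      proof (rule eqI)
        fix i assume i: "i \<in> I"
        have "(diag \<alpha> (Re \<zeta> *\<^sub>R x - Im \<zeta> *\<^sub>R y - u) - diag \<beta> (Im \<zeta> *\<^sub>R x + Re \<zeta> *\<^sub>R y - v)) \<bullet> e i =
          (\<alpha> i * (Re \<zeta> - \<mu> i) - \<beta> i * Im \<zeta>) * (x \<bullet> e i) - (\<beta> i * (Re \<zeta> - \<mu> i) + \<alpha> i * Im \<zeta>) * (y \<bullet> e i)"
          using q(2,3) i by (simp add: mem_T inner_diff_left inner_add_left diag_coeff ab) (simp add: algebra_simps)
        then show "(diag \<alpha> (Re \<zeta> *\<^sub>R x - Im \<zeta> *\<^sub>R y - u) - diag \<beta> (Im \<zeta> *\<^sub>R x + Re \<zeta> *\<^sub>R y - v)) \<bullet> e i = x \<bullet> e i"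
          using inv1[OF i] inv2[OF i] by simp
      qed
      moreover have "diag \<beta> (Re \<zeta> *\<^sub>R x - Im \<zeta> *\<^sub>R y - u) + diag \<alpha> (Im \<zeta> *\<^sub>R x + Re \<zeta> *\<^sub>R y - v) = y"
      proof (rule eqI)
        fix i assume i: "i \<in> I"
        have "(diag \<beta> (Re \<zeta> *\<^sub>R x - Im \<zeta> *\<^sub>R y - u) + diag \<alpha> (Im \<zeta> *\<^sub>R x + Re \<zeta> *\<^sub>R y - v)) \<bullet> e i =
          (\<beta> i * (Re \<zeta> - \<mu> i) + \<alpha> i * Im \<zeta>) * (x \<bullet> e i) + (\<alpha> i * (Re \<zeta> - \<mu> i) - \<beta> i * Im \<zeta>) * (y \<bullet> e i)"
          using q(2,3) i by (simp add: mem_T inner_diff_left inner_add_left diag_coeff ab) (simp add: algebra_simps)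
        then show "(diag \<beta> (Re \<zeta> *\<^sub>R x - Im \<zeta> *\<^sub>R y - u) + diag \<alpha> (Im \<zeta> *\<^sub>R x + Re \<zeta> *\<^sub>R y - v)) \<bullet> e i = y \<bullet> e i"
          using inv1[OF i] inv2[OF i] by simp
      qed
      ultimately show ?thesis by (simp add: R_def cscale_def)
    qed
    then show "q \<in> {(p, R p) | p. True}" using q(1) by (metis (mono_tags, lifting) mem_Collect_eq)
  next
    fix q assume "q \<in> {(p, R p) | p. True}"
    then obtain y1 y2 where q: "q = ((y1, y2), R (y1, y2))" by auto
    define x1 where "x1 = diag \<alpha> y1 - diag \<beta> y2"
    define x2 where "x2 = diag \<beta> y1 + diag \<alpha> y2"
    define w1 where "w1 = Re \<zeta> *\<^sub>R x1 - Im \<zeta> *\<^sub>R x2 - y1"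
    define w2 where "w2 = Im \<zeta> *\<^sub>R x1 + Re \<zeta> *\<^sub>R x2 - y2"
    have "(x1, w1) \<in> T" unfolding mem_T
    proof
      fix i assume i: "i \<in> I"
      have "w1 \<bullet> e i - \<mu> i * (x1 \<bullet> e i) = (\<alpha> i * (Re \<zeta> - \<mu> i) - \<beta> i * Im \<zeta> - 1) * (y1 \<bullet> e i)
          - (\<beta> i * (Re \<zeta> - \<mu> i) + \<alpha> i * Im \<zeta>) * (y2 \<bullet> e i)"
        using i by (simp add: w1_def x1_def x2_def inner_diff_left inner_add_left diag_coeff ab) (simp add: algebra_simps)
      then show "w1 \<bullet> e i = \<mu> i * (x1 \<bullet> e i)"
        using inv1[OF i] inv2[OF i] by simp
    qed
    moreover have "(x2, w2) \<in> T" unfolding mem_T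
    proof
      fix i assume i: "i \<in> I"
      have "w2 \<bullet> e i - \<mu> i * (x2 \<bullet> e i) = (\<beta> i * (Re \<zeta> - \<mu> i) + \<alpha> i * Im \<zeta>) * (y1 \<bullet> e i)
          + (\<alpha> i * (Re \<zeta> - \<mu> i) - \<beta> i * Im \<zeta> - 1) * (y2 \<bullet> e i)"
        using i by (simp add: w2_def x1_def x2_def inner_diff_left inner_add_left diag_coeff ab) (simp add: algebra_simps)
      then show "w2 \<bullet> e i = \<mu> i * (x2 \<bullet> e i)"
        using inv1[OF i] inv2[OF i] by simp
    qed
    moreover have "q = (cscale \<zeta> (x1, x2) - (w1, w2), (x1, x2))"
      by (simp add: q R_def cscale_def w1_def w2_def x1_def x2_def)
    ultimately show "q \<in> resolvent_op T \<zeta>"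
      unfolding resolvent_op_def complexify_op_def by blast
  qed
  ultimately show ?thesis unfolding resolvent_set_def by blast
qed

lemma eigenvalue_iff: "eigenvalue_op T \<nu> \<longleftrightarrow> (\<exists>i\<in>I. \<nu> = \<mu> i)"
proof
  assume "eigenvalue_op T \<nu>"
  then obtain u where u: "u \<noteq> 0" "(u, \<nu> *\<^sub>R u) \<in> T" by (auto simp: eigenvalue_op_def)
  then obtain i where i: "i \<in> I" "u \<bullet> e i \<noteq> 0" using total by blast
  then show "\<exists>i\<in>I. \<nu> = \<mu> i" using u(2) by (auto simp: mem_T)
next
  assume "\<exists>i\<in>I. \<nu> = \<mu> i"
  then show "eigenvalue_op T \<nu>"
    unfolding eigenvalue_op_def using basis_in_T norm_basis by (metis norm_zero zero_neq_one)
qed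

lemma spectrum_subset: "spectrum_op T \<subseteq> complex_of_real ` {\<nu>. eigenvalue_op T \<nu>}"
proof
  fix \<zeta> assume "\<zeta> \<in> spectrum_op T"
  then have "\<not> no_eigenvalue \<zeta>" using in_resolvent_set by (auto simp: spectrum_op_def)
  then show "\<zeta> \<in> complex_of_real ` {\<nu>. eigenvalue_op T \<nu>}"
    by (auto simp: no_eigenvalue_def eigenvalue_iff)
qed

text \<open>Compactness is demanded at every point of the resolvent set, where the resolvent is only
  known to be some bounded \<open>R\<close>. Its values have components in the domain of
  \<open>T\<close>, and there x = (c - T)^(-1) (c x - T x) with c x - T x bounded; so both
  components land in one compact set that belongs to the single point \<open>c\<close>.\<close>

lemma compact_resolvent: "compact_resolvent T"
  unfolding compact_resolvent_def
proof (intro conjI ballI)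
  have "no_eigenvalue (of_real c)" using upper by (force simp: no_eigenvalue_def)
  then show "resolvent_set T \<noteq> {}" using in_resolvent_set by blast
  fix \<zeta> assume "\<zeta> \<in> resolvent_set T"
  then obtain R where R: "bounded_linear R" "resolvent_op T \<zeta> = {(x, R x) | x. True}"
    by (auto simp: resolvent_set_def)
  obtain B where B: "\<And>p. norm (R p) \<le> norm p * B" "B \<ge> 0"
    using bounded_linear.nonneg_bounded[OF R(1)] by blast
  \<comment> \<open>\<open>B\<close> bounds \<open>x\<close> and \<open>y\<close>. The vectors
    \<open>u\<close> and \<open>v\<close> are combinations of these with the real and imaginary
    parts of \<zeta>, up to a component of \<open>p\<close> of norm at most 1.\<close>
  define M where "M = \<bar>c\<bar> * B + (\<bar>Re \<zeta>\<bar> + \<bar>Im \<zeta>\<bar>) * B + 1"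
  define A where "A = closure (diag (\<lambda>i. 1 / (c - \<mu> i)) ` cball 0 M)"
  have A: "compact A" unfolding A_def by (rule compact_resolvent_c)
  have "resolvent_op T \<zeta> `` cball 0 1 \<subseteq> A \<times> A"
  proof
    fix q assume "q \<in> resolvent_op T \<zeta> `` cball 0 1"
    then obtain p where p: "norm p \<le> 1" "(p, q) \<in> resolvent_op T \<zeta>" by auto
    then obtain x y u v where q: "q = (x, y)" "p = cscale \<zeta> (x, y) - (u, v)" "(x, u) \<in> T" "(y, v) \<in> T"
      by (auto simp: resolvent_op_def complexify_op_def)
    have "q = R p" using p(2) R(2) by auto
    then have "norm q \<le> norm p * B" using B by simp
    also have "\<dots> \<le> B" using p(1) B(2) by (simp add: mult_left_le_one_le)
    finally have qB: "norm q \<le> B" .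
    then have x: "norm x \<le> B" and y: "norm y \<le> B"
      using norm_fst_le[of x y] norm_snd_le[of y x] by (auto simp: q(1) intro: order_trans)
    have p1: "norm (fst p) \<le> 1" "norm (snd p) \<le> 1"
      using p(1) norm_fst_le[of "fst p" "snd p"] norm_snd_le[of "snd p" "fst p"] by auto
    have s: "norm (r *\<^sub>R z) \<le> \<bar>r\<bar> * B" if "norm z \<le> B" for r and z :: 'a
      using that by (simp add: mult_left_mono)
    have "u = Re \<zeta> *\<^sub>R x - Im \<zeta> *\<^sub>R y - fst p" "v = Im \<zeta> *\<^sub>R x + Re \<zeta> *\<^sub>R y - snd p"
      by (simp_all add: q(2) cscale_def)
    then have "norm u \<le> \<bar>Re \<zeta>\<bar> * B + \<bar>Im \<zeta>\<bar> * B + 1" "norm v \<le> \<bar>Im \<zeta>\<bar> * B + \<bar>Re \<zeta>\<bar> * B + 1"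
      using s[OF x] s[OF y] p1
      by (auto intro!: norm_triangle_le_diff norm_triangle_le add_mono)
    then have "norm (c *\<^sub>R x - u) \<le> M" "norm (c *\<^sub>R y - v) \<le> M"
      using s[OF x, of c] s[OF y, of c] unfolding M_def 
      by (auto intro!: norm_triangle_le_diff simp: algebra_simps)
    then have "x \<in> A" "y \<in> A"
      unfolding A_def using T_resolvent_c[OF q(3)] T_resolvent_c[OF q(4)]
      by (auto intro!: closure_subset[THEN subsetD] simp: image_iff)
    then show "q \<in> A \<times> A" by (simp add: q(1))
  qed
  then have "closure (resolvent_op T \<zeta> `` cball 0 1) \<subseteq> A \<times> A"
    using A by (intro closure_minimal) (auto intro: compact_imp_closed compact_Times)
  then show "compact (closure (resolvent_op T \<zeta> `` cball 0 1))"
    using A by (metis closed_closure compact_Int_closed compact_Times inf.absorb2)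
qed

section \<open>The semigroup of a diagonal operator and its generator\<close>

definition exp_semigroup :: "real \<Rightarrow> 'a \<Rightarrow> 'a" where
  "exp_semigroup t = diag (\<lambda>i. exp (\<mu> i * t))"

lemma exp_bound:
  assumes "i \<in> I" "t \<ge> 0" "t \<le> r"
  shows "\<bar>exp (\<mu> i * t)\<bar> \<le> exp (\<bar>c\<bar> * r)"
proof -
  have "\<mu> i * t \<le> \<bar>c\<bar> * t" using upper[OF assms(1)] assms(2) by (intro mult_right_mono) auto
  also have "\<dots> \<le> \<bar>c\<bar> * r" using assms by (intro mult_left_mono) auto
  finally show ?thesis by simp
qed

lemma bdd_exp: "t \<ge> 0 \<Longrightarrow> bdd (\<lambda>i. exp (\<mu> i * t))"
  unfolding bdd_def using exp_bound[of _ t t] by blast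

lemma C0_exp_semigroup: "C0_semigroup exp_semigroup"
  unfolding C0_semigroup_def
proof (intro conjI allI impI)
  show "bounded_linear (exp_semigroup t)" if "t \<ge> 0" for t
    unfolding exp_semigroup_def using bounded_linear_diag[OF bdd_exp[OF that]] .
  show "exp_semigroup 0 x = x" for x
    by (rule eqI) (use bdd_exp[of 0] in \<open>simp add: exp_semigroup_def diag_coeff\<close>)
  show "exp_semigroup (s + t) x = exp_semigroup s (exp_semigroup t x)" if "0 \<le> s" "0 \<le> t" for s t x
    by (rule eqI) (use that in \<open>simp add: exp_semigroup_def diag_coeff bdd_exp, simp add: exp_add distrib_left\<close>)
  show "continuous_on {0..} (\<lambda>t. exp_semigroup t x)" for x
    unfolding continuous_on_def exp_semigroup_def
  proof
    fix t :: real assume t: "t \<in> {0..}"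
    show "((\<lambda>t. diag (\<lambda>i. exp (\<mu> i * t)) x) \<longlongrightarrow> diag (\<lambda>i. exp (\<mu> i * t)) x) (at t within {0..})"
    proof (rule diag_tendsto)
      have "\<forall>\<^sub>F s in at t within {0..}. s < t + 1 \<and> s \<in> {0..}"
        by (intro eventually_conj eventually_at_topological[THEN iffD2] exI[of _ "{..<t+1}"]) (auto simp: eventually_at_filter)
      then show "\<forall>\<^sub>F s in at t within {0..}. \<forall>i\<in>I. \<bar>exp (\<mu> i * s)\<bar> \<le> exp (\<bar>c\<bar> * (t + 1))"
        by eventually_elim (use exp_bound in auto)
    qed (use t exp_bound in \<open>auto intro!: tendsto_intros\<close>)
  qed
qed

text \<open>This is the multiplier of the difference quotient composed with the resolvent at
  \<open>c + 1\<close>. It is bounded uniformly in \<open>i\<close>, since |exp(\<mu> t) - 1| is at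
  most a constant times t |\<mu>|, and |\<mu>| is controlled by c + 1 - \<mu>. The choice of
  \<open>c + 1\<close> makes this denominator greater than 1.\<close>

lemma exp_quotient_bound:
  assumes "i \<in> I" "0 < t" "t \<le> 1"
  shows "\<bar>(exp (\<mu> i * t) - 1) / t * (1 / (c + 1 - \<mu> i))\<bar> \<le> (\<bar>c\<bar> + 1) * exp \<bar>c\<bar> + 1"
proof -
  have pos: "c + 1 - \<mu> i > 1" using upper[OF assms(1)] by simp
  have "\<bar>exp (\<mu> i * t) - 1\<bar> \<le> t * \<bar>\<mu> i\<bar> * exp (\<bar>c\<bar>)" if "\<mu> i \<ge> 0"
  proof -
    \<comment> \<open>From exp(-s) >= 1 - s follows exp s - 1 <= s exp s, with s =
      \<open>\<mu> i * t\<close>.\<close>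
    have "1 - \<mu> i * t \<le> exp (- (\<mu> i * t))" using exp_ge_add_one_self[of "- (\<mu> i * t)"] by simp
    then have "(1 - \<mu> i * t) * exp (\<mu> i * t) \<le> 1"
      by (metis exp_minus_inverse exp_ge_zero mult.commute mult_left_mono)
    then have "exp (\<mu> i * t) - 1 \<le> \<mu> i * t * exp (\<mu> i * t)" by (simp add: algebra_simps)
    also have "\<dots> \<le> \<mu> i * t * exp \<bar>c\<bar>"
      using exp_bound[of i t 1] assms that by (intro mult_left_mono) auto
    finally show ?thesis using that assms by (simp add: mult.commute)
  qed
  moreover have "\<bar>exp (\<mu> i * t) - 1\<bar> \<le> t * \<bar>\<mu> i\<bar>" if "\<mu> i < 0"
  proof -
    have "exp (\<mu> i * t) \<le> 1" using that assms by (simp add: mult_nonpos_nonneg)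
    then have "\<bar>exp (\<mu> i * t) - 1\<bar> = 1 - exp (\<mu> i * t)" "t * \<bar>\<mu> i\<bar> = - (\<mu> i * t)"
      using that by auto
    then show ?thesis using exp_ge_add_one_self[of "\<mu> i * t"] by linarith
  qed
  ultimately consider "\<mu> i \<ge> 0" "\<bar>exp (\<mu> i * t) - 1\<bar> \<le> t * \<bar>\<mu> i\<bar> * exp (\<bar>c\<bar>)"
    | "\<mu> i < 0" "\<bar>exp (\<mu> i * t) - 1\<bar> \<le> t * \<bar>\<mu> i\<bar>" by fastforce
  then have "\<bar>exp (\<mu> i * t) - 1\<bar> \<le> t * (((\<bar>c\<bar> + 1) * exp \<bar>c\<bar> + 1) * (c + 1 - \<mu> i))"
  proof cases
    case 1
    have "\<bar>\<mu> i\<bar> * exp \<bar>c\<bar> \<le> ((\<bar>c\<bar> + 1) * exp \<bar>c\<bar> + 1) * 1"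
      using 1(1) upper[OF assms(1)] by (simp add: add_increasing2 mult_right_mono)
    also have "\<dots> \<le> ((\<bar>c\<bar> + 1) * exp \<bar>c\<bar> + 1) * (c + 1 - \<mu> i)"
      using pos by (intro mult_left_mono) auto
    finally have "t * (\<bar>\<mu> i\<bar> * exp \<bar>c\<bar>) \<le> t * (((\<bar>c\<bar> + 1) * exp \<bar>c\<bar> + 1) * (c + 1 - \<mu> i))"
      using assms by (intro mult_left_mono) auto
    then show ?thesis using 1(2) by (simp add: mult.assoc)
  next
    case 2
    have "\<bar>\<mu> i\<bar> \<le> \<bar>c\<bar> * 1 + (c + 1 - \<mu> i)" using 2(1) by simp
    also have "\<dots> \<le> \<bar>c\<bar> * (c + 1 - \<mu> i) + (c + 1 - \<mu> i)"
      using pos by (intro add_mono mult_left_mono) auto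
    also have "\<dots> = (\<bar>c\<bar> * 1 + 1) * (c + 1 - \<mu> i)" by (simp add: algebra_simps)
    also have "\<dots> \<le> ((\<bar>c\<bar> + 1) * exp \<bar>c\<bar> + 1) * (c + 1 - \<mu> i)"
      using pos by (intro mult_right_mono add_mono mult_mono) auto
    finally have "t * \<bar>\<mu> i\<bar> \<le> t * (((\<bar>c\<bar> + 1) * exp \<bar>c\<bar> + 1) * (c + 1 - \<mu> i))"
      using assms by (intro mult_left_mono) auto
    then show ?thesis using 2(2) by simp
  qed
  moreover have "t * (c + 1 - \<mu> i) > 0" using pos assms by simp
  moreover have "\<bar>(exp (\<mu> i * t) - 1) / t * (1 / (c + 1 - \<mu> i))\<bar> = \<bar>exp (\<mu> i * t) - 1\<bar> / (t * (c + 1 - \<mu> i))"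
    using pos assms by (simp add: abs_mult)
  ultimately show ?thesis
    by (simp only: pos_divide_le_eq) (simp only: mult_ac)
qed

text \<open>A limit of difference quotients yields the coefficient equations of \<open>T\<close>.
  Conversely, a vector of the domain is the resolvent at \<open>c + 1\<close> applied to some
  \<open>h\<close>; this turns the quotient on \<open>x\<close>, whose multipliers are unbounded,
  into a uniformly bounded family on \<open>h\<close>, to which \<open>diag_tendsto\<close>
  applies.\<close>

lemma generator_exp_semigroup: "generator exp_semigroup = T"
proof (intro equalityI subsetI)
  fix p assume p: "p \<in> generator exp_semigroup"
  obtain x y where xy: "p = (x, y)" by (cases p)
  have lim: "((\<lambda>t. (exp_semigroup t x - x) /\<^sub>R t) \<longlongrightarrow> y) (at_right 0)"
    using p by (simp add: xy generator_def)
  have "y \<bullet> e i = \<mu> i * (x \<bullet> e i)" if i: "i \<in> I" for i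
  proof -
    have "((\<lambda>t. ((exp_semigroup t x - x) /\<^sub>R t) \<bullet> e i) \<longlongrightarrow> y \<bullet> e i) (at_right 0)"
      by (intro tendsto_intros lim)
    moreover have "\<forall>\<^sub>F t in at_right 0. ((exp_semigroup t x - x) /\<^sub>R t) \<bullet> e i = (exp (\<mu> i * t) - 1) / t * (x \<bullet> e i)"
      using eventually_at_right_less[of 0]
      by eventually_elim (use i bdd_exp in \<open>simp add: inner_diff_left exp_semigroup_def diag_coeff field_simps\<close>)
    ultimately have "((\<lambda>t. (exp (\<mu> i * t) - 1) / t * (x \<bullet> e i)) \<longlongrightarrow> y \<bullet> e i) (at_right 0)"
      by (rule Lim_transform_eventually)
    moreover have "((\<lambda>t. (exp (\<mu> i * t) - 1) / t * (x \<bullet> e i)) \<longlongrightarrow> \<mu> i * (x \<bullet> e i)) (at_right 0)"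
    proof (intro tendsto_intros)
      have "((\<lambda>t. exp (\<mu> i * t)) has_field_derivative \<mu> i) (at 0)"
        by (auto intro!: derivative_eq_intros)
      then have "((\<lambda>t. (exp (\<mu> i * t) - 1) / t) \<longlongrightarrow> \<mu> i) (at 0)"
        by (simp add: has_field_derivative_iff)
      then show "((\<lambda>t. (exp (\<mu> i * t) - 1) / t) \<longlongrightarrow> \<mu> i) (at_right 0)"
        by (rule tendsto_within_subset) auto
    qed
    ultimately show ?thesis
      by (intro tendsto_unique[OF trivial_limit_at_right_real]) auto
  qed
  then show "p \<in> T" by (simp add: xy mem_T)
next
  fix p assume p: "p \<in> T"
  obtain x y where xy: "p = (x, y)" by (cases p)
  define h where "h = (c + 1) *\<^sub>R x - y"
  have hi: "h \<bullet> e i = (c + 1 - \<mu> i) * (x \<bullet> e i)" "y \<bullet> e i = \<mu> i * (x \<bullet> e i)" if "i \<in> I" for i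
    using p that by (auto simp: xy mem_T h_def inner_diff_left algebra_simps)
  define B where "B = (\<bar>c\<bar> + 1) * exp \<bar>c\<bar> + 1"
  have psi: "\<bar>\<mu> i * (1 / (c + 1 - \<mu> i))\<bar> \<le> B" and 
       lim: "((\<lambda>t. (exp (\<mu> i * t) - 1) / t * (1 / (c + 1 - \<mu> i))) \<longlongrightarrow> \<mu> i * (1 / (c + 1 - \<mu> i))) (at_right 0)"
       if i: "i \<in> I" for i
  proof -
    have "((\<lambda>t. exp (\<mu> i * t)) has_field_derivative \<mu> i) (at 0)"
      by (auto intro!: derivative_eq_intros)
    then have "((\<lambda>t. (exp (\<mu> i * t) - 1) / t) \<longlongrightarrow> \<mu> i) (at 0)"
      by (simp add: has_field_derivative_iff)
    then have "((\<lambda>t. (exp (\<mu> i * t) - 1) / t) \<longlongrightarrow> \<mu> i) (at_right 0)"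
      by (rule tendsto_within_subset) auto
    then show lim: "((\<lambda>t. (exp (\<mu> i * t) - 1) / t * (1 / (c + 1 - \<mu> i))) \<longlongrightarrow> \<mu> i * (1 / (c + 1 - \<mu> i))) (at_right 0)"
      by (intro tendsto_intros)
    have "\<forall>\<^sub>F t in at_right 0. 0 < t \<and> t < (1::real)"
      by (intro eventually_at_rightI[of 0 1]) auto
    then have "\<forall>\<^sub>F t in at_right 0. \<bar>(exp (\<mu> i * t) - 1) / t * (1 / (c + 1 - \<mu> i))\<bar> \<le> B"
      by eventually_elim (use exp_quotient_bound[OF i] in \<open>simp add: B_def\<close>)
    then show "\<bar>\<mu> i * (1 / (c + 1 - \<mu> i))\<bar> \<le> B"
      by (rule tendsto_upperbound[OF tendsto_rabs[OF lim] _ trivial_limit_at_right_real])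
  qed
  have "\<forall>\<^sub>F t in at_right 0. 0 < t \<and> t < (1::real)"
    by (intro eventually_at_rightI[of 0 1]) auto
  then have ev: "\<forall>\<^sub>F t in at_right 0. \<forall>i\<in>I. \<bar>(exp (\<mu> i * t) - 1) / t * (1 / (c + 1 - \<mu> i))\<bar> \<le> B"
    by eventually_elim (use exp_quotient_bound in \<open>simp add: B_def\<close>)
  have "((\<lambda>t. diag (\<lambda>i. (exp (\<mu> i * t) - 1) / t * (1 / (c + 1 - \<mu> i))) h) \<longlongrightarrow>
      diag (\<lambda>i. \<mu> i * (1 / (c + 1 - \<mu> i))) h) (at_right 0)"
    by (rule diag_tendsto[OF ev lim psi])
  moreover have "diag (\<lambda>i. \<mu> i * (1 / (c + 1 - \<mu> i))) h = y"
  proof (rule eqI)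
    fix i assume i: "i \<in> I"
    have "bdd (\<lambda>i. \<mu> i * (1 / (c + 1 - \<mu> i)))" using psi by (auto simp: bdd_def)
    then show "diag (\<lambda>i. \<mu> i * (1 / (c + 1 - \<mu> i))) h \<bullet> e i = y \<bullet> e i"
      using upper[OF i] by (simp add: diag_coeff i hi)
  qed
  moreover have "\<forall>\<^sub>F t in at_right 0. diag (\<lambda>i. (exp (\<mu> i * t) - 1) / t * (1 / (c + 1 - \<mu> i))) h = (exp_semigroup t x - x) /\<^sub>R t"
    using ev eventually_at_right_less[of 0]
  proof eventually_elim
    case (elim t)
    show ?case
    proof (rule eqI)
      fix i assume i: "i \<in> I"
      have "bdd (\<lambda>i. (exp (\<mu> i * t) - 1) / t * (1 / (c + 1 - \<mu> i)))" using elim(1) by (auto simp: bdd_def)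
      moreover have "c + 1 - \<mu> i > 0" using upper[OF i] by simp
      ultimately have "diag (\<lambda>i. (exp (\<mu> i * t) - 1) / t * (1 / (c + 1 - \<mu> i))) h \<bullet> e i = (exp (\<mu> i * t) - 1) / t * (x \<bullet> e i)"
        using i by (simp add: diag_coeff hi)
      then show "diag (\<lambda>i. (exp (\<mu> i * t) - 1) / t * (1 / (c + 1 - \<mu> i))) h \<bullet> e i = ((exp_semigroup t x - x) /\<^sub>R t) \<bullet> e i"
        using elim(2) i bdd_exp[of t] by (simp add: diag_coeff exp_semigroup_def inner_diff_left left_diff_distrib right_diff_distrib divide_inverse mult.commute)
    qed
  qed
  ultimately have "((\<lambda>t. (exp_semigroup t x - x) /\<^sub>R t) \<longlongrightarrow> y) (at_right 0)"
    by (auto intro: Lim_transform_eventually)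
  then show "p \<in> generator exp_semigroup" by (simp add: xy generator_def)
qed

end

section \<open>The spectral theorem for compact positive operators\<close>

text \<open>For 0 <= A <= C one has A^2 <= C A; the test vector x - A x / C extracts this from
  positivity and the norm bound. Positivity is asked only on an invariant subspace, because \<nu> -
  R will have no more than that.\<close>

lemma positive_form_norm_bound:
  fixes A :: "'a::real_inner \<Rightarrow> 'a"
  assumes lin: "linear A" and sym: "\<And>x y. A x \<bullet> y = x \<bullet> A y"
    and W: "subspace W" "\<And>x. x \<in> W \<Longrightarrow> A x \<in> W"
    and pos: "\<And>x. x \<in> W \<Longrightarrow> 0 \<le> A x \<bullet> x"
    and C: "C > 0" "\<And>x. norm (A x) \<le> C * norm x" and x: "x \<in> W"
  shows "(norm (A x))\<^sup>2 \<le> C * (A x \<bullet> x)"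
proof -
  define y where "y = x - (1/C) *\<^sub>R A x"
  have "y \<in> W" unfolding y_def using W x by (intro subspace_diff subspace_scale) auto
  then have "0 \<le> A y \<bullet> y" by (rule pos)
  also have "A y = A x - (1/C) *\<^sub>R A (A x)"
    by (simp add: y_def linear_diff[OF lin] linear_scale[OF lin])
  also have "(A x - (1/C) *\<^sub>R A (A x)) \<bullet> y = A x \<bullet> x - (2/C) * (A x \<bullet> A x) + (1/C) * ((1/C) * (A (A x) \<bullet> A x))"
    using sym[of "A x" x]
    by (simp add: y_def inner_diff_left inner_diff_right inner_commute)
  also have "\<dots> \<le> A x \<bullet> x - (2/C) * (A x \<bullet> A x) + (1/C) * (A x \<bullet> A x)"
  proof -
    have "A (A x) \<bullet> A x \<le> norm (A (A x)) * norm (A x)" by (rule norm_cauchy_schwarz)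
    also have "\<dots> \<le> C * norm (A x) * norm (A x)" by (intro mult_right_mono C) auto
    also have "\<dots> = C * (A x \<bullet> A x)" by (simp add: power2_norm_eq_inner[symmetric] power2_eq_square)
    finally have "(1/C) * (A (A x) \<bullet> A x) \<le> A x \<bullet> A x"
      using C(1) by (simp add: field_simps)
    then show ?thesis using C(1) by (intro add_left_mono mult_left_mono) auto
  qed
  finally show ?thesis
    using C(1) by (simp add: power2_norm_eq_inner field_simps)
qed

text \<open>Maximize the quadratic form of R on the unit sphere of \<open>W\<close>. The preceding
  bound, applied to \<nu> - R, shows that a maximizing sequence consists of approximate
  eigenvectors; compactness makes R y converge along a subsequence, and y converges with it because
  \<nu> > 0.\<close>

lemma compact_positive_eigenvector:
  fixes R :: "'a::{real_inner,complete_space} \<Rightarrow> 'a"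
  assumes bl: "bounded_linear R" and sym: "\<And>x y. R x \<bullet> y = x \<bullet> R y"
    and pos: "\<And>x. 0 \<le> R x \<bullet> x" and inj: "\<And>x. R x = 0 \<Longrightarrow> x = 0"
    and cpt: "compact (closure (R ` cball 0 1))"
    and W: "subspace W" "closed W" "\<And>x. x \<in> W \<Longrightarrow> R x \<in> W" and x: "x \<in> W" "x \<noteq> 0"
  obtains v \<rho> where "v \<in> W" "norm v = 1" "\<rho> > 0" "R v = \<rho> *\<^sub>R v"
proof -
  interpret R: bounded_linear R by fact
  obtain C where C: "C > 0" "\<And>x. norm (R x) \<le> C * norm x"
    using R.pos_bounded by (auto simp: mult.commute)
  define S where "S = {R x \<bullet> x | x. x \<in> W \<and> norm x = 1}"
  define \<nu> where "\<nu> = Sup S"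
  have "R x \<bullet> x \<le> C" if "norm x = 1" for x
    using norm_cauchy_schwarz[of "R x" x] C(2)[of x] that by simp
  then have bdd: "bdd_above S" unfolding S_def bdd_above_def by blast
  define x1 where "x1 = x /\<^sub>R norm x"
  have x1: "x1 \<in> W" "norm x1 = 1" "x1 \<noteq> 0"
    using x W(1) by (auto simp: x1_def intro: subspace_scale)
  then have "R x1 \<bullet> x1 \<in> S" by (auto simp: S_def)
  \<comment> \<open>Injectivity and the norm bound exclude a vanishing form at \<open>x1\<close>.
    The supremum is therefore positive, so \<nu> can be divided by.\<close>
  moreover have "R x1 \<bullet> x1 > 0"
  proof -
    have "(norm (R x1))\<^sup>2 \<le> C * (R x1 \<bullet> x1)"
      by (rule positive_form_norm_bound[where W=UNIV]) (use sym pos C R.linear_axioms in auto)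
    moreover have "R x1 \<noteq> 0" using inj x1(3) by blast
    ultimately have "0 < C * (R x1 \<bullet> x1)" by (smt (verit) zero_less_norm_iff zero_less_power)
    then show ?thesis using C(1) by (simp add: zero_less_mult_iff)
  qed
  ultimately have lpos: "\<nu> > 0" unfolding \<nu>_def using bdd cSup_upper by (metis less_le_trans)
  have upper: "R y \<bullet> y \<le> \<nu> * (y \<bullet> y)" if "y \<in> W" for y
  proof (cases "y = 0")
    case False
    define z where "z = y /\<^sub>R norm y"
    have "z \<in> W" "norm z = 1" using that False W(1) by (auto simp: z_def intro: subspace_scale)
    then have "R z \<bullet> z \<le> \<nu>" unfolding \<nu>_def by (intro cSup_upper bdd) (auto simp: S_def)
    moreover have "R z \<bullet> z = (R y \<bullet> y) / (y \<bullet> y)"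
      using False by (simp add: z_def R.scale power2_norm_eq_inner[symmetric] power2_eq_square field_simps)
    ultimately show ?thesis using False by (simp add: field_simps)
  qed (simp add: R.zero)
  have "\<exists>y. y \<in> W \<and> norm y = 1 \<and> R y \<bullet> y > \<nu> - 1 / real (Suc k)" for k
  proof -
    have "\<nu> - 1 / real (Suc k) < Sup S" by (simp add: \<nu>_def)
    then obtain s where "s \<in> S" "\<nu> - 1 / real (Suc k) < s"
      using less_cSupD[of S] x1 by (auto simp: S_def)
    then show ?thesis by (auto simp: S_def)
  qed
  then obtain y where y: "\<And>k. y k \<in> W" "\<And>k. norm (y k) = 1" "\<And>k. R (y k) \<bullet> y k > \<nu> - 1 / real (Suc k)"
    by metis
  have "R (y k) \<in> closure (R ` cball 0 1)" for k
    using y(2)[of k] by (intro closure_subset[THEN subsetD]) auto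
  then obtain l r where r: "strict_mono (r::nat\<Rightarrow>nat)" "(\<lambda>k. R (y (r k))) \<longlonglongrightarrow> l"
    using cpt[unfolded compact_def, THEN spec[of _ "\<lambda>k. R (y k)"]] by (auto simp: o_def)
  have gap: "(norm (\<nu> *\<^sub>R y k - R (y k)))\<^sup>2 \<le> (\<nu> + C) * (1 / real (Suc k))" for k
  proof -
    have "(norm (\<nu> *\<^sub>R y k - R (y k)))\<^sup>2 \<le> (\<nu> + C) * ((\<nu> *\<^sub>R y k - R (y k)) \<bullet> y k)"
    proof (rule positive_form_norm_bound[where W=W and A="\<lambda>x. \<nu> *\<^sub>R x - R x"])
      show "linear (\<lambda>x. \<nu> *\<^sub>R x - R x)"
        by (intro linear_compose_sub linear_compose_scale_right linear_ident R.linear_axioms)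
      show "(\<nu> *\<^sub>R x - R x) \<bullet> y = x \<bullet> (\<nu> *\<^sub>R y - R y)" for x y
        by (simp add: inner_diff_left inner_diff_right sym)
      show "x \<in> W \<Longrightarrow> \<nu> *\<^sub>R x - R x \<in> W" for x
        using W by (intro subspace_diff subspace_scale) auto
      show "x \<in> W \<Longrightarrow> 0 \<le> (\<nu> *\<^sub>R x - R x) \<bullet> x" for x
        using upper[of x] by (simp add: inner_diff_left)
      show "\<nu> + C > 0" using lpos C by simp
      show "norm (\<nu> *\<^sub>R x - R x) \<le> (\<nu> + C) * norm x" for x
        using norm_triangle_ineq4[of "\<nu> *\<^sub>R x" "R x"] C(2)[of x] lpos by (simp add: distrib_right)
      show "subspace W" "y k \<in> W" using W y by auto
    qed
    also have "(\<nu> *\<^sub>R y k - R (y k)) \<bullet> y k \<le> 1 / real (Suc k)"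
      using y(3)[of k] y(2)[of k] by (simp add: inner_diff_left power2_norm_eq_inner[symmetric])
    finally show ?thesis using lpos C(1) by (simp add: mult_left_mono)
  qed
  have "(\<lambda>k. (norm (\<nu> *\<^sub>R y k - R (y k)))\<^sup>2) \<longlonglongrightarrow> 0"
  proof (rule tendsto_sandwich[OF _ _ tendsto_const])
    show "(\<lambda>k. (\<nu> + C) * (1 / real (Suc k))) \<longlonglongrightarrow> 0"
      using tendsto_mult_right_zero[OF LIMSEQ_Suc[OF lim_1_over_n]] by (simp add: o_def)
  qed (use gap in auto)
  then have "(\<lambda>k. norm (\<nu> *\<^sub>R y k - R (y k))) \<longlonglongrightarrow> 0"
    using tendsto_real_sqrt by fastforce
  then have "(\<lambda>k. \<nu> *\<^sub>R y k - R (y k)) \<longlonglongrightarrow> 0" by (rule tendsto_norm_zero_cancel)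
  then have "(\<lambda>k. \<nu> *\<^sub>R y (r k) - R (y (r k))) \<longlonglongrightarrow> 0"
    using LIMSEQ_subseq_LIMSEQ[OF _ r(1)] by (force simp: o_def)
  from tendsto_add[OF this r(2)] have "(\<lambda>k. \<nu> *\<^sub>R y (r k)) \<longlonglongrightarrow> l" by simp
  from tendsto_scaleR[OF tendsto_const[of "1/\<nu>"] this]
  have yl: "(\<lambda>k. y (r k)) \<longlonglongrightarrow> l /\<^sub>R \<nu>" using lpos by (simp add: divide_inverse)
  define v where "v = l /\<^sub>R \<nu>"
  have "v \<in> W" using closed_sequentially[OF W(2) _ yl] y(1) by (simp add: v_def)
  moreover have "norm v = 1"
    using tendsto_unique[OF _ tendsto_norm[OF yl]] y(2) by (simp add: v_def)
  moreover have "R v = \<nu> *\<^sub>R v"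
    using tendsto_unique[OF _ R.tendsto[OF yl] r(2)] lpos by (simp add: v_def)
  ultimately show thesis using lpos that by blast
qed

text \<open>Zorn's lemma on orthonormal sets of eigenvectors: the complement of a maximal set is
  closed and invariant, so a nonzero vector in it would supply one more eigenvector. No enumeration
  of the eigenvalues in decreasing order is involved.\<close>

theorem compact_positive_spectral:
  fixes R :: "'a::{real_inner,complete_space} \<Rightarrow> 'a"
  assumes bl: "bounded_linear R" and sym: "\<And>x y. R x \<bullet> y = x \<bullet> R y"
    and pos: "\<And>x. 0 \<le> R x \<bullet> x" and inj: "\<And>x. R x = 0 \<Longrightarrow> x = 0"
    and cpt: "compact (closure (R ` cball 0 1))"
  obtains E \<rho> where "onb (\<lambda>v. v) E" "\<And>v. v \<in> E \<Longrightarrow> \<rho> v > 0" "\<And>v. v \<in> E \<Longrightarrow> R v = \<rho> v *\<^sub>R v"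
proof -
  define A where "A = {E. (\<forall>v\<in>E. norm v = 1 \<and> (\<exists>\<rho>>0. R v = \<rho> *\<^sub>R v)) \<and> (\<forall>u\<in>E. \<forall>v\<in>E. u \<noteq> v \<longrightarrow> u \<bullet> v = 0)}"
  have "\<exists>M\<in>A. \<forall>X\<in>A. M \<subseteq> X \<longrightarrow> X = M"
  proof (rule subset_Zorn')
    fix C assume C: "subset.chain A C"
    then have sub: "C \<subseteq> A" and ch: "\<And>X Y. X \<in> C \<Longrightarrow> Y \<in> C \<Longrightarrow> X \<subseteq> Y \<or> Y \<subseteq> X"
      by (auto simp: subset_chain_def)
    have "u \<bullet> v = 0" if asm: "X \<in> C" "Y \<in> C" "u \<in> X" "v \<in> Y" "u \<noteq> v" for X Y u v
    proof -
      from ch[OF asm(1,2)] obtain Z where "Z \<in> C" "u \<in> Z" "v \<in> Z" using asm by blast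
      then show ?thesis using sub asm(5) by (auto simp: A_def)
    qed
    then show "\<Union>C \<in> A" using sub unfolding A_def by blast
  qed
  then obtain E where E: "E \<in> A" and max: "\<And>X. X \<in> A \<Longrightarrow> E \<subseteq> X \<Longrightarrow> X = E" by blast
  have "\<forall>v\<in>E. \<exists>\<rho>>0. R v = \<rho> *\<^sub>R v" using E by (auto simp: A_def)
  then obtain \<rho> where \<rho>: "\<And>v. v \<in> E \<Longrightarrow> \<rho> v > 0" "\<And>v. v \<in> E \<Longrightarrow> R v = \<rho> v *\<^sub>R v" by metis
  define W where "W = {x. \<forall>v\<in>E. x \<bullet> v = 0}"
  have W: "subspace W" "closed W"
  proof -
    show "subspace W" by (auto simp: W_def subspace_def inner_add_left)
    have "W = (\<Inter>v\<in>E. {x. x \<bullet> v = 0})" by (auto simp: W_def)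
    then show "closed W" by (auto intro!: closed_INT closed_Collect_eq continuous_intros)
  qed
  have inv: "R x \<in> W" if "x \<in> W" for x
    using that by (auto simp: W_def sym \<rho>(2))
  have "x = 0" if x: "x \<in> W" for x
  proof (rule ccontr)
    assume "x \<noteq> 0"
    from compact_positive_eigenvector[OF bl sym pos inj cpt W inv x this]
    obtain v r where v: "v \<in> W" "norm v = 1" "r > 0" "R v = r *\<^sub>R v" by blast
    have "insert v E \<in> A" using E v by (auto simp: A_def W_def inner_commute)
    then have "v \<in> E" using max by blast
    then have "v \<bullet> v = 0" using v(1) by (auto simp: W_def)
    then show False using v(2) by simp
  qed
  moreover have "orthonormal (\<lambda>v. v) E"
    using E by unfold_locales (auto simp: A_def power2_norm_eq_inner[symmetric])
  ultimately have "onb (\<lambda>v. v) E"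
    by (auto simp: onb_def onb_axioms_def W_def)
  then show thesis using \<rho> that by blast
qed

text \<open>\<open>R\<close> is the inverse of c - T, so an eigenvalue \<rho> of \<open>R\<close>
  belongs to the eigenvalue c - 1/\<rho> of \<open>T\<close>. Compactness leaves only finitely many
  \<rho> above a given level, which is the discreteness of \<mu>.\<close>

theorem diagonal_operator_of_resolvent:
  fixes R :: "'a::{real_inner,complete_space} \<Rightarrow> 'a"
  assumes bl: "bounded_linear R" and sym: "\<And>x y. R x \<bullet> y = x \<bullet> R y"
    and pos: "\<And>x. 0 \<le> R x \<bullet> x" and inj: "\<And>x. R x = 0 \<Longrightarrow> x = 0"
    and cpt: "compact (closure (R ` cball 0 1))"
    and T: "T = {(R h, c *\<^sub>R R h - h) | h. True}"
  obtains E \<mu> where "diagonal_operator (\<lambda>v. v) E \<mu> c T"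
proof -
  obtain E \<rho> where E: "onb (\<lambda>v. v) E" and \<rho>: "\<And>v. v \<in> E \<Longrightarrow> \<rho> v > 0" "\<And>v. v \<in> E \<Longrightarrow> R v = \<rho> v *\<^sub>R v"
    using compact_positive_spectral[OF bl sym pos inj cpt] by metis
  interpret onb "\<lambda>v. v" E by fact
  interpret R: bounded_linear R by fact
  define \<mu> where "\<mu> v = c - 1 / \<rho> v" for v
  have fin: "finite {v\<in>E. \<rho> v \<ge> \<epsilon>}" if \<epsilon>: "\<epsilon> > 0" for \<epsilon>
  proof -
    obtain k where k: "finite k" "closure (R ` cball 0 1) \<subseteq> (\<Union>x\<in>k. ball x (\<epsilon>/2))"
      using cpt \<epsilon> unfolding compact_eq_totally_bounded by (meson half_gt_zero)
    have "\<exists>z\<in>k. dist z (R v) < \<epsilon>/2" if "v \<in> E" for v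
    proof -
      have "R v \<in> closure (R ` cball 0 1)"
        using norm_basis[OF that] by (intro closure_subset[THEN subsetD]) auto
      from subsetD[OF k(2) this] show ?thesis by (auto simp: mem_ball)
    qed
    then obtain z where z: "\<And>v. v \<in> E \<Longrightarrow> z v \<in> k" "\<And>v. v \<in> E \<Longrightarrow> dist (z v) (R v) < \<epsilon>/2" by metis
    \<comment> \<open>Orthonormal eigenvectors with eigenvalues at least \<epsilon> have images at
      distance at least \<epsilon>, so no two of them share a center of the
      \<epsilon>/2-net.\<close>
    have "inj_on z {v\<in>E. \<rho> v \<ge> \<epsilon>}"
    proof (rule inj_onI, rule ccontr)
      fix u v assume uv: "u \<in> {v\<in>E. \<rho> v \<ge> \<epsilon>}" "v \<in> {v\<in>E. \<rho> v \<ge> \<epsilon>}" "z u = z v" "u \<noteq> v"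
      have "dist (R u) (R v) < \<epsilon>"
        using z(2)[of u] z(2)[of v] uv dist_triangle3[of "R u" "R v" "z u"] by auto
      then have "(norm (R u - R v))\<^sup>2 < \<epsilon>\<^sup>2"
        unfolding dist_norm using \<epsilon> by (intro power_strict_mono) auto
      also have "(norm (R u - R v))\<^sup>2 = (\<rho> u)\<^sup>2 + (\<rho> v)\<^sup>2"
        unfolding power2_norm_eq_inner using uv
        by (simp add: \<rho>(2) inner_diff_left inner_diff_right inner_basis power2_eq_square)
      finally have "(\<rho> u)\<^sup>2 + (\<rho> v)\<^sup>2 < \<epsilon>\<^sup>2" .
      moreover have "(\<rho> u)\<^sup>2 \<ge> \<epsilon>\<^sup>2" using uv \<epsilon> by (intro power_mono) auto
      ultimately show False by (smt (verit) zero_le_power2)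
    qed
    moreover have "z ` {v\<in>E. \<rho> v \<ge> \<epsilon>} \<subseteq> k" using z(1) by auto
    ultimately show ?thesis using k(1) inj_on_finite by blast
  qed
  have "diagonal_operator (\<lambda>v. v) E \<mu> c T"
  proof unfold_locales
    show "\<mu> i < c" if "i \<in> E" for i using \<rho>(1)[OF that] by (simp add: \<mu>_def)
    show "finite {i \<in> E. M \<le> \<mu> i}" for M
    proof (cases "M < c")
      case True
      have "{i \<in> E. M \<le> \<mu> i} \<subseteq> {v\<in>E. \<rho> v \<ge> 1 / (c - M)}"
      proof safe
        fix v assume v: "v \<in> E" "M \<le> \<mu> v"
        then have "1 / \<rho> v \<le> c - M" by (simp add: \<mu>_def)
        then show "1 / (c - M) \<le> \<rho> v" using True \<rho>(1)[OF v(1)] by (simp add: field_simps)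
      qed
      then show ?thesis using fin[of "1 / (c - M)"] True finite_subset by auto
    next
      case False
      moreover have "\<mu> v < c" if "v \<in> E" for v using \<rho>(1)[OF that] by (simp add: \<mu>_def)
      ultimately have "{i \<in> E. M \<le> \<mu> i} = {}" by fastforce
      then show ?thesis by (simp only: finite.emptyI)
    qed
    show "T = {(x, y). \<forall>v\<in>E. y \<bullet> v = \<mu> v * (x \<bullet> v)}"
    proof (intro equalityI subsetI)
      fix p assume "p \<in> T"
      then obtain h where p: "p = (R h, c *\<^sub>R R h - h)" by (auto simp: T)
      have "(c *\<^sub>R R h - h) \<bullet> v = \<mu> v * (R h \<bullet> v)" if "v \<in> E" for v
        using \<rho>[OF that] by (simp add: \<mu>_def inner_diff_left sym left_diff_distrib)
      then show "p \<in> {(x, y). \<forall>v\<in>E. y \<bullet> v = \<mu> v * (x \<bullet> v)}" by (simp add: p)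
    next
      fix p assume p: "p \<in> {(x, y). \<forall>v\<in>E. y \<bullet> v = \<mu> v * (x \<bullet> v)}"
      obtain x y where xy: "p = (x, y)" by (cases p)
      have "R (c *\<^sub>R x - y) = x"
      proof (rule eqI)
        fix v assume v: "v \<in> E"
        then show "R (c *\<^sub>R x - y) \<bullet> v = x \<bullet> v"
          using p \<rho>[OF v] by (simp add: xy sym inner_diff_left \<mu>_def left_diff_distrib)
      qed
      then have "p = (R (c *\<^sub>R x - y), c *\<^sub>R R (c *\<^sub>R x - y) - (c *\<^sub>R x - y))" by (simp add: xy)
      then show "p \<in> T" unfolding T by blast
    qed
  qed
  then show thesis using that by blast
qed

text \<open>Far to the right of the spectrum of \<open>T0\<close> the resolvent equation is the
  fixed-point equation x = R0 (h + V x) of a contraction. Its solution operator inherits compactness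
  from R0, and the spectral theorem then produces a new diagonal form. Nothing quantitative is
  claimed about the new eigenvalues.\<close>

theorem diagonal_operator_perturbation:
  fixes V :: "'a::{real_inner,complete_space} \<Rightarrow> 'a"
  assumes T0: "diagonal_operator e I \<mu>\<^sub>0 c\<^sub>0 T0"
    and V: "bounded_linear V" and symV: "\<And>x y. V x \<bullet> y = x \<bullet> V y"
    and T: "T = {(x, y). (x, y - V x) \<in> T0}"
  obtains E \<mu> c where "diagonal_operator (\<lambda>v. v) E \<mu> c T"
proof -
  interpret V: bounded_linear V by fact
  obtain v where v: "v > 0" "\<And>x. norm (V x) \<le> v * norm x"
    using V.pos_bounded by (auto simp: mult.commute)
  \<comment> \<open>A distance above \<open>2 * v + 1\<close> from the spectrum of \<open>T0\<close>
    gives the contraction factor v/(2v + 1) < 1/2 and leaves the margin v + 1 in the positivity of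
    R.\<close>
  define c where "c = c\<^sub>0 + 2 * v + 1"
  interpret T0: diagonal_operator e I \<mu>\<^sub>0 c\<^sub>0 T0 by fact
  interpret T1: diagonal_operator e I \<mu>\<^sub>0 c T0
    using T0.upper T0.discrete T0.T_def v(1) by unfold_locales (fastforce simp: c_def)+
  define R0 where "R0 = T0.diag (\<lambda>i. 1 / (c - \<mu>\<^sub>0 i))"
  have R0_coeff: "R0 x \<bullet> e i = 1 / (c - \<mu>\<^sub>0 i) * (x \<bullet> e i)" if "i \<in> I" for x i
    unfolding R0_def by (rule T0.diag_coeff[OF T1.bdd_resolvent that])
  have bl0: "bounded_linear R0" unfolding R0_def by (rule T0.bounded_linear_diag[OF T1.bdd_resolvent])
  then interpret R0: bounded_linear R0 .
  have nR0: "norm (R0 x) \<le> 1 / (2 * v + 1) * norm x" for x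
    unfolding R0_def
  proof (rule T0.norm_diag_le)
    show "\<bar>1 / (c - \<mu>\<^sub>0 i)\<bar> \<le> 1 / (2 * v + 1)" if "i \<in> I" for i
      using T0.upper[OF that] v(1) by (simp add: c_def frac_le)
  qed (use v in auto)
  have T_iff: "(x, c *\<^sub>R x - h) \<in> T \<longleftrightarrow> x = R0 (h + V x)" for x h
  proof
    assume "(x, c *\<^sub>R x - h) \<in> T"
    then have *: "\<And>i. i \<in> I \<Longrightarrow> (c - \<mu>\<^sub>0 i) * (x \<bullet> e i) = (h + V x) \<bullet> e i"
      by (auto simp: T T0.mem_T inner_diff_left inner_add_left algebra_simps)
    show "x = R0 (h + V x)"
    proof (rule T0.eqI)
      fix i assume i: "i \<in> I"
      then show "x \<bullet> e i = R0 (h + V x) \<bullet> e i"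
        using *[OF i] T1.upper[OF i] by (simp add: R0_coeff field_simps)
    qed
  next
    assume x: "x = R0 (h + V x)"
    have "(c - \<mu>\<^sub>0 i) * (x \<bullet> e i) = (h + V x) \<bullet> e i" if i: "i \<in> I" for i
      using arg_cong[OF x, of "\<lambda>z. z \<bullet> e i"] T1.upper[OF i] by (simp add: R0_coeff[OF i] field_simps)
    then show "(x, c *\<^sub>R x - h) \<in> T"
      by (auto simp: T T0.mem_T inner_diff_left inner_add_left algebra_simps)
  qed
  have ex1: "\<exists>!x. R0 (h + V x) = x" for h
  proof (rule banach_fix_type)
    show "\<forall>x y. dist (R0 (h + V x)) (R0 (h + V y)) \<le> 1/2 * dist x y"
    proof (intro allI)
      fix x y
      have "dist (R0 (h + V x)) (R0 (h + V y)) = norm (R0 (V (x - y)))"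
        by (simp add: dist_norm R0.diff[symmetric] V.diff)
      also have "\<dots> \<le> 1 / (2 * v + 1) * (v * norm (x - y))"
        using nR0[of "V (x - y)"] mult_left_mono[OF v(2)[of "x - y"], of "1 / (2 * v + 1)"] v(1) by simp
      also have "\<dots> \<le> 1/2 * norm (x - y)"
      proof -
        have "v / (2 * v + 1) \<le> 1/2" using v(1) by (simp add: field_simps)
        from mult_right_mono[OF this norm_ge_zero[of "x - y"]] show ?thesis by simp
      qed
      finally show "dist (R0 (h + V x)) (R0 (h + V y)) \<le> 1/2 * dist x y" by (simp add: dist_norm)
    qed
  qed auto
  define R where "R h = (THE x. R0 (h + V x) = x)" for h
  have R_eq: "R0 (h + V (R h)) = R h" for h
    unfolding R_def by (rule theI'[OF ex1])
  have R_unique: "R0 (h + V x) = x \<Longrightarrow> R h = x" for h x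
    unfolding R_def by (rule the1_equality[OF ex1])
  have R_norm: "norm (R h) \<le> 2 * norm h" for h
  proof -
    have "norm (R h) \<le> 1 / (2 * v + 1) * (norm h + v * norm (R h))"
    proof -
      have "norm (R h) \<le> 1 / (2 * v + 1) * norm (h + V (R h))" using nR0[of "h + V (R h)"] by (simp add: R_eq)
      also have "\<dots> \<le> 1 / (2 * v + 1) * (norm h + v * norm (R h))"
        using norm_triangle_ineq[of h "V (R h)"] v(2)[of "R h"] v(1) by (intro mult_left_mono) auto
      finally show ?thesis .
    qed
    then have "(2 * v + 1) * norm (R h) \<le> norm h + v * norm (R h)"
      using v(1) by (simp add: field_simps)
    then have "norm (R h) * (v + 1) \<le> norm h" by (simp add: algebra_simps)
    moreover have "norm (R h) * 1 \<le> norm (R h) * (v + 1)" using v(1) by (intro mult_left_mono) auto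
    ultimately show ?thesis by (smt (verit) norm_ge_zero mult_cancel_left2)
  qed
  have blR: "bounded_linear R"
  proof (rule bounded_linear_intro)
    show "R (x + y) = R x + R y" for x y
      using R_eq[of x] R_eq[of y] by (intro R_unique) (metis R0.add V.add add.assoc add.left_commute)
    show "R (r *\<^sub>R x) = r *\<^sub>R R x" for r x
      using R_eq[of x] by (intro R_unique) (metis R0.scale V.scale scaleR_right_distrib)
    show "norm (R x) \<le> norm x * 2" for x using R_norm[of x] by simp
  qed
  have TR: "T = {(R h, c *\<^sub>R R h - h) | h. True}"
  proof (intro equalityI subsetI)
    fix p assume p: "p \<in> T"
    obtain x y where xy: "p = (x, y)" by (cases p)
    have "(x, c *\<^sub>R x - (c *\<^sub>R x - y)) \<in> T" using p by (simp add: xy)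
    then have "R (c *\<^sub>R x - y) = x" using T_iff R_unique by metis
    then have "p = (R (c *\<^sub>R x - y), c *\<^sub>R R (c *\<^sub>R x - y) - (c *\<^sub>R x - y))" by (simp add: xy)
    then show "p \<in> {(R h, c *\<^sub>R R h - h) | h. True}" by blast
  next
    fix p assume "p \<in> {(R h, c *\<^sub>R R h - h) | h. True}"
    then show "p \<in> T" using T_iff R_eq by (auto intro: sym)
  qed
  have inT: "(R h, c *\<^sub>R R h - h) \<in> T" for h using TR by blast
  have symT: "w \<bullet> y = x \<bullet> z" if "(x, w) \<in> T" "(y, z) \<in> T" for x y z w
  proof -
    have "(w - V x) \<bullet> y = x \<bullet> (z - V y)"
      using that by (intro T0.symmetric) (auto simp: T)
    then show ?thesis using symV[of x y] by (simp add: inner_diff_left inner_diff_right)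
  qed
  show thesis
  proof (rule diagonal_operator_of_resolvent[OF blR _ _ _ _ TR])
    show "R x \<bullet> y = x \<bullet> R y" for x y
      using symT[OF inT[of x] inT[of y]] by (simp add: inner_diff_left inner_diff_right)
    \<comment> \<open>With x = R h, the form of \<open>T0\<close> is bounded by c0 and that of V by
      v, so x . h >= (c - c0 - v) |x|^2.\<close>
    show "0 \<le> R h \<bullet> h" for h
    proof -
      define x where "x = R h"
      define y where "y = c *\<^sub>R x - h - V x"
      have y: "(x, y) \<in> T0" using inT[of h] by (simp add: T x_def y_def)
      have "y \<bullet> x \<le> c\<^sub>0 * (x \<bullet> x)"
      proof (rule has_sum_mono[OF T0.parseval])
        show "((\<lambda>i. c\<^sub>0 * ((x \<bullet> e i) * (x \<bullet> e i))) has_sum (c\<^sub>0 * (x \<bullet> x))) I"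
          by (intro has_sum_cmult_right T0.parseval)
        show "(y \<bullet> e i) * (x \<bullet> e i) \<le> c\<^sub>0 * ((x \<bullet> e i) * (x \<bullet> e i))" if "i \<in> I" for i
          using y that T0.upper[OF that] by (auto simp: T0.mem_T mult.assoc intro!: mult_right_mono)
      qed
      moreover have "V x \<bullet> x \<le> v * (x \<bullet> x)"
      proof -
        have "V x \<bullet> x \<le> norm (V x) * norm x" by (rule norm_cauchy_schwarz)
        also have "\<dots> \<le> v * norm x * norm x" by (intro mult_right_mono v) auto
        finally show ?thesis by (simp add: power2_norm_eq_inner[symmetric] power2_eq_square)
      qed
      moreover have "x \<bullet> h = c * (x \<bullet> x) - y \<bullet> x - V x \<bullet> x"
        by (simp add: y_def inner_diff_left inner_commute[of h x])
      moreover have "c * (x \<bullet> x) - c\<^sub>0 * (x \<bullet> x) - v * (x \<bullet> x) = (v + 1) * (x \<bullet> x)"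
        by (simp add: c_def algebra_simps)
      moreover have "0 \<le> (v + 1) * (x \<bullet> x)" using v(1) by simp
      ultimately have "0 \<le> x \<bullet> h" by linarith
      then show ?thesis by (simp add: x_def)
    qed
    show "x = 0" if "R x = 0" for x
    proof -
      have "(0, - x) \<in> T" using inT[of x] that by simp
      then have "(0, - x) \<in> T0" by (simp add: T V.zero)
      then show ?thesis by (intro T0.total) (simp add: T0.mem_T)
    qed
    \<comment> \<open>R h = R0 (h + V (R h)) and the argument of R0 stays bounded, so the unit ball
      is mapped into the relatively compact image of a larger ball.\<close>
    have "R ` cball 0 1 \<subseteq> R0 ` cball 0 (1 + 2 * v)"
    proof
      fix x assume "x \<in> R ` cball 0 1"
      then obtain h where h: "norm h \<le> 1" "x = R h" by auto
      have "norm (h + V (R h)) \<le> norm h + v * norm (R h)"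
        using norm_triangle_ineq[of h "V (R h)"] v(2)[of "R h"] by simp
      also have "\<dots> \<le> 1 + v * 2"
        using h(1) R_norm[of h] v(1) by (intro add_mono mult_left_mono) auto
      finally have "h + V (R h) \<in> cball 0 (1 + 2 * v)" by simp
      then show "x \<in> R0 ` cball 0 (1 + 2 * v)" using R_eq[of h] h(2) by (metis image_eqI)
    qed
    then have "closure (R ` cball 0 1) \<subseteq> closure (R0 ` cball 0 (1 + 2 * v))" by (rule closure_mono)
    then show "compact (closure (R ` cball 0 1))"
      using T1.compact_resolvent_c[of "1 + 2 * v"] unfolding R0_def
      by (metis closed_closure compact_Int_closed inf.absorb2)
  qed (use that in blast)
qed

section \<open>Polar coordinates\<close>

text \<open>The area of the sphere of radius \<open>r\<close> in dimension \<open>n\<close>,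
  extended by 0 to negative \<open>r\<close> so that it is a density on the whole line.\<close>

definition radial_density :: "nat \<Rightarrow> real \<Rightarrow> real" where
  "radial_density n r = real n * unit_ball_vol (real n) * r ^ (n - 1) * indicator {0..} r"

lemma radial_density_nonneg [simp]: "0 \<le> radial_density n r"
  by (auto simp: radial_density_def indicator_def)

lemma radial_density_measurable [measurable]: "radial_density n \<in> borel_measurable borel"
  unfolding radial_density_def[abs_def] by measurable

text \<open>Radial integrals become one-dimensional without spherical coordinates: both measures
  give the half line up to \<open>a\<close> the volume of the ball of radius \<open>a\<close>, and
  half lines generate the Borel sets.\<close>

lemma distr_norm_lborel:
  "distr lborel borel (norm :: real ^ 'n::finite \<Rightarrow> real) = density lborel (radial_density CARD('n))"
proof (rule measure_eqI_generator_eq[where E="range (\<lambda>a::real. {..a})" and \<Omega>=UNIV and A="\<lambda>i. {..real i}"])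
  let ?n = "CARD('n)" and ?M = "distr lborel borel (norm :: real ^ 'n \<Rightarrow> real)"
  have M: "emeasure ?M {..a} = ennreal (if a \<ge> 0 then unit_ball_vol (real ?n) * a ^ ?n else 0)" for a
  proof -
    have "emeasure ?M {..a} = emeasure lborel {x :: real ^ 'n. norm x \<le> a}"
      by (subst emeasure_distr) (auto simp: vimage_def)
    also have "{x :: real ^ 'n. norm x \<le> a} = (if a \<ge> 0 then cball 0 a else {})"
      by (auto dest: order_trans[OF norm_ge_zero])
    finally show ?thesis using emeasure_cball[of a "0 :: real ^ 'n"] by auto
  qed
  show "Int_stable (range (\<lambda>a::real. {..a}))"
    by (rule Int_stableI) auto
  show "sets ?M = sigma_sets UNIV (range (\<lambda>a::real. {..a}))"
    "sets (density lborel (radial_density ?n)) = sigma_sets UNIV (range (\<lambda>a::real. {..a}))"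
    by (simp_all add: borel_eq_atMost)
  show "emeasure ?M {..real i} \<noteq> \<infinity>" for i by (simp add: M)
  show "(\<Union>i. {..real i}) = (UNIV :: real set)" using real_arch_simple by auto
  fix X :: "real set" assume "X \<in> range (\<lambda>a. {..a})"
  then obtain a where X: "X = {..a}" by auto
  have "emeasure (density lborel (radial_density ?n)) {..a} = (\<integral>\<^sup>+r. ennreal (radial_density ?n r) * indicator {..a} r \<partial>lborel)"
    by (subst emeasure_density) auto
  also have "\<dots> = ennreal (if a \<ge> 0 then unit_ball_vol (real ?n) * a ^ ?n else 0)"
  proof (cases "a \<ge> 0")
    case True
    define f where "f r = real ?n * unit_ball_vol (real ?n) * r ^ (?n - 1)" for r :: real
    have "(\<integral>\<^sup>+r. ennreal (radial_density ?n r) * indicator {..a} r \<partial>lborel) = (\<integral>\<^sup>+r. ennreal (f r) * indicator {0..a} r \<partial>lborel)"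
      by (intro nn_integral_cong) (auto simp: radial_density_def f_def indicator_def)
    also have "\<dots> = unit_ball_vol (real ?n) * a ^ ?n - unit_ball_vol (real ?n) * 0 ^ ?n"
    proof (rule nn_integral_FTC_Icc[where F="\<lambda>r. unit_ball_vol (real ?n) * r ^ ?n"])
      show "f \<in> borel_measurable borel" unfolding f_def[abs_def] by measurable
      show "((\<lambda>r. unit_ball_vol (real ?n) * r ^ ?n) has_real_derivative f x) (at x)" for x
        unfolding f_def by (auto intro!: derivative_eq_intros)
      show "0 \<le> f x" if "x \<in> {0..a}" for x
        using that unit_ball_vol_nonneg[of "real ?n"] by (auto simp: f_def intro!: mult_nonneg_nonneg)
    qed (fact True)
    finally show ?thesis using True by simp
  next
    case False
    then have "(\<integral>\<^sup>+r. ennreal (radial_density ?n r) * indicator {..a} r \<partial>lborel) = (\<integral>\<^sup>+(r::real). 0 \<partial>lborel)"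
      by (intro nn_integral_cong) (auto simp: radial_density_def indicator_def)
    then show ?thesis using False by simp
  qed
  finally show "emeasure ?M X = emeasure (density lborel (radial_density ?n)) X"
    by (simp add: M X)
qed auto

lemma integral_norm_lborel:
  fixes F :: "real \<Rightarrow> real"
  assumes [measurable]: "F \<in> borel_measurable borel"
  shows "(LINT x|(lborel :: (real ^ 'n::finite) measure). F (norm x)) = (LINT r|lborel. radial_density CARD('n) r * F r)"
    and "integrable (lborel :: (real ^ 'n) measure) (\<lambda>x. F (norm x)) \<longleftrightarrow> integrable lborel (\<lambda>r. radial_density CARD('n) r * F r)"
proof -
  have "(LINT x|(lborel :: (real ^ 'n) measure). F (norm x)) = (LINT r|distr lborel borel (norm :: real ^ 'n \<Rightarrow> real). F r)"
    by (subst integral_distr) auto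
  then show "(LINT x|(lborel :: (real ^ 'n) measure). F (norm x)) = (LINT r|lborel. radial_density CARD('n) r * F r)"
    by (simp add: distr_norm_lborel integral_density)
  have "integrable (lborel :: (real ^ 'n) measure) (\<lambda>x. F (norm x)) \<longleftrightarrow> integrable (distr lborel borel (norm :: real ^ 'n \<Rightarrow> real)) F"
    by (subst integrable_distr_eq) auto
  then show "integrable (lborel :: (real ^ 'n) measure) (\<lambda>x. F (norm x)) \<longleftrightarrow> integrable lborel (\<lambda>r. radial_density CARD('n) r * F r)"
    by (simp add: distr_norm_lborel integrable_density)
qed

lemma power_le_fact_exp:
  fixes r :: real assumes "r \<ge> 0"
  shows "r ^ m \<le> fact m * exp r"
proof -
  have "(\<Sum>k\<in>{m}. inverse (fact k) * r ^ k) \<le> (\<Sum>k. inverse (fact k) * r ^ k)"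
    using assms by (intro sum_le_suminf summable_exp) auto
  then have "inverse (fact m) * r ^ m \<le> exp r"
    by (simp add: exp_def field_simps scaleR_conv_of_real)
  then show ?thesis by (simp add: field_simps)
qed

text \<open>Completing the square, c (r - 1/c)^2 >= 0 says r - c r^2 <= 1/c - r. The Gaussian thus
  absorbs the exponential from \<open>power_le_fact_exp\<close> and still leaves exp(-r).\<close>

lemma power_gaussian_le:
  fixes r :: real assumes "r \<ge> 0" "c > 0"
  shows "r ^ m * exp (- c * r\<^sup>2) \<le> fact m * exp (1 / c) * exp (- r)"
proof -
  have "0 \<le> c * (r - 1/c)\<^sup>2" using assms by simp
  also have "c * (r - 1/c)\<^sup>2 = c * r\<^sup>2 - 2 * r + 1/c"
    using assms by (simp add: power2_eq_square field_simps)
  finally have "r - c * r\<^sup>2 \<le> 1/c - r" by simp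
  then have "exp (r - c * r\<^sup>2) \<le> exp (1/c - r)" by simp
  then have "exp r * exp (- c * r\<^sup>2) \<le> exp (1/c) * exp (- r)"
    by (simp add: exp_add[symmetric])
  then have *: "fact m * (exp r * exp (- c * r\<^sup>2)) \<le> fact m * (exp (1/c) * exp (- r))"
    by (rule mult_left_mono) simp
  have "r ^ m * exp (- c * r\<^sup>2) \<le> fact m * exp r * exp (- c * r\<^sup>2)"
    using power_le_fact_exp[OF assms(1)] by (rule mult_right_mono) simp
  with * show ?thesis by (simp only: mult.assoc)
qed

lemma integrable_exp_minus: "integrable lborel (\<lambda>r::real. indicator {0..} r * exp (- r))"
proof (rule integrableI_nonneg)
  have lim: "((\<lambda>r::real. - exp (- r)) \<longlongrightarrow> - 0) at_top"
    by (intro tendsto_minus filterlim_compose[OF exp_at_bot filterlim_uminus_at_bot_at_top])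
  have "(\<integral>\<^sup>+(r::real). ennreal (exp (- r)) * indicator {0..} r \<partial>lborel) = ennreal (- 0 - (- exp (- 0)))"
    by (rule nn_integral_FTC_atLeast[where F="\<lambda>r. - exp (- r)", OF _ _ _ lim]) (auto intro!: derivative_eq_intros)
  then show "(\<integral>\<^sup>+(r::real). ennreal (indicator {0..} r * exp (- r)) \<partial>lborel) < \<infinity>"
    by (simp add: ennreal_mult' mult.commute ennreal_indicator)
qed auto

lemma integrable_norm_power_gaussian:
  assumes "c > 0"
  shows "integrable (lborel :: (real ^ 'n::finite) measure) (\<lambda>x. norm x ^ m * exp (- c * (norm x)\<^sup>2))"
proof (subst integral_norm_lborel(2))
  let ?n = "CARD('n)"
  define p where "p = ?n - 1"
  let ?K = "real ?n * unit_ball_vol (real ?n) * (fact (p + m) * exp (1/c))"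
  show "integrable lborel (\<lambda>r. radial_density ?n r * (r ^ m * exp (- c * r\<^sup>2)))"
  proof (rule Bochner_Integration.integrable_bound[OF integrable_mult_right[OF integrable_exp_minus, of ?K]])
    show "AE r in lborel. norm (radial_density ?n r * (r ^ m * exp (- c * r\<^sup>2))) \<le> norm (?K * (indicator {0..} r * exp (- r)))"
    proof (rule AE_I2)
      fix r :: real
      show "norm (radial_density ?n r * (r ^ m * exp (- c * r\<^sup>2))) \<le> norm (?K * (indicator {0..} r * exp (- r)))"
      proof (cases "r \<ge> 0")
        case True
        have "real ?n * unit_ball_vol (real ?n) * (r ^ (p + m) * exp (- c * r\<^sup>2))
          \<le> real ?n * unit_ball_vol (real ?n) * (fact (p + m) * exp (1 / c) * exp (- r))"
          using power_gaussian_le[OF True assms, of "p + m"] by (intro mult_left_mono) auto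
        then show ?thesis using True
          by (simp add: radial_density_def p_def[symmetric] power_add abs_mult mult_ac del: One_nat_def)
      qed (simp add: radial_density_def)
    qed
  qed auto
qed auto

section \<open>The weighted space\<close>

lemma wgt_eq: "wgt x = exp (- (1/4) * (norm x)\<^sup>2)"
  by (simp add: wgt_def)

lemma abs_wgt [simp]: "\<bar>wgt x\<bar> = wgt x"
  using wgt_pos[of x] by simp

lemma radialD: "radial f \<Longrightarrow> norm x = norm y \<Longrightarrow> f x = f y"
  unfolding radial_def by blast

lemma radial_comp_norm: "radial (\<lambda>x. F (norm x))"
  by (simp add: radial_def)

text \<open>The standard membership test: after squaring, the binomial expansion leaves powers of
  the norm against the Gaussian weight.\<close>

lemma poly_bounded_L2rad:
  fixes f :: "real ^ 'n::finite \<Rightarrow> real"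
  assumes [measurable]: "f \<in> borel_measurable borel" and "radial f"
    and bound: "\<And>x. \<bar>f x\<bar> \<le> C * (1 + norm x) ^ m"
  shows "f \<in> L2rad"
proof -
  have "integrable (lborel :: (real ^ 'n) measure) (\<lambda>x. C\<^sup>2 * (\<Sum>k\<le>2 * m. real ((2 * m) choose k) * (norm x ^ k * exp (- (1/4) * (norm x)\<^sup>2))))"
    by (intro integrable_mult_right Bochner_Integration.integrable_sum integrable_norm_power_gaussian) simp
  then have "integrable (lborel :: (real ^ 'n) measure) (\<lambda>x. (f x)\<^sup>2 * wgt x)"
  proof (rule Bochner_Integration.integrable_bound)
    show "AE x in lborel. norm ((f x)\<^sup>2 * wgt x) \<le> norm (C\<^sup>2 * (\<Sum>k\<le>2 * m. real ((2 * m) choose k) * (norm x ^ k * exp (- (1/4) * (norm x)\<^sup>2))))"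
    proof (rule AE_I2)
      fix x :: "real ^ 'n"
      have "(f x)\<^sup>2 \<le> (C * (1 + norm x) ^ m)\<^sup>2"
        using power_mono[OF bound[of x], of 2] by simp
      also have "\<dots> = C\<^sup>2 * (norm x + 1) ^ (2 * m)"
        by (simp add: power_mult_distrib power_mult[symmetric] mult.commute add.commute)
      also have "(norm x + 1) ^ (2 * m) = (\<Sum>k\<le>2 * m. real ((2 * m) choose k) * norm x ^ k)"
        by (simp add: binomial_ring)
      finally have "(f x)\<^sup>2 * wgt x \<le> C\<^sup>2 * (\<Sum>k\<le>2 * m. real ((2 * m) choose k) * norm x ^ k) * wgt x"
        using wgt_pos[of x] by (intro mult_right_mono) auto
      then have "(f x)\<^sup>2 * wgt x \<le> C\<^sup>2 * (\<Sum>k\<le>2 * m. real ((2 * m) choose k) * (norm x ^ k * exp (- (1/4) * (norm x)\<^sup>2)))"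
        by (simp add: wgt_eq sum_distrib_right mult.assoc)
      then show "norm ((f x)\<^sup>2 * wgt x) \<le> norm (C\<^sup>2 * (\<Sum>k\<le>2 * m. real ((2 * m) choose k) * (norm x ^ k * exp (- (1/4) * (norm x)\<^sup>2))))"
        using wgt_pos[of x] by simp
    qed
  qed auto
  then show ?thesis using assms by (simp add: L2rad_def)
qed

lemma L2rad_const: "(\<lambda>x :: real ^ 'n::finite. c) \<in> L2rad"
  by (rule poly_bounded_L2rad[where C="\<bar>c\<bar>" and m=0]) (auto simp: radial_def)

lemma toH_eq_iff: "f \<in> L2rad \<Longrightarrow> g \<in> L2rad \<Longrightarrow> toH f = toH g \<longleftrightarrow> (AE x in lborel. f x = g x)"
  by transfer (simp add: L2rad_rel_def)

lemma toH_ex: "\<exists>f. f \<in> L2rad \<and> u = toH f"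
  by transfer (auto simp: L2rad_rel_def)

lemma toH_add: "f \<in> L2rad \<Longrightarrow> g \<in> L2rad \<Longrightarrow> toH (\<lambda>x. f x + g x) = toH f + toH g"
  by transfer (simp add: L2rad_rel_def L2rad_add)

lemma toH_diff: "f \<in> L2rad \<Longrightarrow> g \<in> L2rad \<Longrightarrow> toH (\<lambda>x. f x - g x) = toH f - toH g"
  by transfer (simp add: L2rad_rel_def L2rad_minus)

lemma toH_scale: "f \<in> L2rad \<Longrightarrow> toH (\<lambda>x. c * f x) = c *\<^sub>R toH f"
  by transfer (simp add: L2rad_rel_def L2rad_scale)

lemma toH_zero: "toH (\<lambda>x. 0) = 0"
  by transfer (simp add: L2rad_rel_def L2rad_zero)

lemma inner_toH: "f \<in> L2rad \<Longrightarrow> g \<in> L2rad \<Longrightarrow> toH f \<bullet> toH g = (LINT x|lborel. f x * g x * wgt x)"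
  by transfer simp

lemma norm_toH: "f \<in> L2rad \<Longrightarrow> (norm (toH f))\<^sup>2 = (LINT x|lborel. (f x)\<^sup>2 * wgt x)"
  unfolding power2_norm_eq_inner by (simp add: inner_toH power2_eq_square)

lemma L2rad_borel: "f \<in> L2rad \<Longrightarrow> f \<in> borel_measurable borel"
  by (simp add: L2rad_def)

lemma L2rad_radial: "f \<in> L2rad \<Longrightarrow> radial f"
  by (simp add: L2rad_def)

lemma L2rad_integrable: "f \<in> L2rad \<Longrightarrow> integrable lborel (\<lambda>x. (f x)\<^sup>2 * wgt x)"
  by (simp add: L2rad_def)

lemma L2rad_abs: "f \<in> L2rad \<Longrightarrow> (\<lambda>x. \<bar>f x\<bar>) \<in> L2rad"
proof -
  assume f: "f \<in> L2rad"
  have "radial (\<lambda>x. \<bar>f x\<bar>)"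
    using radialD[OF L2rad_radial[OF f]] unfolding radial_def by metis
  then show ?thesis using f by (auto simp: L2rad_def)
qed

text \<open>Used to extract an actual point from statements that hold almost everywhere.\<close>

lemma not_AE_False: "\<not> (AE x in (lborel :: (real ^ 'n::finite) measure). False)"
proof
  assume "AE x in (lborel :: (real ^ 'n) measure). False"
  then have "UNIV \<in> null_sets (lborel :: (real ^ 'n) measure)"
    using AE_iff_null_sets[of UNIV "lborel :: (real ^ 'n) measure"] by simp
  then show False by (simp add: null_sets_def emeasure_lborel_UNIV)
qed

text \<open>Convergence in the weighted norm is L1 convergence of the weighted squared differences,
  to which the theorem on almost everywhere convergent subsequences applies; the positive weight is
  then divided out.\<close>

lemma toH_AE_subseq:
  assumes f: "\<And>k. f k \<in> L2rad" "g \<in> L2rad" and lim: "(\<lambda>k. toH (f k)) \<longlonglongrightarrow> toH g"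
  obtains r where "strict_mono (r :: nat \<Rightarrow> nat)" "AE x in lborel. (\<lambda>k. f (r k) x) \<longlonglongrightarrow> g x"
proof -
  have "(\<lambda>k. (norm (toH (f k) - toH g))\<^sup>2) \<longlonglongrightarrow> 0\<^sup>2"
    using lim by (intro tendsto_power) (simp add: LIM_zero tendsto_norm_zero)
  also have "(\<lambda>k. (norm (toH (f k) - toH g))\<^sup>2) = (\<lambda>k. LINT x|lborel. norm ((f k x - g x)\<^sup>2 * wgt x))"
    using wgt_pos by (simp add: toH_diff[symmetric] f norm_toH L2rad_minus abs_mult less_imp_le)
  finally have *: "(\<lambda>k. LINT x|lborel. norm ((f k x - g x)\<^sup>2 * wgt x)) \<longlonglongrightarrow> 0" by simp
  obtain r where r: "strict_mono r" "AE x in lborel. (\<lambda>k. (f (r k) x - g x)\<^sup>2 * wgt x) \<longlonglongrightarrow> 0"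
    using tendsto_L1_AE_subseq[OF _ *] L2rad_integrable[OF L2rad_minus[OF f(1) f(2)]] by blast
  have *: "(\<lambda>k. f (r k) x) \<longlonglongrightarrow> g x" if "(\<lambda>k. (f (r k) x - g x)\<^sup>2 * wgt x) \<longlonglongrightarrow> 0" for x
  proof -
    have "(\<lambda>k. sqrt ((f (r k) x - g x)\<^sup>2 * wgt x / wgt x)) \<longlonglongrightarrow> sqrt (0 / wgt x)"
      using that wgt_pos[of x] by (intro tendsto_intros) auto
    then have "(\<lambda>k. \<bar>f (r k) x - g x\<bar>) \<longlonglongrightarrow> 0" using wgt_pos[of x] by (simp add: less_imp_neq[symmetric])
    then show ?thesis by (intro LIM_zero_cancel[where l="g x"]) (rule tendsto_rabs_zero_cancel)
  qed
  have "AE x in lborel. (\<lambda>k. f (r k) x) \<longlonglongrightarrow> g x"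
    using r(2) by eventually_elim (rule *)
  then show thesis using that r(1) by simp
qed

section \<open>Completeness of the weighted space\<close>

text \<open>Fatou's lemma, which delivers square integrability of the limit together with the
  bound.\<close>

lemma toH_norm_liminf:
  assumes f: "\<And>k. f k \<in> L2rad" and g: "g \<in> borel_measurable borel" "radial g"
    and lim: "AE x in lborel. (\<lambda>k. f k x) \<longlonglongrightarrow> g x" and bound: "\<And>k. norm (toH (f k)) \<le> B"
  shows "g \<in> L2rad" "norm (toH g) \<le> B"
proof -
  note [measurable] = L2rad_borel[OF f] g(1)
  have B: "B \<ge> 0" by (rule order_trans[OF norm_ge_zero bound])
  have "(\<integral>\<^sup>+x. ennreal ((g x)\<^sup>2 * wgt x) \<partial>lborel) = (\<integral>\<^sup>+x. liminf (\<lambda>k. ennreal ((f k x)\<^sup>2 * wgt x)) \<partial>lborel)"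
  proof (rule nn_integral_cong_AE)
    show "AE x in lborel. ennreal ((g x)\<^sup>2 * wgt x) = liminf (\<lambda>k. ennreal ((f k x)\<^sup>2 * wgt x))"
      using lim
    proof eventually_elim
      case (elim x)
      then have "(\<lambda>k. ennreal ((f k x)\<^sup>2 * wgt x)) \<longlonglongrightarrow> ennreal ((g x)\<^sup>2 * wgt x)"
        by (intro tendsto_intros)
      then show ?case by (simp add: lim_imp_Liminf)
    qed
  qed
  also have "\<dots> \<le> liminf (\<lambda>k. \<integral>\<^sup>+x. ennreal ((f k x)\<^sup>2 * wgt x) \<partial>lborel)"
    by (rule nn_integral_liminf) auto
  also have "\<dots> \<le> limsup (\<lambda>k. \<integral>\<^sup>+x. ennreal ((f k x)\<^sup>2 * wgt x) \<partial>lborel)"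
    by (intro Liminf_le_Limsup) auto
  also have "\<dots> \<le> ennreal (B\<^sup>2)"
  proof (rule Limsup_bounded, intro always_eventually allI)
    fix k
    have "(\<integral>\<^sup>+x. ennreal ((f k x)\<^sup>2 * wgt x) \<partial>lborel) = ennreal ((norm (toH (f k)))\<^sup>2)"
      unfolding norm_toH[OF f]
      by (intro nn_integral_eq_integral L2rad_integrable f) (auto simp: wgt_def)
    also have "\<dots> \<le> ennreal (B\<^sup>2)" using bound by (intro ennreal_leI power_mono) auto
    finally show "(\<integral>\<^sup>+x. ennreal ((f k x)\<^sup>2 * wgt x) \<partial>lborel) \<le> ennreal (B\<^sup>2)" .
  qed
  finally have *: "(\<integral>\<^sup>+x. ennreal ((g x)\<^sup>2 * wgt x) \<partial>lborel) \<le> ennreal (B\<^sup>2)" .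
  have "integrable lborel (\<lambda>x. (g x)\<^sup>2 * wgt x)"
    using * by (intro integrableI_nonneg) (auto simp: wgt_def intro: le_less_trans)
  then show gL: "g \<in> L2rad" using g by (simp add: L2rad_def)
  have "(\<integral>\<^sup>+x. ennreal ((g x)\<^sup>2 * wgt x) \<partial>lborel) = ennreal ((norm (toH g))\<^sup>2)"
    unfolding norm_toH[OF gL]
    by (intro nn_integral_eq_integral L2rad_integrable gL) (auto simp: wgt_def)
  with * have "(norm (toH g))\<^sup>2 \<le> B\<^sup>2" by simp
  then show "norm (toH g) \<le> B" using B by (rule power2_le_imp_le)
qed

text \<open>The weight has finite mass, so the constant 1 is a vector of the space and
  Cauchy-Schwarz embeds it into weighted L1. Cauchy sequences can then be treated by the L1
  theory.\<close>

lemma integral_abs_wgt_le: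
  fixes f :: "real ^ 'n::finite \<Rightarrow> real"
  assumes "f \<in> L2rad"
  shows "(LINT x|lborel. \<bar>f x\<bar> * wgt x) \<le> norm (toH f) * norm (toH (\<lambda>x :: real ^ 'n::finite. 1))"
proof -
  note a = L2rad_abs[OF assms]
  have "(LINT x|lborel. \<bar>f x\<bar> * wgt x) = toH (\<lambda>x. \<bar>f x\<bar>) \<bullet> toH (\<lambda>x. 1)"
    by (simp add: inner_toH a L2rad_const)
  also have "\<dots> \<le> norm (toH (\<lambda>x. \<bar>f x\<bar>)) * norm (toH (\<lambda>x :: real ^ 'n. 1))" by (rule norm_cauchy_schwarz)
  also have "norm (toH (\<lambda>x. \<bar>f x\<bar>)) = norm (toH f)"
    by (rule power2_eq_imp_eq) (simp_all add: norm_toH a assms)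
  finally show ?thesis .
qed

text \<open>A Cauchy sequence is also Cauchy in weighted L1, so a subsequence converges almost
  everywhere. Fatou's lemma along this subsequence bounds the distance of the limit from every late
  member of the sequence.\<close>

instance radL2 :: (finite) complete_space
proof
  fix X :: "nat \<Rightarrow> 'a radL2" assume X: "Cauchy X"
  have "\<exists>f. f \<in> L2rad \<and> X k = toH f" for k
    by (rule toH_ex)
  then obtain f where f: "\<And>k. f k \<in> L2rad" "\<And>k. X k = toH (f k)" by metis
  note [measurable] = L2rad_borel[OF f(1)]
  define K where "K = norm (toH (\<lambda>x :: real ^ 'a. 1)) + 1"
  have K: "K > 0" by (simp add: K_def add_nonneg_pos)
  have int: "integrable lborel (\<lambda>x. f k x * wgt x)" for k
    using L2rad_mult_integrable[OF f(1) L2rad_const[of 1]] by simp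
  have CX: "\<exists>N. \<forall>m\<ge>N. \<forall>n\<ge>N. norm (X m - X n) < \<epsilon>" if "\<epsilon> > 0" for \<epsilon>
    using X that unfolding Cauchy_def dist_norm by blast
  obtain r where r: "strict_mono r" "AE x in lborel. Cauchy (\<lambda>i. f (r i) x * wgt x)"
  proof (rule cauchy_L1_AE_cauchy_subseq[OF int])
    fix \<epsilon> :: real assume "\<epsilon> > 0"
    then obtain N where N: "\<And>m n. m \<ge> N \<Longrightarrow> n \<ge> N \<Longrightarrow> norm (X m - X n) < \<epsilon> / K"
      using CX[of "\<epsilon> / K"] K by auto
    have "LINT x|lborel. norm (f i x * wgt x - f j x * wgt x) < \<epsilon>" if "i \<ge> N" "j \<ge> N" for i j
    proof -
      have "(LINT x|lborel. norm (f i x * wgt x - f j x * wgt x)) = (LINT x|lborel. \<bar>f i x - f j x\<bar> * wgt x)"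
        by (simp add: left_diff_distrib[symmetric] abs_mult)
      also have "\<dots> \<le> norm (toH (\<lambda>x. f i x - f j x)) * norm (toH (\<lambda>x :: real ^ 'a. 1))"
        by (intro integral_abs_wgt_le L2rad_minus f)
      also have "\<dots> \<le> norm (X i - X j) * K"
        by (simp add: toH_diff f K_def mult_left_mono)
      also have "\<dots> < \<epsilon>" using N[OF that] K by (simp add: field_simps)
      finally show ?thesis .
    qed
    then show "\<exists>N. \<forall>i\<ge>N. \<forall>j\<ge>N. LINT x|lborel. norm (f i x * wgt x - f j x * wgt x) < \<epsilon>" by blast
  qed
  have conv: "AE x in lborel. convergent (\<lambda>j. f (r j) x)"
    using r(2)
  proof eventually_elim
    case (elim x)
    then obtain l where "(\<lambda>i. f (r i) x * wgt x) \<longlonglongrightarrow> l"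
      using Cauchy_convergent convergent_def by blast
    from tendsto_divide[OF this tendsto_const[of "wgt x"]]
    have "(\<lambda>i. f (r i) x) \<longlonglongrightarrow> l / wgt x" using wgt_pos[of x] by simp
    then show ?case by (auto simp: convergent_def)
  qed
  \<comment> \<open>Whether the subsequence converges at \<open>x\<close>, and to which limit,
    depends on \<open>norm x\<close> only; with the default 0 elsewhere \<open>g\<close> is radial
    everywhere and not merely almost everywhere.\<close>
  define g where "g x = (if Cauchy (\<lambda>j. f (r j) x) then lim (\<lambda>j. f (r j) x) else 0)" for x
  have gm: "g \<in> borel_measurable borel" unfolding g_def[abs_def] by measurable
  have gr: "radial g"
    unfolding radial_def
  proof (intro allI impI)
    fix x y :: "real ^ 'a" assume "norm x = norm y"
    then have "(\<lambda>j. f (r j) x) = (\<lambda>j. f (r j) y)" using radialD[OF L2rad_radial[OF f(1)]] by blast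
    then show "g x = g y" by (simp only: g_def)
  qed
  have glim: "AE x in lborel. (\<lambda>j. f (r j) x) \<longlonglongrightarrow> g x"
    using conv by eventually_elim (simp add: g_def convergent_LIMSEQ_iff Cauchy_convergent_iff)
  have main: "(\<lambda>x. g x - f i x) \<in> L2rad \<and> norm (toH (\<lambda>x. g x - f i x)) \<le> \<epsilon>"
    if N: "\<And>m n. m \<ge> N \<Longrightarrow> n \<ge> N \<Longrightarrow> norm (X m - X n) < \<epsilon>" and i: "i \<ge> N" for i N \<epsilon>
  proof (intro conjI)
    have 1: "(\<lambda>x. f (r (j + N)) x - f i x) \<in> L2rad" for j by (intro L2rad_minus f)
    have 2: "(\<lambda>x. g x - f i x) \<in> borel_measurable borel" using gm by measurable
    have 3: "radial (\<lambda>x. g x - f i x)"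
      using radialD[OF gr] radialD[OF L2rad_radial[OF f(1)]] unfolding radial_def by metis
    have 4: "AE x in lborel. (\<lambda>j. f (r (j + N)) x - f i x) \<longlonglongrightarrow> g x - f i x"
      using glim by eventually_elim (intro tendsto_intros LIMSEQ_ignore_initial_segment)
    have 5: "norm (toH (\<lambda>x. f (r (j + N)) x - f i x)) \<le> \<epsilon>" for j
    proof -
      have "r (j + N) \<ge> N" using seq_suble[OF r(1), of "j + N"] by simp
      then show ?thesis using N[of "r (j + N)" i] i by (simp add: toH_diff f less_imp_le)
    qed
    show "(\<lambda>x. g x - f i x) \<in> L2rad" "norm (toH (\<lambda>x. g x - f i x)) \<le> \<epsilon>"
      using toH_norm_liminf[OF 1 2 3 4 5] by auto
  qed
  obtain N1 where "\<And>m n. m \<ge> N1 \<Longrightarrow> n \<ge> N1 \<Longrightarrow> norm (X m - X n) < 1"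
    using CX[of 1] by auto
  then have gL: "g \<in> L2rad"
    using L2rad_add[OF conjunct1[OF main[of N1 1 N1]] f(1)[of N1]] by simp
  have "X \<longlonglongrightarrow> toH g"
  proof (rule LIMSEQ_I)
    fix \<epsilon> :: real assume "\<epsilon> > 0"
    then obtain N where N: "\<And>m n. m \<ge> N \<Longrightarrow> n \<ge> N \<Longrightarrow> norm (X m - X n) < \<epsilon> / 2"
      using CX[of "\<epsilon> / 2"] by auto
    have "norm (X i - toH g) < \<epsilon>" if "i \<ge> N" for i
      using main[OF N that] \<open>\<epsilon> > 0\<close> by (simp add: f(2) toH_diff[OF gL f(1)] norm_minus_commute)
    then show "\<exists>no. \<forall>n\<ge>no. norm (X n - toH g) < \<epsilon>" by blast
  qed
  then show "convergent X" by (auto simp: convergent_def)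
qed

section \<open>Smooth radial functions and cutoffs\<close>

lemma dir_deriv_eq:
  assumes "(f has_derivative f') (at x)"
  shows "dir_deriv e f x = f' e"
proof -
  have "((\<lambda>t. x + t *\<^sub>R e) has_derivative (\<lambda>t. t *\<^sub>R e)) (at 0)"
    by (auto intro!: derivative_eq_intros)
  then have "((\<lambda>t. f (x + t *\<^sub>R e)) has_derivative (\<lambda>t. f' (t *\<^sub>R e))) (at 0)"
    using has_derivative_compose[of "\<lambda>t. x + t *\<^sub>R e" _ 0 UNIV f f'] assms by simp
  moreover have "(\<lambda>t. f' (t *\<^sub>R e)) = (*) (f' e)"
    using linear_scale[OF has_derivative_linear[OF assms]] by (auto simp: mult.commute)
  ultimately have "((\<lambda>t. f (x + t *\<^sub>R e)) has_field_derivative f' e) (at 0)"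
    by (simp add: has_field_derivative_def)
  then show ?thesis unfolding dir_deriv_def by (rule DERIV_imp_deriv)
qed

text \<open>An algebra of functions whose generators are differentiable with partial derivatives in the
  algebra consists of smooth functions; this replaces a calculus of smooth functions.\<close>

inductive_set function_algebra :: "(real ^ 'n \<Rightarrow> real) set \<Rightarrow> (real ^ 'n \<Rightarrow> real) set" for G where
  const: "(\<lambda>x. c) \<in> function_algebra G"
| gen: "g \<in> G \<Longrightarrow> g \<in> function_algebra G"
| add: "f \<in> function_algebra G \<Longrightarrow> g \<in> function_algebra G \<Longrightarrow> (\<lambda>x. f x + g x) \<in> function_algebra G"
| mult: "f \<in> function_algebra G \<Longrightarrow> g \<in> function_algebra G \<Longrightarrow> (\<lambda>x. f x * g x) \<in> function_algebra G"

lemma smooth_funI: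
  fixes G :: "(real ^ 'n::finite \<Rightarrow> real) set"
  assumes diff: "\<And>g x. g \<in> G \<Longrightarrow> g differentiable (at x)"
    and closed: "\<And>g i. g \<in> G \<Longrightarrow> pdiff i g \<in> function_algebra G"
    and f: "f \<in> function_algebra G"
  shows "smooth_fun f"
proof -
  have step: "(\<forall>x. f differentiable (at x)) \<and> (\<forall>i. pdiff i f \<in> function_algebra G)" if "f \<in> function_algebra G" for f
    using that
  proof induction
    case (const c)
    have "pdiff i (\<lambda>x :: real ^ 'n. c) = (\<lambda>x. 0)" for i
      by (intro ext dir_deriv_eq[of _ "\<lambda>h. 0"]) auto
    then show ?case by (auto intro: function_algebra.const)
  next
    case (gen g)
    then show ?case using diff closed by blast
  next
    case (add f g)
    have "pdiff i (\<lambda>x. f x + g x) = (\<lambda>x. pdiff i f x + pdiff i g x)" for i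
    proof
      fix x
      obtain f' g' where "(f has_derivative f') (at x)" "(g has_derivative g') (at x)"
        using add.IH unfolding differentiable_def by meson
      then show "pdiff i (\<lambda>x. f x + g x) x = pdiff i f x + pdiff i g x"
        using dir_deriv_eq[OF has_derivative_add] dir_deriv_eq by metis
    qed
    then show ?case using add.IH by (auto intro: function_algebra.add)
  next
    case (mult f g)
    have "pdiff i (\<lambda>x. f x * g x) = (\<lambda>x. f x * pdiff i g x + pdiff i f x * g x)" for i
    proof
      fix x
      obtain f' g' where "(f has_derivative f') (at x)" "(g has_derivative g') (at x)"
        using mult.IH unfolding differentiable_def by meson
      then show "pdiff i (\<lambda>x. f x * g x) x = f x * pdiff i g x + pdiff i f x * g x"
        using dir_deriv_eq[OF has_derivative_mult] dir_deriv_eq by metis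
    qed
    then show ?case using mult.IH mult.hyps
      by (auto intro!: function_algebra.add function_algebra.mult)
  qed
  have "foldr pdiff is f \<in> function_algebra G" for "is"
    using f step by (induction "is") auto
  then show ?thesis using step unfolding smooth_fun_def by blast
qed

text \<open>The powers of $1/x$ make the family closed under differentiation.\<close>

definition bump :: "nat \<Rightarrow> real \<Rightarrow> real" where
  "bump k x = (if x > 0 then (1/x) ^ k * exp (- (1/x)) else 0)"

lemma bump_bounds: "0 \<le> bump k x" "bump k x \<le> fact k"
proof -
  show "0 \<le> bump k x" by (simp add: bump_def)
  have "(1/x) ^ k * exp (- (1/x)) \<le> fact k" if "x > 0"
    using power_le_fact_exp[of "1/x" k] that by (simp add: exp_minus field_simps)
  then show "bump k x \<le> fact k" by (simp add: bump_def)
qed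

text \<open>At the origin the difference quotient is \<open>bump (k + 2) h * h\<close> for positive
  \<open>h\<close>, bounded by a factorial times |h|: raising the index by two absorbs the division
  by \<open>h\<close> and leaves a factor \<open>h\<close> to spare.\<close>

lemma DERIV_bump: "(bump k has_real_derivative (- real k * bump (k + 1) x + bump (k + 2) x)) (at x)"
proof -
  consider "x > 0" | "x < 0" | "x = 0" by linarith
  then show ?thesis
  proof cases
    case 1
    have "((\<lambda>x. (1/x) ^ k * exp (- (1/x))) has_real_derivative
        real k * (1/x) ^ (k - 1) * (- (1 / x\<^sup>2)) * exp (- (1/x)) + (1/x) ^ k * (exp (- (1/x)) * (1/x\<^sup>2))) (at x)"
      using 1 by (auto intro!: derivative_eq_intros simp: power2_eq_square)
    also have "real k * (1/x) ^ (k - 1) * (- (1 / x\<^sup>2)) * exp (- (1/x)) + (1/x) ^ k * (exp (- (1/x)) * (1/x\<^sup>2))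
      = - real k * bump (k + 1) x + bump (k + 2) x"
    proof -
      have "real k * (1/x) ^ (k - 1) * (1 / x\<^sup>2) = real k * (1/x) ^ (k + 1)"
        by (cases k) (auto simp: power2_eq_square)
      moreover have "(1/x) ^ k * (1/x\<^sup>2) = (1/x) ^ (k + 2)" by (simp add: power_add power2_eq_square)
      ultimately show ?thesis using 1 by (simp add: bump_def)
    qed
    finally show ?thesis
      by (rule has_field_derivative_transform_within_open[of _ _ _ "{0<..}"]) (use 1 in \<open>auto simp: bump_def\<close>)
  next
    case 2
    have "((\<lambda>x. 0) has_real_derivative 0) (at x)" by simp
    then have "(bump k has_real_derivative 0) (at x)"
      by (rule has_field_derivative_transform_within_open[of _ _ _ "{..<0}"]) (use 2 in \<open>auto simp: bump_def\<close>)
    then show ?thesis using 2 by (simp add: bump_def)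
  next
    case 3
    have "((\<lambda>h. bump k h / h) \<longlongrightarrow> 0) (at 0)"
    proof (rule Lim_null_comparison)
      show "\<forall>\<^sub>F h in at 0. norm (bump k h / h) \<le> fact (k + 2) * \<bar>h\<bar>"
      proof (rule always_eventually, rule allI)
        fix h :: real
        show "norm (bump k h / h) \<le> fact (k + 2) * \<bar>h\<bar>"
        proof (cases "h > 0")
          case True
          have "bump k h / h = bump (k + 2) h * h"
            using True by (simp add: bump_def power_add power2_eq_square)
          also have "\<dots> \<le> fact (k + 2) * h" by (intro mult_right_mono bump_bounds) (use True in simp)
          finally show ?thesis using True bump_bounds(1)[of k h] by simp
        qed (auto simp: bump_def mult_nonneg_nonpos simp del: fact_Suc)
      qed
      show "((\<lambda>h. fact (k + 2) * \<bar>h\<bar>) \<longlongrightarrow> (0::real)) (at 0)"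
        by (auto intro!: tendsto_eq_intros)
    qed
    then show ?thesis using 3 by (simp add: has_field_derivative_iff bump_def)
  qed
qed

lemma has_derivative_norm_square_comp:
  fixes x :: "'a::real_inner"
  assumes "(\<phi> has_real_derivative D) (at ((norm x)\<^sup>2))"
  shows "((\<lambda>x. \<phi> ((norm x)\<^sup>2)) has_derivative (\<lambda>h. D * (2 * (x \<bullet> h)))) (at x)"
proof -
  have "((\<lambda>x. (norm x)\<^sup>2) has_derivative (\<lambda>h. 2 * (x \<bullet> h))) (at x)"
    unfolding power2_norm_eq_inner by (auto intro!: derivative_eq_intros simp: inner_commute)
  then show ?thesis
    using has_derivative_compose[of "\<lambda>x. (norm x)\<^sup>2" "\<lambda>h. 2 * (x \<bullet> h)" x UNIV \<phi> "(*) D"] assms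
    by (simp add: has_field_derivative_def)
qed

text \<open>The coordinates give all polynomials in |x|^2, the bumps of every order make the family
  stable under derivatives, and the rational function generates the ground state. One algebra
  therefore serves both kinds of functions that are cut off below.\<close>

definition cutoff_gens :: "real \<Rightarrow> real \<Rightarrow> real \<Rightarrow> (real ^ 'n \<Rightarrow> real) set" where
  "cutoff_gens R a b = {\<lambda>x. x $ i | i. True} \<union> {\<lambda>x. bump k (1 - (norm x)\<^sup>2 / R\<^sup>2) | k. True}
     \<union> {\<lambda>x. 1 / (a * (norm x)\<^sup>2 + b)}"

lemma norm_square_in_function_algebra:
  "(\<lambda>x :: real ^ 'n::finite. (norm x)\<^sup>2) \<in> function_algebra (cutoff_gens R a b)"
proof -
  have "(\<lambda>x. \<Sum>i\<in>S. x $ i * x $ i) \<in> function_algebra (cutoff_gens R a b)" if "finite S" for S :: "'n set"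
    using that
  proof (induction S rule: finite_induct)
    case (insert i S)
    have "(\<lambda>x. x $ i) \<in> function_algebra (cutoff_gens R a b)"
      by (rule function_algebra.gen) (auto simp: cutoff_gens_def)
    then show ?case using insert by (simp add: function_algebra.add function_algebra.mult)
  qed (simp add: function_algebra.const)
  from this[of UNIV] show ?thesis
    by (simp add: power2_norm_eq_inner inner_vec_def)
qed

lemma smooth_cutoff_algebra:
  fixes f :: "real ^ 'n::finite \<Rightarrow> real"
  assumes "R > 0" "a > 0" "b > 0" and f: "f \<in> function_algebra (cutoff_gens R a b)"
  shows "smooth_fun f"
proof (rule smooth_funI[OF _ _ f])
  let ?A = "function_algebra (cutoff_gens R a b :: (real ^ 'n \<Rightarrow> real) set)"
  have coord: "(\<lambda>x. x $ i) \<in> ?A" for i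
    by (rule function_algebra.gen) (auto simp: cutoff_gens_def)
  have bmp: "(\<lambda>x. bump k (1 - (norm x)\<^sup>2 / R\<^sup>2)) \<in> ?A" for k
    by (rule function_algebra.gen) (auto simp: cutoff_gens_def)
  have rat: "(\<lambda>x. 1 / (a * (norm x)\<^sup>2 + b)) \<in> ?A"
    by (rule function_algebra.gen) (auto simp: cutoff_gens_def)
  have d1: "((\<lambda>x :: real ^ 'n. x $ j) has_derivative (\<lambda>h. h $ j)) (at x)" for j x
    by (rule bounded_linear_imp_has_derivative[OF bounded_linear_vec_nth])
  have d2: "((\<lambda>x :: real ^ 'n. bump k (1 - (norm x)\<^sup>2 / R\<^sup>2)) has_derivative
     (\<lambda>h. (- (1 / R\<^sup>2) * (- real k * bump (k + 1) (1 - (norm x)\<^sup>2 / R\<^sup>2) + bump (k + 2) (1 - (norm x)\<^sup>2 / R\<^sup>2))) * (2 * (x \<bullet> h)))) (at x)" for k x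
  proof (rule has_derivative_norm_square_comp[where \<phi>="\<lambda>s. bump k (1 - s / R\<^sup>2)"])
    have "((\<lambda>s. 1 - s / R\<^sup>2) has_real_derivative - (1 / R\<^sup>2)) (at ((norm x)\<^sup>2))"
      using assms(1) by (auto intro!: derivative_eq_intros simp: power2_eq_square power4_eq_xxxx)
    from DERIV_chain2[OF DERIV_bump this]
    show "((\<lambda>s. bump k (1 - s / R\<^sup>2)) has_real_derivative
      - (1 / R\<^sup>2) * (- real k * bump (k + 1) (1 - (norm x)\<^sup>2 / R\<^sup>2) + bump (k + 2) (1 - (norm x)\<^sup>2 / R\<^sup>2))) (at ((norm x)\<^sup>2))"
      by (simp only: mult.commute)
  qed
  have pos: "a * (norm x)\<^sup>2 + b > 0" for x :: "real ^ 'n"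
    using assms by (simp add: add_nonneg_pos)
  have d3: "((\<lambda>x :: real ^ 'n. 1 / (a * (norm x)\<^sup>2 + b)) has_derivative
     (\<lambda>h. (- a * ((1 / (a * (norm x)\<^sup>2 + b)) * (1 / (a * (norm x)\<^sup>2 + b)))) * (2 * (x \<bullet> h)))) (at x)" for x
  proof (rule has_derivative_norm_square_comp[where \<phi>="\<lambda>s. 1 / (a * s + b)"])
    show "((\<lambda>s. 1 / (a * s + b)) has_real_derivative - a * ((1 / (a * (norm x)\<^sup>2 + b)) * (1 / (a * (norm x)\<^sup>2 + b)))) (at ((norm x)\<^sup>2))"
      using pos[of x] by (auto intro!: derivative_eq_intros simp: less_imp_neq[symmetric])
  qed
  fix g :: "real ^ 'n \<Rightarrow> real" assume g: "g \<in> cutoff_gens R a b"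
  then consider j where "g = (\<lambda>x. x $ j)" | k where "g = (\<lambda>x. bump k (1 - (norm x)\<^sup>2 / R\<^sup>2))"
    | "g = (\<lambda>x. 1 / (a * (norm x)\<^sup>2 + b))"
    by (auto simp: cutoff_gens_def)
  then have "(\<forall>x. g differentiable (at x)) \<and> (\<forall>i. pdiff i g \<in> ?A)"
  proof cases
    case 1
    have "pdiff i g = (\<lambda>x. axis i 1 $ j)" for i
      unfolding 1 by (rule ext) (rule dir_deriv_eq[OF d1])
    then show ?thesis using d1 unfolding 1 differentiable_def by (auto intro: function_algebra.const)
  next
    case 2
    have "pdiff i g = (\<lambda>x. (- (1 / R\<^sup>2) * (- real k * bump (k + 1) (1 - (norm x)\<^sup>2 / R\<^sup>2) + bump (k + 2) (1 - (norm x)\<^sup>2 / R\<^sup>2))) * (2 * x $ i))" for i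
      unfolding 2 by (rule ext) (simp only: dir_deriv_eq[OF d2] inner_axis inner_real_def mult_1_right)
    then have "pdiff i g \<in> ?A" for i
      by (simp only:) (intro function_algebra.add function_algebra.mult function_algebra.const bmp coord)
    moreover have "g differentiable (at x)" for x
      unfolding 2 differentiable_def by (rule exI) (rule d2)
    ultimately show ?thesis by blast
  next
    case 3
    have "pdiff i g = (\<lambda>x. (- a * ((1 / (a * (norm x)\<^sup>2 + b)) * (1 / (a * (norm x)\<^sup>2 + b)))) * (2 * x $ i))" for i
      unfolding 3 by (rule ext) (simp only: dir_deriv_eq[OF d3] inner_axis inner_real_def mult_1_right)
    then have "pdiff i g \<in> ?A" for i
      by (simp only:) (intro function_algebra.add function_algebra.mult function_algebra.const rat coord)
    moreover have "g differentiable (at x)" for x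
      unfolding 3 differentiable_def by (rule exI) (rule d3)
    ultimately show ?thesis by blast
  qed
  then show "g differentiable (at x)" "pdiff i g \<in> ?A" for x i by blast+
qed

lemma cutoff_Cc_rad:
  fixes f :: "real ^ 'n::finite \<Rightarrow> real"
  assumes "R > 0" "a > 0" "b > 0" and f: "f \<in> function_algebra (cutoff_gens R a b)" and rad: "radial f"
  shows "(\<lambda>x. bump 0 (1 - (norm x)\<^sup>2 / R\<^sup>2) * f x) \<in> Cc_rad"
proof -
  have "(\<lambda>x. bump 0 (1 - (norm x)\<^sup>2 / R\<^sup>2) * f x) \<in> function_algebra (cutoff_gens R a b)"
    by (intro function_algebra.mult f function_algebra.gen) (auto simp: cutoff_gens_def)
  then have "smooth_fun (\<lambda>x. bump 0 (1 - (norm x)\<^sup>2 / R\<^sup>2) * f x)"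
    using smooth_cutoff_algebra assms(1-3) by blast
  moreover have "radial (\<lambda>x. bump 0 (1 - (norm x)\<^sup>2 / R\<^sup>2) * f x)"
    unfolding radial_def using radialD[OF rad] by metis
  moreover have "{x. bump 0 (1 - (norm x)\<^sup>2 / R\<^sup>2) * f x \<noteq> 0} \<subseteq> cball 0 R"
  proof
    fix x assume "x \<in> {x. bump 0 (1 - (norm x)\<^sup>2 / R\<^sup>2) * f x \<noteq> 0}"
    then have "1 - (norm x)\<^sup>2 / R\<^sup>2 > 0" by (auto simp: bump_def split: if_splits)
    then have "(norm x)\<^sup>2 < R\<^sup>2" using assms(1) by (simp add: field_simps)
    then show "x \<in> cball 0 R" using assms(1) power_less_imp_less_base[of "norm x" 2 R] by simp
  qed
  then have "compact (closure {x. bump 0 (1 - (norm x)\<^sup>2 / R\<^sup>2) * f x \<noteq> 0})"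
    using bounded_subset[OF bounded_cball] by (simp add: compact_closure)
  ultimately show ?thesis by (simp add: Cc_rad_def)
qed

section \<open>The operator in the radial variable\<close>

text \<open>The origin is excluded because the norm is not differentiable there; a single point is a
  null set, so the integral identities lose nothing.\<close>

lemma L_fun_radial:
  fixes f :: "real ^ 'n::finite \<Rightarrow> real" and F :: "real \<Rightarrow> real"
  assumes f: "\<And>x. f x = F (norm x)"
    and F1: "\<And>r. r > 0 \<Longrightarrow> (F has_real_derivative F1 r) (at r)"
    and F2: "\<And>r. r > 0 \<Longrightarrow> (F1 has_real_derivative F2 r) (at r)"
    and x: "x \<noteq> 0"
  shows "L_fun f x = F2 (norm x) + (real CARD('n) - 1) / norm x * F1 (norm x) - norm x / 2 * F1 (norm x)
      - F (norm x) + potential CARD('n) (norm x) * F (norm x)"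
proof -
  define r where "r = norm x"
  have r: "r > 0" using x by (simp add: r_def)
  have dn: "(norm has_derivative (\<lambda>h. (y \<bullet> h) / norm y)) (at y)" if "y \<noteq> 0" for y :: "real ^ 'n"
  proof -
    have "(norm has_derivative (\<lambda>h. h \<bullet> sgn y)) (at y)"
      using has_derivative_norm[OF that] by simp
    then show ?thesis by (simp add: sgn_div_norm inner_commute divide_inverse mult.commute)
  qed
  have dFn: "((\<lambda>y. G (norm y)) has_derivative (\<lambda>h. D * ((y \<bullet> h) / norm y))) (at y)"
    if "(G has_real_derivative D) (at (norm y))" "y \<noteq> 0" for G D and y :: "real ^ 'n"
    using has_derivative_compose[OF dn[OF that(2)] that(1)[unfolded has_field_derivative_def]] by simp
  have f_eq: "f = (\<lambda>y. F (norm y))" using f by blast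
  have p1: "pdiff i f y = F1 (norm y) * (y $ i / norm y)" if "y \<noteq> 0" for i y
    using dir_deriv_eq[OF dFn[OF F1 that]] that by (simp add: f_eq inner_axis)
  have p2: "pdiff i (pdiff i f) x = F2 r * (x $ i)\<^sup>2 / r\<^sup>2 + F1 r * (1 / r - (x $ i)\<^sup>2 / r ^ 3)" for i
  proof -
    have "((\<lambda>y. F1 (norm y) * (y $ i * inverse (norm y))) has_derivative
      (\<lambda>h. F1 r * ((x $ i) * (- ((x \<bullet> h) / r) / r\<^sup>2) + h $ i / r) + F2 r * ((x \<bullet> h) / r) * (x $ i / r))) (at x)"
      (is "(_ has_derivative ?D) _")
    proof (rule has_derivative_eq_rhs)
      show "((\<lambda>y. F1 (norm y) * (y $ i * inverse (norm y))) has_derivative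
         (\<lambda>h. F1 (norm x) * (x $ i * (- (inverse (norm x) * ((x \<bullet> h) / norm x) * inverse (norm x))) + h $ i * inverse (norm x))
             + F2 (norm x) * ((x \<bullet> h) / norm x) * (x $ i * inverse (norm x)))) (at x)"
        by (intro has_derivative_mult dFn F2 Deriv.has_derivative_inverse dn x
            bounded_linear_imp_has_derivative[OF bounded_linear_vec_nth]) (use x in auto)
    qed (use r in \<open>auto simp: r_def[symmetric] fun_eq_iff field_simps power2_eq_square\<close>)
    then have "(pdiff i f has_derivative ?D) (at x)"
      by (rule has_derivative_transform_within_open[of _ _ _ _ "- {0}"]) (use x p1 in \<open>auto simp: divide_inverse\<close>)
    from dir_deriv_eq[OF this, of "axis i 1"]
    show ?thesis using r by (simp add: inner_axis field_simps power2_eq_square power3_eq_cube)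
  qed
  have sq: "(\<Sum>i\<in>UNIV. (x $ i)\<^sup>2) = r\<^sup>2"
    by (simp add: r_def norm_vec_def L2_set_def sum_nonneg)
  have "(\<Sum>i\<in>UNIV. pdiff i (pdiff i f) x) = F2 r * r\<^sup>2 / r\<^sup>2 + F1 r * (real CARD('n) / r - r\<^sup>2 / r ^ 3)"
    unfolding p2 sq[symmetric]
    by (simp add: sum.distrib sum_subtractf sum_distrib_left[symmetric] sum_divide_distrib[symmetric])
  also have "\<dots> = F2 r + (real CARD('n) - 1) / r * F1 r"
    using r by (simp add: field_simps power2_eq_square power3_eq_cube)
  finally have lap: "(\<Sum>i\<in>UNIV. pdiff i (pdiff i f) x) = F2 r + (real CARD('n) - 1) / r * F1 r" .
  have "(\<Sum>i\<in>UNIV. x $ i * pdiff i f x) = (\<Sum>i\<in>UNIV. F1 r / r * (x $ i)\<^sup>2)"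
    by (intro sum.cong) (use r in \<open>auto simp: p1[OF x] r_def[symmetric] field_simps power2_eq_square\<close>)
  also have "\<dots> = r * F1 r"
    unfolding sum_distrib_left[symmetric] sq using r by (simp add: power2_eq_square)
  finally have drift: "(\<Sum>i\<in>UNIV. x $ i * pdiff i f x) = r * F1 r" .
  show ?thesis
    unfolding L_fun_def lap drift by (simp add: f r_def[symmetric])
qed

text \<open>Restriction to a coordinate axis, over the whole line and not just the half line: the
  profile of a smooth function is then smooth across 0, and differentiating it amounts to taking a
  partial derivative.\<close>

definition profile :: "(real ^ 'n::finite \<Rightarrow> real) \<Rightarrow> real \<Rightarrow> real" where
  "profile f r = f (r *\<^sub>R axis (SOME i. True) 1)"

lemma profile_norm: "radial f \<Longrightarrow> profile f (norm x) = f x"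
  unfolding profile_def by (rule radialD) auto

lemma DERIV_profile:
  assumes "\<And>x. f differentiable (at x)"
  shows "(profile f has_real_derivative profile (pdiff (SOME i. True) f) r) (at r)"
proof -
  let ?e = "axis (SOME i. True) 1 :: real ^ 'a"
  obtain f' where f': "(f has_derivative f') (at (r *\<^sub>R ?e))"
    using assms unfolding differentiable_def by blast
  have "((\<lambda>t. t *\<^sub>R ?e) has_derivative (\<lambda>t. t *\<^sub>R ?e)) (at r)"
    by (auto intro!: derivative_eq_intros)
  from has_derivative_compose[OF this f']
  have "((\<lambda>t. f (t *\<^sub>R ?e)) has_derivative (\<lambda>t. f' (t *\<^sub>R ?e))) (at r)" by simp
  moreover have "(\<lambda>t. f' (t *\<^sub>R ?e)) = (*) (f' ?e)"
    using linear_scale[OF has_derivative_linear[OF f']] by (auto simp: mult.commute)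
  ultimately show ?thesis
    using dir_deriv_eq[OF f', of ?e] by (simp add: has_field_derivative_def profile_def[abs_def])
qed

lemma Cc_rad_profile:
  fixes f :: "real ^ 'n::finite \<Rightarrow> real"
  assumes f: "f \<in> Cc_rad"
  obtains F F1 F2 R where "\<And>x. f x = F (norm x)" "\<And>r. (F has_real_derivative F1 r) (at r)"
    "\<And>r. (F1 has_real_derivative F2 r) (at r)" "continuous_on UNIV F2" "R > 0"
    "\<And>r. \<bar>r\<bar> \<ge> R \<Longrightarrow> F r = 0 \<and> F1 r = 0 \<and> F2 r = 0"
proof -
  let ?i = "SOME i :: 'n. True"
  have sm: "smooth_fun f" "radial f" "compact (closure {x. f x \<noteq> 0})"
    using f by (auto simp: Cc_rad_def)
  have d: "foldr pdiff is f differentiable (at x)" for "is" x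
    using sm(1) unfolding smooth_fun_def by blast
  define F where "F = profile f"
  define F1 where "F1 = profile (pdiff ?i f)"
  define F2 where "F2 = profile (pdiff ?i (pdiff ?i f))"
  have 1: "(F has_real_derivative F1 r) (at r)" for r
    unfolding F_def F1_def by (rule DERIV_profile) (use d[of "[]"] in simp)
  have 2: "(F1 has_real_derivative F2 r) (at r)" for r
    unfolding F1_def F2_def by (rule DERIV_profile) (use d[of "[?i]"] in simp)
  have 3: "(F2 has_real_derivative profile (pdiff ?i (pdiff ?i (pdiff ?i f))) r) (at r)" for r
    unfolding F2_def by (rule DERIV_profile) (use d[of "[?i, ?i]"] in simp)
  obtain B where B: "\<And>x. x \<in> closure {x. f x \<noteq> 0} \<Longrightarrow> norm x \<le> B"
    using compact_imp_bounded[OF sm(3)] unfolding bounded_iff by blast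
  have z: "F r = 0" if "\<bar>r\<bar> > B" for r
  proof (rule ccontr)
    assume "F r \<noteq> 0"
    then have "r *\<^sub>R axis ?i 1 \<in> closure {x. f x \<noteq> 0}"
      by (intro closure_subset[THEN subsetD]) (simp add: F_def profile_def)
    from B[OF this] show False using that by simp
  qed
  have op: "open {r :: real. \<bar>r\<bar> > B}" by (intro open_Collect_less continuous_intros)
  have z1: "F1 r = 0" if "\<bar>r\<bar> > B" for r
  proof -
    have "(F has_real_derivative 0) (at r)"
      by (rule has_field_derivative_transform_within_open[of "\<lambda>_. 0" _ _ "{r. \<bar>r\<bar> > B}"])
        (use that op z in auto)
    then show ?thesis using 1 DERIV_unique by blast
  qed
  have z2: "F2 r = 0" if "\<bar>r\<bar> > B" for r
  proof -
    have "(F1 has_real_derivative 0) (at r)"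
      by (rule has_field_derivative_transform_within_open[of "\<lambda>_. 0" _ _ "{r. \<bar>r\<bar> > B}"])
        (use that op z1 in auto)
    then show ?thesis using 2 DERIV_unique by blast
  qed
  show thesis
  \<comment> \<open>The derivatives vanish by an argument on an open set, hence under a strict
    inequality; the radius is enlarged by 1 to include the boundary and to be positive.\<close>
  proof (rule that[of F F1 F2 "\<bar>B\<bar> + 1"])
    show "f x = F (norm x)" for x using profile_norm[OF sm(2)] by (simp add: F_def)
    show "continuous_on UNIV F2"
      using 3 DERIV_isCont by (intro continuous_at_imp_continuous_on) blast
    show "F r = 0 \<and> F1 r = 0 \<and> F2 r = 0" if "\<bar>B\<bar> + 1 \<le> \<bar>r\<bar>" for r
    proof -
      have "\<bar>r\<bar> > B" using that by linarith
      then show ?thesis using z z1 z2 by blast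
    qed
  qed (use 1 2 in auto)
qed

section \<open>Functions in the domain of the closure\<close>

lemma Cc_rad_differentiable:
  assumes "f \<in> Cc_rad"
  shows "foldr pdiff is f differentiable (at x)"
  using assms by (simp add: Cc_rad_def smooth_fun_def)

lemma continuous_on_of_differentiable:
  "(\<And>x. f differentiable (at x)) \<Longrightarrow> continuous_on UNIV f"
  by (intro continuous_at_imp_continuous_on ballI differentiable_imp_continuous_within)

text \<open>The upper restriction on the dimension is present through \<open>b_pos\<close>. The
  parameter \<open>n_type\<close> ties the number \<open>n\<close> to the type of the
  vectors.\<close>

locale weight_coeffs =
  fixes n_type :: "'n::finite itself" and n :: nat and a b :: real
  assumes n_eq: "CARD('n) = n" and a_eq: "coeff_a n = a" and b_eq: "coeff_b n = b"
    and a_pos: "0 < a" and b_pos: "0 < b" and n_ge: "7 \<le> n"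
begin

lemma denominator_pos: "0 < b + a * s\<^sup>2" "0 < a * s\<^sup>2 + b"
  using a_pos b_pos by (simp_all add: add_pos_nonneg add_nonneg_pos)

lemma continuous_on_potential: "continuous_on S (potential n)"
  unfolding potential_def[abs_def] a_eq b_eq
  by (intro continuous_intros) (use denominator_pos(1) in \<open>simp add: less_imp_neq[symmetric]\<close>)

lemma potential_measurable [measurable]: "potential n \<in> borel_measurable borel"
  by (rule borel_measurable_continuous_onI[OF continuous_on_potential])

lemma potential_bounded: obtains K where "K > 0" "\<And>r. \<bar>potential n r\<bar> \<le> K"
proof -
  \<comment> \<open>\<open>C\<close> makes \<open>C * D\<close> dominate the numerator term by term:
    2 serves the constant part and |2a - 1|/a the quadratic part.\<close>
  define C where "C = 2 + \<bar>2 * a - 1\<bar> / a"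
  have C: "C > 0" using a_pos by (simp add: C_def add_pos_nonneg)
  have "\<bar>potential n r\<bar> \<le> \<bar>3 * (real n - 4)\<bar> * C / b + 1" for r
  proof -
    define D where "D = b + a * r\<^sup>2"
    have D: "D \<ge> b" "D > 0" using denominator_pos(1)[of r] a_pos by (simp_all add: D_def)
    have "\<bar>2 * b + (2 * a - 1) * r\<^sup>2\<bar> \<le> 2 * b + \<bar>2 * a - 1\<bar> * r\<^sup>2"
      using b_pos by (intro order_trans[OF abs_triangle_ineq]) (simp add: abs_mult)
    also have "\<dots> \<le> C * D"
    proof -
      have "C * D = 2 * b + \<bar>2 * a - 1\<bar> * r\<^sup>2 + (2 * a * r\<^sup>2 + \<bar>2 * a - 1\<bar> / a * b)"
        using a_pos by (simp add: C_def D_def field_simps)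
      moreover have "0 \<le> 2 * a * r\<^sup>2 + \<bar>2 * a - 1\<bar> / a * b"
        using a_pos b_pos by (intro add_nonneg_nonneg mult_nonneg_nonneg) auto
      ultimately show ?thesis by linarith
    qed
    finally have "\<bar>2 * b + (2 * a - 1) * r\<^sup>2\<bar> / D\<^sup>2 \<le> C * D / D\<^sup>2"
      using D by (intro divide_right_mono) auto
    also have "\<dots> = C / D" using D by (simp add: power2_eq_square)
    also have "\<dots> \<le> C / b" using D C b_pos by (intro divide_left_mono) auto
    finally have "\<bar>3 * (real n - 4)\<bar> * (\<bar>2 * b + (2 * a - 1) * r\<^sup>2\<bar> / D\<^sup>2) \<le> \<bar>3 * (real n - 4)\<bar> * (C / b)"
      by (rule mult_left_mono) simp
    then show ?thesis
      by (simp add: potential_def a_eq b_eq D_def[symmetric] abs_mult abs_divide)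
  qed
  moreover have "\<bar>3 * (real n - 4)\<bar> * C / b + 1 > 0"
    using C b_pos by (intro add_nonneg_pos) auto
  ultimately show thesis using that by blast
qed

text \<open>Radiality of \<open>L_fun f\<close> comes from the radial formula away from the origin;
  at the origin there is nothing to compare, since only 0 has norm 0.\<close>

lemma Cc_rad_L2rad:
  fixes f :: "real ^ 'n \<Rightarrow> real"
  assumes f: "f \<in> Cc_rad"
  shows "f \<in> L2rad" "L_fun f \<in> L2rad"
proof -
  obtain F F1 F2 R where F: "\<And>x. f x = F (norm x)" "\<And>r. (F has_real_derivative F1 r) (at r)"
    "\<And>r. (F1 has_real_derivative F2 r) (at r)" "continuous_on UNIV F2" "R > 0"
    "\<And>r. \<bar>r\<bar> \<ge> R \<Longrightarrow> F r = 0 \<and> F1 r = 0 \<and> F2 r = 0"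
    using Cc_rad_profile[OF f] by blast
  note L = L_fun_radial[OF F(1) F(2) F(3)]
  have d: "foldr pdiff is f differentiable (at x)" for "is" x
    by (rule Cc_rad_differentiable[OF f])
  have c0: "continuous_on UNIV f"
    by (rule continuous_on_of_differentiable) (use d[of "[]"] in simp)
  have c1: "continuous_on UNIV (pdiff i f)" for i
    by (rule continuous_on_of_differentiable) (use d[of "[i]"] in simp)
  have c2: "continuous_on UNIV (pdiff i (pdiff i f))" for i
    by (rule continuous_on_of_differentiable) (use d[of "[i, i]"] in simp)
  have cV: "continuous_on UNIV (\<lambda>x :: real ^ 'n. potential n (norm x))"
    by (rule continuous_on_compose2[OF continuous_on_potential continuous_on_norm[OF continuous_on_id]]) auto
  have cL: "continuous_on UNIV (L_fun f)"
    unfolding L_fun_def[abs_def] n_eq by (intro continuous_intros c0 c1 c2 cV)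
  have bounded: "h \<in> L2rad" if c: "continuous_on UNIV h" and z: "\<And>x. norm x \<ge> R \<Longrightarrow> h x = 0"
    and r: "radial h" for h :: "real ^ 'n \<Rightarrow> real"
  proof -
    have "compact (h ` cball 0 R)"
      by (intro compact_continuous_image continuous_on_subset[OF c]) auto
    from compact_imp_bounded[OF this] obtain B where "\<forall>y\<in>h ` cball 0 R. norm y \<le> B"
      unfolding bounded_iff by blast
    then have B: "\<bar>h x\<bar> \<le> B" if "norm x \<le> R" for x using that by simp
    have "\<bar>h x\<bar> \<le> \<bar>B\<bar> * (1 + norm x) ^ 0" for x
      using B[of x] z[of x] by (cases "norm x \<le> R") auto
    then show ?thesis using r borel_measurable_continuous_onI[OF c] by (intro poly_bounded_L2rad) 
  qed
  show "f \<in> L2rad"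
    by (rule bounded[OF c0]) (use F f in \<open>auto simp: Cc_rad_def\<close>)
  show "L_fun f \<in> L2rad"
  proof (rule bounded[OF cL])
    show "L_fun f x = 0" if "norm x \<ge> R" for x
    proof -
      have "x \<noteq> 0" using that F(5) by auto
      then show ?thesis using L[of x] F(6)[of "norm x"] that by simp
    qed
    show "radial (L_fun f)"
      unfolding radial_def
    proof (intro allI impI)
      fix x y :: "real ^ 'n" assume xy: "norm x = norm y"
      show "L_fun f x = L_fun f y"
      proof (cases "x = 0")
        case False
        then have "y \<noteq> 0" using xy by auto
        then show ?thesis using L[OF False] L[of y] xy by simp
      qed (use xy in simp)
    qed
  qed
qed

end

lemma toH_tendsto_dominated:
  fixes f :: "nat \<Rightarrow> real ^ 'n::finite \<Rightarrow> real"
  assumes f: "\<And>k. f k \<in> L2rad" "g \<in> L2rad" and w: "w \<in> L2rad"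
    and bound: "\<And>k x. x \<noteq> 0 \<Longrightarrow> \<bar>f k x - g x\<bar> \<le> w x"
    and lim: "\<And>x. x \<noteq> 0 \<Longrightarrow> (\<lambda>k. f k x) \<longlonglongrightarrow> g x"
  shows "(\<lambda>k. toH (f k)) \<longlonglongrightarrow> toH g"
proof -
  note [measurable] = L2rad_borel[OF f(1)] L2rad_borel[OF f(2)] L2rad_borel[OF w]
  have nz: "AE x in lborel. (x :: real ^ 'n) \<noteq> 0"
    by (rule AE_lborel_singleton)
  have "(\<lambda>k. LINT x|lborel. (f k x - g x)\<^sup>2 * wgt x) \<longlonglongrightarrow> (LINT x|(lborel :: (real ^ 'n) measure). 0)"
  proof (rule integral_dominated_convergence[where w="\<lambda>x. (w x)\<^sup>2 * wgt x"])
    show "AE x in lborel. (\<lambda>k. (f k x - g x)\<^sup>2 * wgt x) \<longlonglongrightarrow> 0"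
      using nz
    proof eventually_elim
      case (elim x)
      have "(\<lambda>k. (f k x - g x)\<^sup>2 * wgt x) \<longlonglongrightarrow> (g x - g x)\<^sup>2 * wgt x"
        by (intro tendsto_intros lim elim)
      then show ?case by simp
    qed
    show "AE x in lborel. norm ((f k x - g x)\<^sup>2 * wgt x) \<le> (w x)\<^sup>2 * wgt x" for k
      using nz
    proof eventually_elim
      case (elim x)
      have "(f k x - g x)\<^sup>2 \<le> (w x)\<^sup>2"
        using power_mono[OF bound[OF elim], of k 2] by simp
      then show ?case using wgt_pos[of x] by (simp add: abs_mult)
    qed
  qed (use L2rad_integrable[OF w] in auto)
  then have "(\<lambda>k. (norm (toH (f k) - toH g))\<^sup>2) \<longlonglongrightarrow> 0"
    by (simp add: toH_diff[symmetric] f norm_toH L2rad_minus)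
  then have "(\<lambda>k. sqrt ((norm (toH (f k) - toH g))\<^sup>2)) \<longlonglongrightarrow> sqrt 0"
    by (rule tendsto_real_sqrt)
  then have "(\<lambda>k. norm (toH (f k) - toH g)) \<longlonglongrightarrow> 0" by simp
  then show ?thesis by (rule Lim_null[THEN iffD2, OF tendsto_norm_zero_cancel])
qed

context weight_coeffs
begin

text \<open>The Leibniz rule for L applied to cutoff times q, with \<open>h\<close> for 1/R^2,
  \<open>u\<close> for 1/r, \<open>N\<close> for n - 1, and \<open>b0\<close>, \<open>b2\<close>,
  \<open>c\<close> for the bump values. Apart from the cutoff times the image of q, every term
  carries a factor \<open>h\<close>.\<close>

lemma cutoff_identity:
  fixes r u e b0 q2 h b2 q1 q c N p :: real
  assumes "r * u = 1"
  shows "e * (b0 * q2 + 2 * (- 2 * r * h) * (b2 * q1) + (- 2 * h) * (b2 * q) + (4 * r\<^sup>2 * h\<^sup>2) * (c * q))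
      + N * u * (e * (b0 * q1 + (- 2 * r * h) * (b2 * q)))
      - r / 2 * (e * (b0 * q1 + (- 2 * r * h) * (b2 * q))) - b0 * (e * q) + p * (b0 * (e * q))
    = e * b0 * (q2 + N * u * q1 - r / 2 * q1 - q + p * q)
      + e * ((- 4 * r * h) * b2 * q1 + (4 * r\<^sup>2 * h\<^sup>2) * c * q + ((r\<^sup>2 - 2 * (N + 1)) * h) * b2 * q)"
proof -
  have "N * u * (e * (b0 * q1 + (- 2 * r * h) * (b2 * q))) = N * u * e * b0 * q1 - 2 * N * (r * u) * h * e * b2 * q"
    by (simp add: algebra_simps)
  then show ?thesis unfolding assms by (simp add: algebra_simps power2_eq_square)
qed

text \<open>A solution of L q = l away from the origin with polynomial growth is approached in the
  graph norm by its cutoffs at the radii k + 1: the commutator with the cutoff is 1/R^2 times a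
  polynomially bounded function, so dominated convergence handles both components. No bound on
  \<open>q2\<close> appears, because \<open>eq\<close> trades it for \<open>l\<close>.\<close>

lemma in_closure_L_op:
  fixes q q1 q2 l :: "real \<Rightarrow> real"
  assumes q1: "\<And>r. r > 0 \<Longrightarrow> (q has_real_derivative q1 r) (at r)"
    and q2: "\<And>r. r > 0 \<Longrightarrow> (q1 has_real_derivative q2 r) (at r)"
    and C: "C \<ge> 0" and bq: "\<And>r. r \<ge> 0 \<Longrightarrow> \<bar>q r\<bar> \<le> C * (1 + r) ^ m"
    and bq1: "\<And>r. r > 0 \<Longrightarrow> \<bar>q1 r\<bar> \<le> C * (1 + r) ^ m"
    and bl: "\<And>r. r \<ge> 0 \<Longrightarrow> \<bar>l r\<bar> \<le> C * (1 + r) ^ m"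
    and [measurable]: "q \<in> borel_measurable borel" "l \<in> borel_measurable borel"
    and alg: "\<And>R. R > 0 \<Longrightarrow> (\<lambda>x :: real ^ 'n. q (norm x)) \<in> function_algebra (cutoff_gens R a b)"
    and eq: "\<And>r. r > 0 \<Longrightarrow> q2 r + (real n - 1) / r * q1 r - r / 2 * q1 r - q r + potential n r * q r = l r"
  shows "(toH (\<lambda>x :: real ^ 'n. q (norm x)), toH (\<lambda>x :: real ^ 'n. l (norm x))) \<in> closure L_op"
proof -
  \<comment> \<open>\<open>bump 0\<close> equals exp(-1) at 1, so the factor \<open>exp 1\<close>
    makes the cutoffs tend to 1 pointwise.\<close>
  define f where "f k x = bump 0 (1 - (norm x)\<^sup>2 / (real (Suc k))\<^sup>2) * (exp 1 * q (norm x))" for k and x :: "real ^ 'n"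
  have fC: "f k \<in> Cc_rad" for k
    unfolding f_def
    by (intro cutoff_Cc_rad[where a=a and b=b] function_algebra.mult function_algebra.const alg a_pos b_pos)
       (auto simp: radial_def)
  \<comment> \<open>The bumps of order 2, 3, 4 are bounded by 2, 6, 24. This gives 8 = 4 * 2, then
    146 = 4 * 36 + 2 with 36 = 2 * 6 + 24, and finally 4 n = 2 n * 2.\<close>
  define W where "W r = exp 1 * (8 * r * \<bar>q1 r\<bar> + 146 * r\<^sup>2 * \<bar>q r\<bar> + 4 * real n * \<bar>q r\<bar>)" for r
  have W0: "W r \<ge> 0" if "r > 0" for r using that by (simp add: W_def)
  have Lf: "\<bar>L_fun (f k) x - exp 1 * bump 0 (1 - (norm x)\<^sup>2 / (real (Suc k))\<^sup>2) * l (norm x)\<bar>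
      \<le> W (norm x) / (real (Suc k))\<^sup>2" if x: "x \<noteq> 0" for k x
  proof -
    define R where "R = real (Suc k)"
    have R: "R \<ge> 1" by (simp add: R_def)
    define B where "B j r = bump j (1 - r\<^sup>2 / R\<^sup>2)" for j r
    have dB: "(B j has_real_derivative (- 2 * r / R\<^sup>2) * (- real j * B (j + 1) r + B (j + 2) r)) (at r)" for j r
    proof -
      have "((\<lambda>r. 1 - r\<^sup>2 / R\<^sup>2) has_real_derivative - 2 * r / R\<^sup>2) (at r)"
        using R by (auto intro!: derivative_eq_intros simp: power2_eq_square power4_eq_xxxx)
      from DERIV_chain2[OF DERIV_bump this] show ?thesis
        unfolding B_def by (simp only: mult.commute)
    qed
    define F where "F r = B 0 r * (exp 1 * q r)" for r
    define F1 where "F1 r = exp 1 * (B 0 r * q1 r + (- 2 * r / R\<^sup>2) * (B 2 r * q r))" for r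
    define F2 where "F2 r = exp 1 * (B 0 r * q2 r + 2 * (- 2 * r / R\<^sup>2) * (B 2 r * q1 r)
        + (- 2 / R\<^sup>2) * (B 2 r * q r) + (4 * r\<^sup>2 / R ^ 4) * ((- 2 * B 3 r + B 4 r) * q r))" for r
    have dF: "(F has_real_derivative F1 r) (at r)" if "r > 0" for r
      unfolding F_def F1_def using R
      by (auto intro!: derivative_eq_intros q1[OF that] dB simp: field_simps numeral_2_eq_2)
    have dF1: "(F1 has_real_derivative F2 r) (at r)" if "r > 0" for r
    proof -
      have num: "B (2 + 1) = B 3" "B (2 + 2) = B 4" "B (0 + 2) = B 2" by (simp_all add: numeral_eq_Suc)
      have "(F1 has_real_derivative
         exp 1 * ((B 0 r * q2 r + (- 2 * r / R\<^sup>2) * (- real 0 * B (0 + 1) r + B (0 + 2) r) * q1 r)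
          + ((- 2 * r / R\<^sup>2) * (B 2 r * q1 r + (- 2 * r / R\<^sup>2) * (- real 2 * B (2 + 1) r + B (2 + 2) r) * q r)
          + (- 2 / R\<^sup>2) * (B 2 r * q r)))) (at r)"
        unfolding F1_def
      proof (intro DERIV_cmult DERIV_add DERIV_mult' dB q1[OF that] q2[OF that])
        show "((\<lambda>r. - 2 * r / R\<^sup>2) has_real_derivative - 2 / R\<^sup>2) (at r)"
          using R by (auto intro!: derivative_eq_intros simp: power2_eq_square power4_eq_xxxx)
      qed
      then show ?thesis
        unfolding F2_def num
        by (rule DERIV_cong) (simp add: algebra_simps power2_eq_square power4_eq_xxxx)
    qed
    define r where "r = norm x"
    have r: "r > 0" using x by (simp add: r_def)
    have "L_fun (f k) x = F2 r + (real n - 1) / r * F1 r - r / 2 * F1 r - F r + potential n r * F r"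
      unfolding r_def n_eq[symmetric]
      by (rule L_fun_radial[OF _ dF dF1 x]) (auto simp: f_def F_def B_def R_def)
    also have "\<dots> = exp 1 * B 0 r * (q2 r + (real n - 1) / r * q1 r - r / 2 * q1 r - q r + potential n r * q r)
        + exp 1 * ((- 4 * r / R\<^sup>2) * B 2 r * q1 r + (4 * r\<^sup>2 / R ^ 4) * (- 2 * B 3 r + B 4 r) * q r
          + ((r\<^sup>2 - 2 * real n) / R\<^sup>2) * B 2 r * q r)"
      unfolding F2_def F1_def F_def
      using cutoff_identity[of r "1 / r" "exp 1" "B 0 r" "q2 r" "1 / R\<^sup>2" "B 2 r" "q1 r" "q r" "- 2 * B 3 r + B 4 r" "real n - 1" "potential n r"] r
      by (simp add: power_divide power_mult[symmetric])
    also have "q2 r + (real n - 1) / r * q1 r - r / 2 * q1 r - q r + potential n r * q r = l r"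
      by (rule eq[OF r])
    finally have "\<bar>L_fun (f k) x - exp 1 * B 0 r * l r\<bar> = exp 1 * \<bar>(- 4 * r / R\<^sup>2) * B 2 r * q1 r
          + (4 * r\<^sup>2 / R ^ 4) * (- 2 * B 3 r + B 4 r) * q r + ((r\<^sup>2 - 2 * real n) / R\<^sup>2) * B 2 r * q r\<bar>"
      by (simp add: abs_mult)
    also have "\<dots> \<le> exp 1 * ((4 * r / R\<^sup>2) * 2 * \<bar>q1 r\<bar> + (4 * r\<^sup>2 / R\<^sup>2) * 36 * \<bar>q r\<bar> + ((r\<^sup>2 + 2 * real n) / R\<^sup>2) * 2 * \<bar>q r\<bar>)"
    proof (intro mult_left_mono order_trans[OF abs_triangle_ineq] add_mono)
      have b2: "\<bar>B 2 r\<bar> \<le> 2" using bump_bounds[of 2] by (simp add: B_def fact_numeral)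
      have "\<bar>B 3 r\<bar> \<le> 6" "\<bar>B 4 r\<bar> \<le> 24" using bump_bounds[of 3] bump_bounds[of 4] by (simp_all add: B_def fact_numeral)
      then have b34: "\<bar>- 2 * B 3 r + B 4 r\<bar> \<le> 36" by linarith
      show "\<bar>(- 4 * r / R\<^sup>2) * B 2 r * q1 r\<bar> \<le> (4 * r / R\<^sup>2) * 2 * \<bar>q1 r\<bar>"
        unfolding abs_mult using r b2 by (intro mult_mono) (auto simp: abs_mult)
      have "R\<^sup>2 * 1 \<le> R\<^sup>2 * R\<^sup>2" using R by (intro mult_left_mono) auto
      then have "R\<^sup>2 \<le> R ^ 4" by (simp add: power2_eq_square power4_eq_xxxx)
      then have "4 * r\<^sup>2 / R ^ 4 \<le> 4 * r\<^sup>2 / R\<^sup>2" using R by (intro divide_left_mono) auto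
      then show "\<bar>(4 * r\<^sup>2 / R ^ 4) * (- 2 * B 3 r + B 4 r) * q r\<bar> \<le> (4 * r\<^sup>2 / R\<^sup>2) * 36 * \<bar>q r\<bar>"
        unfolding abs_mult using b34 by (intro mult_mono) auto
      have "\<bar>(r\<^sup>2 - 2 * real n) / R\<^sup>2\<bar> \<le> (r\<^sup>2 + 2 * real n) / R\<^sup>2"
        using abs_triangle_ineq4[of "r\<^sup>2" "2 * real n"] by (simp add: divide_right_mono)
      then show "\<bar>((r\<^sup>2 - 2 * real n) / R\<^sup>2) * B 2 r * q r\<bar> \<le> ((r\<^sup>2 + 2 * real n) / R\<^sup>2) * 2 * \<bar>q r\<bar>"
        unfolding abs_mult using b2 by (intro mult_mono) auto
    qed auto
    also have "\<dots> = W r / R\<^sup>2"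
      by (simp add: W_def add_divide_distrib distrib_left distrib_right)
    finally show ?thesis by (simp add: B_def r_def R_def)
  qed
  have qL: "(\<lambda>x :: real ^ 'n. q (norm x)) \<in> L2rad" and lL: "(\<lambda>x :: real ^ 'n. l (norm x)) \<in> L2rad"
    by (rule poly_bounded_L2rad[where C=C and m=m]; simp add: bq bl radial_def)+
  have b01: "\<bar>exp 1 * bump 0 s - 1\<bar> \<le> exp 1 + 1" for s
  proof -
    have "\<bar>exp 1 * bump 0 s\<bar> \<le> exp 1" using bump_bounds[of 0 s] by (simp add: abs_mult)
    then show ?thesis by linarith
  qed
  have blim: "(\<lambda>k. exp 1 * bump 0 (1 - (norm x)\<^sup>2 / (real (Suc k))\<^sup>2)) \<longlonglongrightarrow> 1" for x :: "real ^ 'n"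
  proof -
    have "(\<lambda>k. 1 - (norm x)\<^sup>2 * (1 / real (Suc k))\<^sup>2) \<longlonglongrightarrow> 1 - (norm x)\<^sup>2 * 0\<^sup>2"
      by (intro tendsto_intros LIMSEQ_Suc[OF lim_1_over_n])
    then have "(\<lambda>k. 1 - (norm x)\<^sup>2 / (real (Suc k))\<^sup>2) \<longlonglongrightarrow> 1" by (simp add: power_divide)
    from isCont_tendsto_compose[OF DERIV_isCont[OF DERIV_bump[of 0]] this]
    have "(\<lambda>k. exp 1 * bump 0 (1 - (norm x)\<^sup>2 / (real (Suc k))\<^sup>2)) \<longlonglongrightarrow> exp 1 * bump 0 1"
      by (intro tendsto_intros)
    then show ?thesis by (simp add: bump_def exp_minus)
  qed
  have "(\<lambda>k. toH (f k)) \<longlonglongrightarrow> toH (\<lambda>x :: real ^ 'n. q (norm x))"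
  proof (rule toH_tendsto_dominated[where w="\<lambda>x. (exp 1 + 1) * \<bar>q (norm x)\<bar>"])
    show "f k \<in> L2rad" for k by (rule Cc_rad_L2rad[OF fC])
    have "(\<lambda>x :: real ^ 'n. \<bar>q (norm x)\<bar>) \<in> L2rad"
      by (rule poly_bounded_L2rad[where C=C and m=m]) (simp_all add: bq radial_def)
    then show "(\<lambda>x :: real ^ 'n. (exp 1 + 1) * \<bar>q (norm x)\<bar>) \<in> L2rad" by (rule L2rad_scale)
    show "\<bar>f k x - q (norm x)\<bar> \<le> (exp 1 + 1) * \<bar>q (norm x)\<bar>" for k x
    proof -
      have "f k x - q (norm x) = (exp 1 * bump 0 (1 - (norm x)\<^sup>2 / (real (Suc k))\<^sup>2) - 1) * q (norm x)"
        by (simp add: f_def left_diff_distrib)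
      then show ?thesis using b01 by (simp add: abs_mult mult_right_mono)
    qed
    show "(\<lambda>k. f k x) \<longlonglongrightarrow> q (norm x)" for x
      using tendsto_mult[OF blim[of x] tendsto_const[of "q (norm x)"]] by (simp add: f_def mult_ac)
  qed (rule qL)
  moreover have "(\<lambda>k. toH (L_fun (f k))) \<longlonglongrightarrow> toH (\<lambda>x :: real ^ 'n. l (norm x))"
  \<comment> \<open>The dominating function adds the bound \<open>exp 1 + 1\<close> for the cutoff
    error on \<open>l\<close> to the bound for \<open>W\<close>, where 154 = 8 + 146. The exponent
    \<open>m + 2\<close> absorbs the factor r^2 in \<open>W\<close>.\<close>
  proof (rule toH_tendsto_dominated[where w="\<lambda>x. (exp 1 + 1 + exp 1 * (154 + 4 * real n)) * (C * (1 + norm x) ^ (m + 2))"])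
    show "L_fun (f k) \<in> L2rad" for k by (rule Cc_rad_L2rad[OF fC])
    show "(\<lambda>x :: real ^ 'n. (exp 1 + 1 + exp 1 * (154 + 4 * real n)) * (C * (1 + norm x) ^ (m + 2))) \<in> L2rad"
      by (intro L2rad_scale poly_bounded_L2rad[where C=C and m="m+2"]) (auto simp: radial_def abs_mult C)
    have near: "\<bar>L_fun (f k) x - l (norm x)\<bar> \<le> \<bar>exp 1 * bump 0 (1 - (norm x)\<^sup>2 / (real (Suc k))\<^sup>2) - 1\<bar> * \<bar>l (norm x)\<bar>
        + W (norm x) / (real (Suc k))\<^sup>2" if "x \<noteq> 0" for k x
    proof -
      have "L_fun (f k) x - l (norm x) = (L_fun (f k) x - exp 1 * bump 0 (1 - (norm x)\<^sup>2 / (real (Suc k))\<^sup>2) * l (norm x))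
          + (exp 1 * bump 0 (1 - (norm x)\<^sup>2 / (real (Suc k))\<^sup>2) - 1) * l (norm x)"
        by (simp add: left_diff_distrib)
      then show ?thesis
        using Lf[OF that, of k] abs_triangle_ineq[of
            "L_fun (f k) x - exp 1 * bump 0 (1 - (norm x)\<^sup>2 / (real (Suc k))\<^sup>2) * l (norm x)"
            "(exp 1 * bump 0 (1 - (norm x)\<^sup>2 / (real (Suc k))\<^sup>2) - 1) * l (norm x)"]
        unfolding abs_mult by linarith
    qed
    show "\<bar>L_fun (f k) x - l (norm x)\<bar> \<le> (exp 1 + 1 + exp 1 * (154 + 4 * real n)) * (C * (1 + norm x) ^ (m + 2))"
      if x: "x \<noteq> 0" for k x
    proof -
      define r where "r = norm x"
      have r: "r > 0" using x by (simp add: r_def)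
      define P where "P = C * (1 + r) ^ (m + 2)"
      have P1: "C * (1 + r) ^ m * (1 + r)\<^sup>2 = P" by (simp add: P_def power_add mult.assoc power2_eq_square)
      have C0: "C * (1 + r) ^ m \<ge> 0" using C r by simp
      have up: "C * (1 + r) ^ m * t \<le> P" if "t \<le> (1 + r)\<^sup>2" for t
        unfolding P1[symmetric] using that C0 by (intro mult_left_mono)
      have t1: "1 \<le> (1 + r)\<^sup>2" "r \<le> (1 + r)\<^sup>2" "r\<^sup>2 \<le> (1 + r)\<^sup>2"
        using r by (simp_all add: power2_eq_square algebra_simps)
      have l: "\<bar>l r\<bar> \<le> P" "\<bar>q r\<bar> \<le> P"
        using bl[of r] bq[of r] r up[OF t1(1)] by auto
      have "\<bar>q1 r\<bar> * r \<le> C * (1 + r) ^ m * r" using bq1[OF r] r by (intro mult_right_mono) auto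
      also have "\<dots> \<le> P" by (rule up[OF t1(2)])
      finally have "r * \<bar>q1 r\<bar> \<le> P" by (simp only: mult.commute)
      moreover have "r\<^sup>2 * \<bar>q r\<bar> \<le> P"
      proof -
        have "\<bar>q r\<bar> * r\<^sup>2 \<le> C * (1 + r) ^ m * r\<^sup>2" using bq[of r] r by (intro mult_right_mono) auto
        also have "\<dots> \<le> P" by (rule up[OF t1(3)])
        finally show ?thesis by (simp only: mult.commute)
      qed
      moreover have "4 * real n * \<bar>q r\<bar> \<le> 4 * real n * P" using l by (intro mult_left_mono) auto
      ultimately have "8 * r * \<bar>q1 r\<bar> + 146 * r\<^sup>2 * \<bar>q r\<bar> + 4 * real n * \<bar>q r\<bar> \<le> (154 + 4 * real n) * P"
        by (simp add: distrib_right)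
      then have "W r \<le> exp 1 * ((154 + 4 * real n) * P)"
        unfolding W_def by (intro mult_left_mono) auto
      moreover have "W r / (real (Suc k))\<^sup>2 \<le> W r"
        using divide_left_mono[OF one_le_power[of "real (Suc k)" 2] W0[OF r]] by simp
      moreover have "\<bar>exp 1 * bump 0 (1 - (norm x)\<^sup>2 / (real (Suc k))\<^sup>2) - 1\<bar> * \<bar>l r\<bar> \<le> (exp 1 + 1) * P"
        using b01 l by (intro mult_mono) auto
      ultimately have "\<bar>L_fun (f k) x - l (norm x)\<bar> \<le> (exp 1 + 1) * P + exp 1 * ((154 + 4 * real n) * P)"
        using near[OF x, of k] by (simp add: r_def[symmetric])
      then show ?thesis by (simp add: P_def r_def algebra_simps)
    qed
    show "(\<lambda>k. L_fun (f k) x) \<longlonglongrightarrow> l (norm x)" if x: "x \<noteq> 0" for x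
    proof -
      have "(\<lambda>k. \<bar>exp 1 * bump 0 (1 - (norm x)\<^sup>2 / (real (Suc k))\<^sup>2) - 1\<bar> * \<bar>l (norm x)\<bar>
          + W (norm x) * (1 / real (Suc k))\<^sup>2) \<longlonglongrightarrow> \<bar>1 - 1\<bar> * \<bar>l (norm x)\<bar> + W (norm x) * 0\<^sup>2"
        by (intro tendsto_intros blim LIMSEQ_Suc[OF lim_1_over_n])
      then have "(\<lambda>k. \<bar>exp 1 * bump 0 (1 - (norm x)\<^sup>2 / (real (Suc k))\<^sup>2) - 1\<bar> * \<bar>l (norm x)\<bar>
          + W (norm x) / (real (Suc k))\<^sup>2) \<longlonglongrightarrow> 0" by (simp add: power_divide)
      then have "(\<lambda>k. L_fun (f k) x - l (norm x)) \<longlonglongrightarrow> 0"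
        by (rule Lim_null_comparison[rotated]) (use near[OF x] in auto)
      then show ?thesis by (rule LIM_zero_cancel)
    qed
  qed (rule lL)
  ultimately have "(\<lambda>k. (toH (f k), toH (L_fun (f k)))) \<longlonglongrightarrow> (toH (\<lambda>x :: real ^ 'n. q (norm x)), toH (\<lambda>x :: real ^ 'n. l (norm x)))"
    by (rule tendsto_Pair)
  moreover have "(toH (f k), toH (L_fun (f k))) \<in> L_op" for k
    using fC unfolding L_op_def by blast
  ultimately show ?thesis
    unfolding closure_sequential by (intro exI[of _ "\<lambda>k. (toH (f k), toH (L_fun (f k)))"]) simp
qed

end

section \<open>Completeness of the radial polynomials\<close>

text \<open>Squaring exp(d |x|^2) against the weight leaves the exponent 2d - 1/4, which is at most
  -1/8 when d <= 1/16. This is the origin of the steps of 1/16 below.\<close>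

lemma norm_power_exp_L2rad:
  assumes "d \<le> 1/16"
  shows "(\<lambda>x :: real ^ 'n::finite. norm x ^ m * exp (d * (norm x)\<^sup>2)) \<in> L2rad"
proof -
  have "integrable (lborel :: (real ^ 'n) measure) (\<lambda>x. (norm x ^ m * exp (d * (norm x)\<^sup>2))\<^sup>2 * wgt x)"
  proof (rule Bochner_Integration.integrable_bound[OF integrable_norm_power_gaussian[of "1/8" "2 * m"]])
    show "AE x in lborel. norm ((norm (x :: real ^ 'n) ^ m * exp (d * (norm x)\<^sup>2))\<^sup>2 * wgt x)
        \<le> norm (norm x ^ (2 * m) * exp (- (1/8) * (norm x)\<^sup>2))"
    proof (rule AE_I2)
      fix x :: "real ^ 'n"
      have "(norm x ^ m * exp (d * (norm x)\<^sup>2))\<^sup>2 * wgt x = norm x ^ (2 * m) * exp ((2 * d - 1/4) * (norm x)\<^sup>2)"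
      proof -
        have "(exp (d * (norm x)\<^sup>2))\<^sup>2 * wgt x = exp ((2 * d - 1/4) * (norm x)\<^sup>2)"
          unfolding wgt_eq exp_double[symmetric] exp_add[symmetric] by (simp add: left_diff_distrib)
        then show ?thesis by (simp add: power_mult_distrib power_mult[symmetric] mult.commute mult.left_commute)
      qed
      also have "\<dots> \<le> norm x ^ (2 * m) * exp (- (1/8) * (norm x)\<^sup>2)"
      proof -
        have "(2 * d - 1/4) * (norm x)\<^sup>2 \<le> (- (1/8)) * (norm x)\<^sup>2"
          using assms by (intro mult_right_mono) auto
        then have "exp ((2 * d - 1/4) * (norm x)\<^sup>2) \<le> exp ((- (1/8)) * (norm x)\<^sup>2)" by simp
        then show ?thesis by (rule mult_left_mono) simp
      qed
      finally show "norm ((norm x ^ m * exp (d * (norm x)\<^sup>2))\<^sup>2 * wgt x) \<le> norm (norm x ^ (2 * m) * exp (- (1/8) * (norm x)\<^sup>2))"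
        using wgt_pos[of x] by simp
    qed
  qed auto
  then show ?thesis by (simp add: L2rad_def radial_def)
qed

lemma moment_integrable:
  fixes h :: "real ^ 'n::finite \<Rightarrow> real"
  assumes "h \<in> L2rad" "d \<le> 1/16"
  shows "integrable lborel (\<lambda>x. h x * (norm x ^ m * exp (d * (norm x)\<^sup>2)) * wgt x)"
  by (rule L2rad_mult_integrable[OF assms(1) norm_power_exp_L2rad[OF assms(2)]])

text \<open>Expand exp(-|x|^2/16) in its power series under the integral: each term is a moment that
  vanishes by hypothesis. The partial sums are dominated by exp(|x|^2/16), the largest factor that
  \<open>moment_integrable\<close> covers, so the Gaussian is sharpened in small steps.\<close>

lemma moments_shift:
  fixes h :: "real ^ 'n::finite \<Rightarrow> real"
  assumes h: "h \<in> L2rad" and t: "t \<ge> 0"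
    and z: "\<And>k. (LINT x|lborel. h x * (norm x ^ (2 * k) * exp (- t * (norm x)\<^sup>2)) * wgt x) = 0"
  shows "(LINT x|lborel. h x * (norm x ^ (2 * k) * exp (- (t + 1/16) * (norm x)\<^sup>2)) * wgt x) = 0"
proof -
  note [measurable] = L2rad_borel[OF h]
  define S where "S N x = h x * (norm x ^ (2 * k) * exp (- t * (norm x)\<^sup>2)) * wgt x * (\<Sum>j<N. (- (1/16) * (norm x)\<^sup>2) ^ j / fact j)" for N x
  have "(\<lambda>N. LINT x|lborel. S N x) \<longlonglongrightarrow> (LINT x|lborel. h x * (norm x ^ (2 * k) * exp (- (t + 1/16) * (norm x)\<^sup>2)) * wgt x)"
  proof (rule integral_dominated_convergence[where w="\<lambda>x. \<bar>h x\<bar> * (norm x ^ (2 * k) * exp (1/16 * (norm x)\<^sup>2)) * wgt x"])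
    show "integrable lborel (\<lambda>x. \<bar>h x\<bar> * (norm x ^ (2 * k) * exp (1/16 * (norm x)\<^sup>2)) * wgt x)"
      by (rule moment_integrable[OF L2rad_abs[OF h]]) simp
    show "AE x in lborel. (\<lambda>N. S N x) \<longlonglongrightarrow> h x * (norm x ^ (2 * k) * exp (- (t + 1/16) * (norm x)\<^sup>2)) * wgt x"
    proof (rule AE_I2)
      fix x :: "real ^ 'n"
      have "(\<lambda>j. (- (1/16) * (norm x)\<^sup>2) ^ j / fact j) sums exp (- (1/16) * (norm x)\<^sup>2)"
        using exp_converges[of "- (1/16) * (norm x)\<^sup>2"]
        by (simp only: real_scaleR_def divide_inverse mult.commute[of _ "inverse (fact _)"])
      then have "(\<lambda>N. \<Sum>j<N. (- (1/16) * (norm x)\<^sup>2) ^ j / fact j) \<longlonglongrightarrow> exp (- (1/16) * (norm x)\<^sup>2)"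
        by (simp only: sums_def)
      then have "(\<lambda>N. S N x) \<longlonglongrightarrow> h x * (norm x ^ (2 * k) * exp (- t * (norm x)\<^sup>2)) * wgt x * exp (- (1/16) * (norm x)\<^sup>2)"
        unfolding S_def by (intro tendsto_intros)
      moreover have "exp (- t * (norm x)\<^sup>2) * exp (- (1/16) * (norm x)\<^sup>2) = exp (- (t + 1/16) * (norm x)\<^sup>2)"
        unfolding exp_add[symmetric] by (simp add: algebra_simps)
      ultimately show "(\<lambda>N. S N x) \<longlonglongrightarrow> h x * (norm x ^ (2 * k) * exp (- (t + 1/16) * (norm x)\<^sup>2)) * wgt x"
        by (simp only: mult.assoc mult.commute[of "wgt x"]) (simp only: mult.assoc[symmetric])
    qed
    show "AE x in lborel. norm (S N x) \<le> \<bar>h x\<bar> * (norm x ^ (2 * k) * exp (1/16 * (norm x)\<^sup>2)) * wgt x" for N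
    proof (rule AE_I2)
      fix x :: "real ^ 'n"
      have "\<bar>\<Sum>j<N. (- (1/16) * (norm x)\<^sup>2) ^ j / fact j\<bar> \<le> (\<Sum>j<N. \<bar>(- (1/16) * (norm x)\<^sup>2) ^ j / fact j\<bar>)"
        by (rule sum_abs)
      also have "\<dots> = (\<Sum>j<N. inverse (fact j) * (1/16 * (norm x)\<^sup>2) ^ j)"
      proof (intro sum.cong refl)
        fix j
        have "\<bar>- (1/16) * (norm x)\<^sup>2\<bar> = 1/16 * (norm x)\<^sup>2" by (simp add: abs_mult)
        then show "\<bar>(- (1/16) * (norm x)\<^sup>2) ^ j / fact j\<bar> = inverse (fact j) * (1/16 * (norm x)\<^sup>2) ^ j"
          unfolding abs_divide power_abs
          by (simp only: abs_of_nonneg[OF fact_ge_zero] divide_inverse[of _ "fact j"] mult.commute)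
      qed
      also have "\<dots> \<le> (\<Sum>j. inverse (fact j) * (1/16 * (norm x)\<^sup>2) ^ j)"
        by (intro sum_le_suminf summable_exp) auto
      also have "\<dots> = exp (1/16 * (norm x)\<^sup>2)"
        by (simp add: exp_def)
      finally have e: "\<bar>\<Sum>j<N. (- (1/16) * (norm x)\<^sup>2) ^ j / fact j\<bar> \<le> exp (1/16 * (norm x)\<^sup>2)" .
      have "exp (- t * (norm x)\<^sup>2) \<le> 1" using t by simp
      then have "\<bar>h x\<bar> * (norm x ^ (2 * k) * exp (- t * (norm x)\<^sup>2)) * wgt x * \<bar>\<Sum>j<N. (- (1/16) * (norm x)\<^sup>2) ^ j / fact j\<bar>
        \<le> \<bar>h x\<bar> * (norm x ^ (2 * k) * 1) * wgt x * exp (1/16 * (norm x)\<^sup>2)"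
        using e wgt_pos[of x] by (intro mult_mono mult_left_mono mult_right_mono mult_nonneg_nonneg) auto
      then show "norm (S N x) \<le> \<bar>h x\<bar> * (norm x ^ (2 * k) * exp (1/16 * (norm x)\<^sup>2)) * wgt x"
        by (simp add: S_def abs_mult mult_ac)
    qed
  qed (auto simp: S_def)
  moreover have "(LINT x|lborel. S N x) = 0" for N
  proof -
    have "S N = (\<lambda>x. \<Sum>j<N. (- (1/16)) ^ j / fact j * (h x * (norm x ^ (2 * (k + j)) * exp (- t * (norm x)\<^sup>2)) * wgt x))"
    proof
      fix x :: "real ^ 'n"
      have "(- (1/16) * (norm x)\<^sup>2) ^ j = (- (1/16)) ^ j * norm x ^ (2 * j)" for j
        unfolding power_mult_distrib power_mult ..
      then show "S N x = (\<Sum>j<N. (- (1/16)) ^ j / fact j * (h x * (norm x ^ (2 * (k + j)) * exp (- t * (norm x)\<^sup>2)) * wgt x))"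
        unfolding S_def sum_distrib_left
        by (intro sum.cong refl) (simp add: power_add distrib_left mult_ac)
    qed
    moreover have "integrable lborel (\<lambda>x. h x * (norm x ^ (2 * (k + j)) * exp (- t * (norm x)\<^sup>2)) * wgt x)" for j
      by (rule moment_integrable[OF h]) (use t in simp)
    ultimately show ?thesis by (simp only: Bochner_Integration.integral_sum integrable_mult_right integral_mult_right_zero z) simp
  qed
  ultimately show ?thesis by (simp add: LIMSEQ_const_iff)
qed

lemma L2rad_wgt_integrable:
  "h \<in> L2rad \<Longrightarrow> integrable lborel (\<lambda>x :: real ^ 'n::finite. h x * wgt x)"
  using L2rad_mult_integrable[OF _ L2rad_const[of 1]] by simp

lemma bounded_mult_integrable:
  fixes h :: "real ^ 'n::finite \<Rightarrow> real"
  assumes h: "h \<in> L2rad" and [measurable]: "\<phi> \<in> borel_measurable borel" and bound: "\<And>x. \<bar>\<phi> x\<bar> \<le> B"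
  shows "integrable lborel (\<lambda>x. h x * wgt x * \<phi> x)"
proof (rule Bochner_Integration.integrable_bound[OF integrable_mult_right[OF L2rad_wgt_integrable[OF h], of B]])
  note [measurable] = L2rad_borel[OF h]
  show "(\<lambda>x. h x * wgt x * \<phi> x) \<in> borel_measurable lborel" by measurable
  have B: "B \<ge> 0" using bound[of 0] by simp
  show "AE x in lborel. norm (h x * wgt x * \<phi> x) \<le> norm (B * (h x * wgt x))"
  proof (rule AE_I2)
    fix x
    have "\<bar>h x * wgt x\<bar> * \<bar>\<phi> x\<bar> \<le> \<bar>h x * wgt x\<bar> * B" by (intro mult_left_mono bound) simp
    then show "norm (h x * wgt x * \<phi> x) \<le> norm (B * (h x * wgt x))" using B by (simp add: abs_mult mult_ac)
  qed
qed

text \<open>Iterating the shift gives vanishing moments against all powers of z = exp(-|x|^2/16).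
  Unlike |x|^2, this variable stays in a compact interval, so Stone-Weierstrass extends the
  vanishing to every continuous function of z.\<close>

lemma moments_zero_continuous:
  fixes h :: "real ^ 'n::finite \<Rightarrow> real" and c :: "real \<Rightarrow> real"
  assumes h: "h \<in> L2rad"
    and z: "\<And>k. (LINT x|lborel. h x * norm x ^ (2 * k) * wgt x) = 0"
    and c: "continuous_on UNIV c"
  shows "(LINT x|lborel. h x * wgt x * c (exp (- (1/16) * (norm x)\<^sup>2))) = 0"
proof -
  note [measurable] = L2rad_borel[OF h] borel_measurable_continuous_onI[OF c]
  have m0: "(LINT x|lborel. h x * (norm x ^ (2 * k) * exp (- (real m / 16) * (norm x)\<^sup>2)) * wgt x) = 0" for m k
  proof (induction m arbitrary: k)
    case 0
    then show ?case using z[of k] by simp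
  next
    case (Suc m)
    have m: "real (Suc m) / 16 = real m / 16 + 1/16" by (simp add: add_divide_distrib)
    show ?case unfolding m
      by (rule moments_shift[OF h _ Suc.IH]) simp
  qed
  let ?z = "\<lambda>x :: real ^ 'n. exp (- (1/16) * (norm x)\<^sup>2)"
  have zr: "?z x \<in> {0..1}" for x by simp
  have zint: "integrable lborel (\<lambda>x. h x * wgt x * ?z x ^ j)" for j
    by (rule bounded_mult_integrable[OF h, of _ 1]) (use zr in \<open>auto intro: power_le_one\<close>)
  have zm: "(LINT x|lborel. h x * wgt x * ?z x ^ j) = 0" for j
  proof -
    have "?z x ^ j = exp (- (real j / 16) * (norm x)\<^sup>2)" for x :: "real ^ 'n"
      by (simp add: exp_of_nat_mult[symmetric])
    then show ?thesis using m0[where k=0 and m=j] by (simp add: mult_ac)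
  qed
  \<comment> \<open>The added 1 keeps \<open>H\<close> positive when \<open>h\<close> vanishes
    almost everywhere.\<close>
  define H where "H = (LINT x|lborel. \<bar>h x * wgt x\<bar>) + 1"
  have H: "H > 0" by (simp add: H_def add_nonneg_pos)
  have intc: "integrable lborel (\<lambda>x. h x * wgt x * c (?z x))"
  proof -
    have "compact (c ` {0..1})" by (intro compact_continuous_image continuous_on_subset[OF c]) auto
    from compact_imp_bounded[OF this] obtain B where "\<forall>y\<in>c ` {0..1}. norm y \<le> B"
      unfolding bounded_iff by blast
    then have "\<bar>c (?z x)\<bar> \<le> B" for x using zr[of x] by simp
    then show ?thesis by (intro bounded_mult_integrable[OF h]) auto
  qed
  have "\<bar>LINT x|lborel. h x * wgt x * c (?z x)\<bar> \<le> \<epsilon>" if "\<epsilon> > 0" for \<epsilon>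
  proof -
    obtain p where p: "real_polynomial_function p" "\<And>y. y \<in> {0..1::real} \<Longrightarrow> \<bar>c y - p y\<bar> < \<epsilon> / H"
    proof (rule Stone_Weierstrass_real_polynomial_function[of "{0..1::real}" c "\<epsilon> / H"])
      show "continuous_on {0..1} c" by (rule continuous_on_subset[OF c]) simp
    qed (use H \<open>\<epsilon> > 0\<close> in auto)
    obtain \<alpha> N where p_eq: "p = (\<lambda>y. \<Sum>i\<le>N. \<alpha> i * y ^ i)"
      using p(1) unfolding real_polynomial_function_iff_sum by blast
    have pe: "(\<lambda>x. h x * wgt x * p (?z x)) = (\<lambda>x. \<Sum>i\<le>N. \<alpha> i * (h x * wgt x * ?z x ^ i))"
      unfolding p_eq sum_distrib_left by (intro ext sum.cong refl) (simp only: mult_ac)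
    have pint: "integrable lborel (\<lambda>x. h x * wgt x * p (?z x))"
      unfolding pe by (intro Bochner_Integration.integrable_sum integrable_mult_right zint)
    have "(LINT x|lborel. h x * wgt x * p (?z x)) = 0"
      unfolding pe by (subst Bochner_Integration.integral_sum) (simp_all only: integrable_mult_right zint integral_mult_right_zero zm, simp)
    then have "\<bar>LINT x|lborel. h x * wgt x * c (?z x)\<bar> = \<bar>LINT x|lborel. h x * wgt x * c (?z x) - h x * wgt x * p (?z x)\<bar>"
      by (subst Bochner_Integration.integral_diff[OF intc pint]) simp
    also have "\<dots> \<le> (LINT x|lborel. \<bar>h x * wgt x\<bar> * (\<epsilon> / H))"
    proof (rule integral_abs_bound_integral)
      show "integrable lborel (\<lambda>x. h x * wgt x * c (?z x) - h x * wgt x * p (?z x))"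
        by (intro Bochner_Integration.integrable_diff intc pint)
      show "integrable lborel (\<lambda>x. \<bar>h x * wgt x\<bar> * (\<epsilon> / H))"
        by (intro integrable_mult_left integrable_abs L2rad_wgt_integrable h)
      show "\<bar>h x * wgt x * c (?z x) - h x * wgt x * p (?z x)\<bar> \<le> \<bar>h x * wgt x\<bar> * (\<epsilon> / H)" for x
        unfolding right_diff_distrib[symmetric] abs_mult[of "h x * wgt x"]
        using p(2)[OF zr[of x]] by (intro mult_left_mono) auto
    qed
    also have "\<dots> = (H - 1) * (\<epsilon> / H)" by (simp add: H_def)
    also have "\<dots> \<le> \<epsilon>" using H that by (simp add: field_simps)
    finally show ?thesis .
  qed
  note eps = this
  have "\<bar>LINT x|lborel. h x * wgt x * c (?z x)\<bar> \<le> 0"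
  proof (rule field_le_epsilon)
    fix e :: real assume "e > 0"
    from eps[OF this] show "\<bar>LINT x|lborel. h x * wgt x * c (?z x)\<bar> \<le> 0 + e" by (simp only: add_0_left)
  qed
  then show ?thesis by simp
qed

text \<open>For \<rho> >= 0 the tail |x| > \<rho> is the set z < \<tau>, whose indicator is a
  bounded pointwise limit of the continuous ramps \<open>c j\<close>.\<close>

lemma moments_zero_tail:
  fixes h :: "real ^ 'n::finite \<Rightarrow> real"
  assumes h: "h \<in> L2rad"
    and z: "\<And>k. (LINT x|lborel. h x * norm x ^ (2 * k) * wgt x) = 0"
  shows "(LINT x|lborel. h x * wgt x * indicator {\<rho><..} (norm x)) = 0"
proof (cases "\<rho> \<ge> 0")
  case False
  then have "\<rho> < norm x" for x :: "real ^ 'n"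
    using norm_ge_zero[of x] by linarith
  then have "indicator {\<rho><..} (norm x) = (1::real)" for x :: "real ^ 'n" by simp
  then show ?thesis using z[of 0] by simp
next
  case True
  note [measurable] = L2rad_borel[OF h]
  let ?z = "\<lambda>x :: real ^ 'n. exp (- (1/16) * (norm x)\<^sup>2)"
  define \<tau> where "\<tau> = exp (- (1/16) * \<rho>\<^sup>2)"
  define c where "c j y = min 1 (real j * max 0 (\<tau> - y))" for j y
  have lim: "(\<lambda>j. c j y) \<longlonglongrightarrow> (if y < \<tau> then 1 else 0)" for y
  proof (cases "y < \<tau>")
    case True
    obtain J where J: "1 / (\<tau> - y) \<le> real J" using real_arch_simple by blast
    have "c j y = 1" if "j \<ge> J" for j
    proof -
      have "1 = 1 / (\<tau> - y) * (\<tau> - y)" using True by simp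
      also have "\<dots> \<le> real j * (\<tau> - y)" using J that True by (intro mult_right_mono) auto
      finally show ?thesis using True by (simp add: c_def)
    qed
    then show ?thesis using True by (intro tendsto_eventually eventually_sequentiallyI[of J]) simp
  qed (simp add: c_def)
  have "(\<lambda>j. LINT x|lborel. h x * wgt x * c j (?z x)) \<longlonglongrightarrow> (LINT x|lborel. h x * wgt x * (if ?z x < \<tau> then 1 else 0))"
  proof (rule integral_dominated_convergence[where w="\<lambda>x. \<bar>h x * wgt x\<bar>"])
    show "integrable lborel (\<lambda>x. \<bar>h x * wgt x\<bar>)" by (intro integrable_abs L2rad_wgt_integrable h)
    show "AE x in lborel. (\<lambda>j. h x * wgt x * c j (?z x)) \<longlonglongrightarrow> h x * wgt x * (if ?z x < \<tau> then 1 else 0)"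
      by (intro AE_I2 tendsto_intros lim)
    have "\<bar>c j y\<bar> \<le> 1" for j y by (auto simp: c_def)
    then have "\<bar>h x * wgt x\<bar> * \<bar>c j (?z x)\<bar> \<le> \<bar>h x * wgt x\<bar> * 1" for j x by (intro mult_left_mono) auto
    then show "AE x in lborel. norm (h x * wgt x * c j (?z x)) \<le> \<bar>h x * wgt x\<bar>" for j
      by (intro AE_I2) (simp only: real_norm_def abs_mult[of "_ * _"] mult_1_right)
  qed (auto simp: c_def)
  moreover have "(LINT x|lborel. h x * wgt x * c j (?z x)) = 0" for j
    by (rule moments_zero_continuous[OF h z]) (auto simp: c_def intro!: continuous_intros)
  moreover have "(if ?z x < \<tau> then 1 else 0) = (indicator {\<rho><..} (norm x) :: real)" for x
  proof -
    have "\<rho>\<^sup>2 < (norm x)\<^sup>2 \<longleftrightarrow> \<rho> < norm x"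
      using True power_strict_mono[of \<rho> "norm x" 2] power_less_imp_less_base[of \<rho> 2 "norm x"] by auto
    then show ?thesis by (simp add: \<tau>_def indicator_def)
  qed
  ultimately show ?thesis by (simp add: LIMSEQ_const_iff)
qed

text \<open>Tails are stable under intersection and generate the Borel sets. The sets with vanishing
  integral form a Dynkin system; disjoint unions pass by dominated convergence.\<close>

lemma moments_zero_borel:
  fixes h :: "real ^ 'n::finite \<Rightarrow> real"
  assumes h: "h \<in> L2rad"
    and z: "\<And>k. (LINT x|lborel. h x * norm x ^ (2 * k) * wgt x) = 0"
    and B: "B \<in> sets borel"
  shows "(LINT x|lborel. h x * wgt x * indicator B (norm x)) = 0"
proof -
  note [measurable] = L2rad_borel[OF h]
  have sb: "sets (borel :: real measure) = sigma_sets UNIV (range (\<lambda>a. {a<..}))"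
    by (subst borel_Ioi) simp
  have int: "integrable lborel (\<lambda>x. h x * wgt x * indicator A (norm x))" if "A \<in> sets borel" for A
    using that by (intro bounded_mult_integrable[OF h, of _ 1]) (auto simp: indicator_def)
  have "{a<..} \<inter> {b<..} = {max a b<..}" for a b :: real by auto
  then have st: "Int_stable (range (\<lambda>a :: real. {a<..}))" by (intro Int_stableI) auto
  have sub: "range (\<lambda>a :: real. {a<..}) \<subseteq> Pow UNIV" by simp
  have "B \<in> sigma_sets UNIV (range (\<lambda>a. {a<..}))" using B by (simp add: sb)
  from st sub this show ?thesis
  proof (induction rule: sigma_sets_induct_disjoint)
    case (basic A)
    then show ?case using moments_zero_tail[OF h z] by auto
  next
    case empty
    then show ?case by simp
  next
    case (compl A)
    then have A: "A \<in> sets borel" by (simp add: sb)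
    have "(LINT x|lborel. h x * wgt x * indicator (UNIV - A) (norm x)) = (LINT x|lborel. h x * wgt x - h x * wgt x * indicator A (norm x))"
      by (intro Bochner_Integration.integral_cong) (auto simp: indicator_def)
    also have "\<dots> = (LINT x|lborel. h x * wgt x) - (LINT x|lborel. h x * wgt x * indicator A (norm x))"
      by (rule Bochner_Integration.integral_diff[OF L2rad_wgt_integrable[OF h] int[OF A]])
    also have "\<dots> = 0" using z[of 0] compl.IH by simp
    finally show ?case .
  next
    case (union A)
    then have A [measurable]: "A i \<in> sets borel" for i using sb by auto
    have sums: "(\<lambda>i. indicator (A i) r :: real) sums indicator (\<Union>i. A i) r" for r
      using union.hyps(1) by (intro indicator_sums) (auto simp: disjoint_family_on_def)
    have le1: "(\<Sum>i<N. indicator (A i) r :: real) \<le> 1" for N r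
    proof -
      have "(\<Sum>i<N. indicator (A i) r :: real) \<le> (\<Sum>i. indicator (A i) r)"
        using sums[of r] by (intro sum_le_suminf) (auto simp: sums_iff)
      also have "\<dots> \<le> 1" using sums[of r] by (simp add: sums_iff indicator_def)
      finally show ?thesis .
    qed
    have "(\<lambda>N. LINT x|lborel. h x * wgt x * (\<Sum>i<N. indicator (A i) (norm x))) \<longlonglongrightarrow>
        (LINT x|lborel. h x * wgt x * indicator (\<Union>i. A i) (norm x))"
    proof (rule integral_dominated_convergence[where w="\<lambda>x. \<bar>h x * wgt x\<bar>"])
      show "integrable lborel (\<lambda>x. \<bar>h x * wgt x\<bar>)" by (intro integrable_abs L2rad_wgt_integrable h)
      show "AE x in lborel. (\<lambda>N. h x * wgt x * (\<Sum>i<N. indicator (A i) (norm x))) \<longlonglongrightarrow> h x * wgt x * indicator (\<Union>i. A i) (norm x)"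
        by (intro AE_I2 tendsto_intros) (use sums in \<open>simp add: sums_def\<close>)
      have "\<bar>h x * wgt x\<bar> * \<bar>\<Sum>i<N. indicator (A i) (norm x)\<bar> \<le> \<bar>h x * wgt x\<bar> * 1" for N x
        using le1[of "norm x" N] by (intro mult_left_mono) (auto simp: sum_nonneg)
      then show "AE x in lborel. norm (h x * wgt x * (\<Sum>i<N. indicator (A i) (norm x))) \<le> \<bar>h x * wgt x\<bar>" for N
        by (intro AE_I2) (simp only: real_norm_def abs_mult[of "_ * _"] mult_1_right)
      have mi: "(\<lambda>x :: real ^ 'n. indicator C (norm x) :: real) \<in> borel_measurable borel" if [measurable]: "C \<in> sets borel" for C
        by measurable
      have UA: "\<Union> (range A) \<in> sets borel" using A by (intro sets.countable_UN) auto
      have hw: "(\<lambda>x. h x * wgt x) \<in> borel_measurable borel" by measurable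
      show "(\<lambda>x. h x * wgt x * indicator (\<Union>i. A i) (norm x)) \<in> borel_measurable lborel"
        unfolding measurable_lborel2 by (rule borel_measurable_times[OF hw mi[OF UA]])
      show "(\<lambda>x. h x * wgt x * (\<Sum>i<N. indicator (A i) (norm x))) \<in> borel_measurable lborel" for N
        unfolding measurable_lborel2 by (intro borel_measurable_times borel_measurable_sum hw mi A)
    qed
    moreover have "(LINT x|lborel. h x * wgt x * (\<Sum>i<N. indicator (A i) (norm x))) = 0" for N
    proof -
      have "(LINT x|lborel. (\<Sum>i<N. h x * wgt x * indicator (A i) (norm x))) = 0"
        using union.IH int[OF A] by (subst Bochner_Integration.integral_sum) auto
      then show ?thesis by (simp only: sum_distrib_left)
    qed
    ultimately show ?case by (simp add: LIMSEQ_const_iff)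
  qed
qed

lemma profile_measurable: "h \<in> borel_measurable borel \<Longrightarrow> profile h \<in> borel_measurable borel"
  unfolding profile_def[abs_def] by (rule measurable_compose[of _ borel borel]) auto

text \<open>Since \<open>h\<close> is radial, the sets where it is positive or negative are
  described by Borel conditions on the norm, and the integral of \<open>h\<close> over each of them
  vanishes.\<close>

theorem moments_zero:
  fixes h :: "real ^ 'n::finite \<Rightarrow> real"
  assumes h: "h \<in> L2rad"
    and z: "\<And>k. (LINT x|lborel. h x * norm x ^ (2 * k) * wgt x) = 0"
  shows "toH h = 0"
proof -
  note [measurable] = L2rad_borel[OF h] profile_measurable[OF L2rad_borel[OF h]]
  have prof: "profile h (norm x) = h x" for x by (rule profile_norm[OF L2rad_radial[OF h]])
  have sgn: "AE x in lborel. s * h x \<le> 0" if s: "s = 1 \<or> s = -1" for s :: real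
  proof -
    define B where "B = {r. s * profile h r > 0}"
    have B: "B \<in> sets borel" unfolding B_def by measurable
    have "(LINT x|lborel. s * (h x * wgt x * indicator B (norm x))) = 0"
      using moments_zero_borel[OF h z B] by simp
    moreover have "integrable lborel (\<lambda>x. s * (h x * wgt x * indicator B (norm x)))"
      using B by (intro integrable_mult_right bounded_mult_integrable[OF h, of _ 1]) (auto simp: indicator_def)
    moreover have nn: "0 \<le> s * (h x * wgt x * indicator B (norm x))" for x
      using wgt_pos[of x] by (auto simp: B_def indicator_def prof mult.assoc[symmetric])
    ultimately have "AE x in lborel. s * (h x * wgt x * indicator B (norm x)) = 0"
      by (subst (asm) integral_nonneg_eq_0_iff_AE) auto
    then show ?thesis
    proof eventually_elim
      case (elim x)
      show ?case
      proof (rule ccontr)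
        assume "\<not> s * h x \<le> 0"
        then have "norm x \<in> B" "s * h x \<noteq> 0" by (auto simp: B_def prof)
        then show False using elim wgt_pos[of x] by simp
      qed
    qed
  qed
  have "AE x in lborel. 1 * h x \<le> 0" "AE x in lborel. (-1) * h x \<le> 0" by (rule sgn, simp)+
  then have "AE x in lborel. h x = 0" by eventually_elim auto
  then show ?thesis
    using toH_eq_iff[OF h L2rad_zero] by (simp add: toH_zero)
qed

section \<open>Functions of polynomial growth and Laguerre polynomials\<close>

text \<open>Growth is controlled on the half line only, as the argument will always be a
  norm.\<close>

definition tempered :: "(real \<Rightarrow> real) \<Rightarrow> bool" where
  "tempered f \<longleftrightarrow> (\<exists>C m. C \<ge> 0 \<and> (\<forall>r\<ge>0. \<bar>f r\<bar> \<le> C * (1 + r) ^ m))"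

lemma temperedI: "C \<ge> 0 \<Longrightarrow> (\<And>r. r \<ge> 0 \<Longrightarrow> \<bar>f r\<bar> \<le> C * (1 + r) ^ m) \<Longrightarrow> tempered f"
  unfolding tempered_def by blast

lemma tempered_bounded: "(\<And>r. \<bar>f r\<bar> \<le> C) \<Longrightarrow> tempered f"
  by (rule temperedI[of "\<bar>C\<bar>" f 0]) (auto intro: order_trans[OF _ abs_ge_self])

lemma tempered_id: "tempered (\<lambda>r. r)"
  by (rule temperedI[of 1 _ 1]) auto

lemma tempered_common:
  assumes "tempered f" "tempered g"
  obtains C m where "C \<ge> 0" "\<And>r. r \<ge> 0 \<Longrightarrow> \<bar>f r\<bar> \<le> C * (1 + r) ^ m" "\<And>r. r \<ge> 0 \<Longrightarrow> \<bar>g r\<bar> \<le> C * (1 + r) ^ m"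
proof -
  obtain C m D k where C: "C \<ge> 0" "\<And>r. r \<ge> 0 \<Longrightarrow> \<bar>f r\<bar> \<le> C * (1 + r) ^ m"
    and D: "D \<ge> 0" "\<And>r. r \<ge> 0 \<Longrightarrow> \<bar>g r\<bar> \<le> D * (1 + r) ^ k"
    using assms unfolding tempered_def by blast
  have up: "B * (1 + r) ^ j \<le> (C + D) * (1 + r) ^ (m + k)" if "r \<ge> 0" "B \<le> C + D" "j \<le> m + k" for B r :: real and j
    using that C(1) D(1) by (intro mult_mono power_increasing) auto
  show thesis
  proof (rule that[of "C + D" "m + k"])
    show "\<bar>f r\<bar> \<le> (C + D) * (1 + r) ^ (m + k)" if "r \<ge> 0" for r
      by (rule order_trans[OF C(2)[OF that] up[OF that]]) (use D(1) in auto)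
    show "\<bar>g r\<bar> \<le> (C + D) * (1 + r) ^ (m + k)" if "r \<ge> 0" for r
      by (rule order_trans[OF D(2)[OF that] up[OF that]]) (use C(1) in auto)
  qed (use C D in auto)
qed

lemma tempered_add:
  assumes "tempered f" "tempered g"
  shows "tempered (\<lambda>r. f r + g r)"
proof -
  obtain C m where C: "C \<ge> 0" "\<And>r. r \<ge> 0 \<Longrightarrow> \<bar>f r\<bar> \<le> C * (1 + r) ^ m" "\<And>r. r \<ge> 0 \<Longrightarrow> \<bar>g r\<bar> \<le> C * (1 + r) ^ m"
    using tempered_common[OF assms] by metis
  show ?thesis
  proof (rule temperedI[of "2 * C" _ m])
    show "\<bar>f r + g r\<bar> \<le> 2 * C * (1 + r) ^ m" if "r \<ge> 0" for r
      using C(2)[OF that] C(3)[OF that] abs_triangle_ineq[of "f r" "g r"] by linarith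
  qed (use C in simp)
qed

lemma tempered_mult:
  assumes "tempered f" "tempered g"
  shows "tempered (\<lambda>r. f r * g r)"
proof -
  obtain C m where C: "C \<ge> 0" "\<And>r. r \<ge> 0 \<Longrightarrow> \<bar>f r\<bar> \<le> C * (1 + r) ^ m" "\<And>r. r \<ge> 0 \<Longrightarrow> \<bar>g r\<bar> \<le> C * (1 + r) ^ m"
    using tempered_common[OF assms] by metis
  show ?thesis
  proof (rule temperedI[of "C * C" _ "m + m"])
    show "\<bar>f r * g r\<bar> \<le> C * C * (1 + r) ^ (m + m)" if "r \<ge> 0" for r
      using mult_mono[OF C(2)[OF that] C(3)[OF that]] C(1) that by (simp add: abs_mult power_add mult_ac)
  qed (use C in simp)
qed

lemma tempered_poly: "tempered (\<lambda>r. poly p (r\<^sup>2))"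
proof (induction p)
  case (pCons c p)
  have "tempered (\<lambda>r. c + r * (r * poly p (r\<^sup>2)))"
    by (intro tempered_add tempered_mult tempered_id pCons.IH tempered_bounded[of _ "\<bar>c\<bar>"]) simp
  then show ?case by (simp add: power2_eq_square mult.assoc)
qed (auto intro: tempered_bounded[of _ 0])

text \<open>The coefficients of the polynomial solution of $4 s p'' + (2n - s) p' = -k p$ with $p(0)=1$.\<close>

primrec lag_coeff :: "nat \<Rightarrow> nat \<Rightarrow> nat \<Rightarrow> real" where
  "lag_coeff n k 0 = 1"
| "lag_coeff n k (Suc j) = (real j - real k) / (real (Suc j) * (4 * real j + 2 * real n)) * lag_coeff n k j"

definition lag :: "nat \<Rightarrow> nat \<Rightarrow> real poly" where
  "lag n k = (\<Sum>j\<le>k. monom (lag_coeff n k j) j)"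

text \<open>The drifted Laplacian without its zero-order terms, acting on functions p(|x|^2) and
  written in the variable s = |x|^2; \<open>poly_ode\<close> is the translation.\<close>

definition lag_op :: "nat \<Rightarrow> real poly \<Rightarrow> real poly" where
  "lag_op n p = [:0, 4:] * pderiv (pderiv p) + [:2 * real n, -1:] * pderiv p"

lemma coeff_lag: "coeff (lag n k) j = (if j \<le> k then lag_coeff n k j else 0)"
  by (simp add: lag_def coeff_sum)

lemma lag_coeff_nonzero: "n > 0 \<Longrightarrow> j \<le> k \<Longrightarrow> lag_coeff n k j \<noteq> 0"
  by (induction j) auto

lemma lag_op_add: "lag_op n (p + q) = lag_op n p + lag_op n q"
  unfolding lag_op_def pderiv_add distrib_left by (simp only: add_ac)

lemma lag_op_smult: "lag_op n (smult c p) = smult c (lag_op n p)"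
  unfolding lag_op_def pderiv_smult mult_smult_right smult_add_right ..

text \<open>Comparing coefficients gives back the recursion of \<open>lag_coeff\<close>. Its factor
  j - k vanishes at j = k, so the truncation at degree k is exact.\<close>

lemma lag_eigen:
  assumes "n > 0"
  shows "lag_op n (lag n k) = smult (- real k) (lag n k)"
proof (rule poly_eqI)
  fix j
  have shift: "coeff ([:0, 4:] * q) j = 4 * (if j = 0 then 0 else coeff q (j - 1))" for q :: "real poly"
    by (cases j) auto
  have shift2: "coeff ([:2 * real n, -1:] * q) j = 2 * real n * coeff q j - (if j = 0 then 0 else coeff q (j - 1))" for q :: "real poly"
    by (cases j) auto
  have "coeff (lag_op n (lag n k)) j = real (Suc j) * (4 * real j + 2 * real n) * coeff (lag n k) (Suc j) - real j * coeff (lag n k) j"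
    unfolding lag_op_def coeff_add shift shift2 coeff_pderiv
    by (cases j) (auto simp: algebra_simps)
  also have "real (Suc j) * (4 * real j + 2 * real n) * coeff (lag n k) (Suc j) = (real j - real k) * coeff (lag n k) j"
  proof -
    have nz: "real (Suc j) * (4 * real j + 2 * real n) \<noteq> 0" using assms by simp
    consider "Suc j \<le> k" | "j = k" | "j > k" by linarith
    then show ?thesis
    proof cases
      case 1
      have "real (Suc j) * (4 * real j + 2 * real n) * lag_coeff n k (Suc j) = (real j - real k) * lag_coeff n k j"
        unfolding lag_coeff.simps using nz by (metis nonzero_mult_div_cancel_left times_divide_eq_left times_divide_eq_right)
      then show ?thesis using 1 by (simp add: coeff_lag del: lag_coeff.simps)
    qed (auto simp: coeff_lag)
  qed
  finally show "coeff (lag_op n (lag n k)) j = coeff (smult (- real k) (lag n k)) j"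
    by (simp add: algebra_simps)
qed

section \<open>The closure of the operator as a perturbed diagonal operator\<close>

text \<open>All integrations by parts take this form: a combination of integrands, multiplied by
  r^(n-1), is recognized as the derivative of an explicit \<open>G\<close> that vanishes at both
  ends. The pointwise identity is needed off the origin only.\<close>

lemma radial_FTC:
  fixes \<phi> :: "real ^ 'n::finite \<Rightarrow> real"
  assumes G: "\<And>r. (G has_real_derivative G' r) (at r)" "continuous_on UNIV G'" "G 0 = 0" "R > 0" "G R = 0"
    and [measurable]: "\<phi> \<in> borel_measurable borel"
    and eq: "\<And>x. x \<noteq> 0 \<Longrightarrow> norm x \<le> R \<Longrightarrow> \<phi> x * norm x ^ (CARD('n) - 1) = G' (norm x)"
    and out: "\<And>x. norm x > R \<Longrightarrow> \<phi> x = 0"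
  shows "integrable lborel \<phi>" "(LINT x|lborel. \<phi> x) = 0"
proof -
  let ?n = "CARD('n)"
  define \<Phi> where "\<Phi> r = indicator {0<..R} r * (G' r / r ^ (?n - 1))" for r
  note [measurable] = borel_measurable_continuous_onI[OF G(2)]
  have [measurable]: "\<Phi> \<in> borel_measurable borel" unfolding \<Phi>_def[abs_def] by measurable
  have "AE x in lborel. (x :: real ^ 'n) \<noteq> 0" by (rule AE_lborel_singleton)
  then have AE1: "AE x in lborel. \<phi> x = \<Phi> (norm x)"
  proof eventually_elim
    case (elim x)
    then show ?case
    proof (cases "norm x \<le> R")
      case True
      then have "\<phi> x = G' (norm x) / norm x ^ (?n - 1)" using eq[OF elim True] elim by (simp add: field_simps)
      then show ?thesis using True elim by (simp add: \<Phi>_def)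
    qed (use out in \<open>simp add: \<Phi>_def\<close>)
  qed
  define K where "K = real ?n * unit_ball_vol (real ?n)"
  have FTC: "has_bochner_integral lborel (\<lambda>r. G' r * indicator {0..R} r) (G R - G 0)"
    using G(1,2,4) by (intro has_bochner_integral_FTC_Icc_real) (auto simp: continuous_on_eq_continuous_at)
  have AE2: "AE r in lborel. radial_density ?n r * \<Phi> r = K * (G' r * indicator {0..R} r)"
    using AE_lborel_singleton[of "0::real"]
    by eventually_elim (auto simp: radial_density_def \<Phi>_def K_def indicator_def)
  have "has_bochner_integral lborel (\<lambda>r. K * (G' r * indicator {0..R} r)) (K * (G R - G 0))"
    by (intro has_bochner_integral_mult_right FTC)
  then have hb: "has_bochner_integral lborel (\<lambda>r. radial_density ?n r * \<Phi> r) 0"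
    using G(3,5) AE2 by (subst has_bochner_integral_cong_AE[OF _ _ AE2]) auto
  have "integrable (lborel :: (real ^ 'n) measure) (\<lambda>x. \<Phi> (norm x))"
    by (subst integral_norm_lborel(2)) (use hb in \<open>auto simp: has_bochner_integral_iff\<close>)
  then show "integrable lborel \<phi>"
    using integrable_cong_AE[OF _ _ AE1] by auto
  have "(LINT x|lborel. \<phi> x) = (LINT x|(lborel :: (real ^ 'n) measure). \<Phi> (norm x))"
    by (rule integral_cong_AE) (use AE1 in auto)
  also have "\<dots> = 0"
    by (subst integral_norm_lborel(1)) (use hb in \<open>auto simp: has_bochner_integral_iff\<close>)
  finally show "(LINT x|lborel. \<phi> x) = 0" .
qed

context weight_coeffs
begin

text \<open>The class does not depend on the representative chosen here, see \<open>Vop_toH\<close>.\<close>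

definition Vop :: "'n radL2 \<Rightarrow> 'n radL2" where
  "Vop u = toH (\<lambda>x. potential n (norm x) * (SOME f. f \<in> L2rad \<and> u = toH f) x)"

lemma potential_mult_L2rad:
  fixes f :: "real ^ 'n \<Rightarrow> real"
  assumes f: "f \<in> L2rad"
  shows "(\<lambda>x. potential n (norm x) * f x) \<in> L2rad"
    and "\<And>K. (\<And>r. \<bar>potential n r\<bar> \<le> K) \<Longrightarrow> norm (toH (\<lambda>x. potential n (norm x) * f x)) \<le> K * norm (toH f)"
proof -
  note [measurable] = L2rad_borel[OF f]
  have bd: "(potential n (norm x) * f x)\<^sup>2 * wgt x \<le> K\<^sup>2 * ((f x)\<^sup>2 * wgt x)" if K: "\<And>r. \<bar>potential n r\<bar> \<le> K" for K x
  proof -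
    have "(potential n (norm x))\<^sup>2 \<le> K\<^sup>2" using power_mono[OF K[of "norm x"], of 2] by simp
    then have "(potential n (norm x))\<^sup>2 * ((f x)\<^sup>2 * wgt x) \<le> K\<^sup>2 * ((f x)\<^sup>2 * wgt x)"
      using wgt_pos[of x] by (intro mult_right_mono) auto
    then show ?thesis by (simp add: power_mult_distrib mult.assoc)
  qed
  obtain K where K: "\<And>r. \<bar>potential n r\<bar> \<le> K" using potential_bounded by metis
  have "radial (\<lambda>x. potential n (norm x) * f x)"
    using radialD[OF L2rad_radial[OF f]] unfolding radial_def by metis
  moreover have "integrable lborel (\<lambda>x. (potential n (norm x) * f x)\<^sup>2 * wgt x)"
  proof (rule Bochner_Integration.integrable_bound[OF integrable_mult_right[OF L2rad_integrable[OF f], of "K\<^sup>2"]])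
    show "AE x in lborel. norm ((potential n (norm x) * f x)\<^sup>2 * wgt x) \<le> norm (K\<^sup>2 * ((f x)\<^sup>2 * wgt x))"
      using bd[OF K] by (intro AE_I2) (simp add: abs_mult)
  qed measurable
  ultimately show L: "(\<lambda>x. potential n (norm x) * f x) \<in> L2rad" by (simp add: L2rad_def)
  fix K assume K: "\<And>r. \<bar>potential n r\<bar> \<le> K"
  have K0: "K \<ge> 0" using K[of 0] by simp
  have "(norm (toH (\<lambda>x. potential n (norm x) * f x)))\<^sup>2 \<le> (LINT x|lborel. K\<^sup>2 * ((f x)\<^sup>2 * wgt x))"
    unfolding norm_toH[OF L] by (intro integral_mono L2rad_integrable L integrable_mult_right f bd K)
  also have "\<dots> = (K * norm (toH f))\<^sup>2" by (simp add: norm_toH f power_mult_distrib)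
  finally show "norm (toH (\<lambda>x. potential n (norm x) * f x)) \<le> K * norm (toH f)"
    by (rule power2_le_imp_le) (simp add: K0)
qed

lemma Vop_toH:
  fixes f :: "real ^ 'n \<Rightarrow> real"
  assumes f: "f \<in> L2rad"
  shows "Vop (toH f) = toH (\<lambda>x. potential n (norm x) * f x)"
proof -
  define g where "g = (SOME g. g \<in> L2rad \<and> toH f = toH g)"
  have "g \<in> L2rad \<and> toH f = toH g" unfolding g_def by (rule someI[of _ f]) (use f in simp)
  then have g: "g \<in> L2rad" "toH f = toH g" by blast+
  then have "AE x in lborel. f x = g x" using toH_eq_iff[OF f g(1)] by simp
  then have "AE x in lborel. potential n (norm x) * f x = potential n (norm x) * g x"
    by eventually_elim simp
  then show ?thesis
    unfolding Vop_def g_def[symmetric]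
    using toH_eq_iff[OF potential_mult_L2rad(1)[OF f] potential_mult_L2rad(1)[OF g(1)]] by simp
qed

lemma bounded_linear_Vop: "bounded_linear Vop"
proof -
  obtain K where K: "\<And>r. \<bar>potential n r\<bar> \<le> K" using potential_bounded by metis
  show ?thesis
  proof (rule bounded_linear_intro)
    fix u v :: "'n radL2" and c :: real
    obtain f where f: "f \<in> L2rad" "u = toH f" using toH_ex by blast
    obtain g where g: "g \<in> L2rad" "v = toH g" using toH_ex by blast
    show "Vop (u + v) = Vop u + Vop v"
      by (simp add: f g toH_add[symmetric] Vop_toH L2rad_add potential_mult_L2rad(1) distrib_left)
    show "Vop (c *\<^sub>R u) = c *\<^sub>R Vop u"
      by (simp add: f toH_scale[symmetric] Vop_toH L2rad_scale potential_mult_L2rad(1) mult.left_commute)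
    show "norm (Vop u) \<le> norm u * K"
      using potential_mult_L2rad(2)[OF f(1) K] by (simp add: f Vop_toH mult.commute)
  qed
qed

lemma Vop_symmetric: "Vop u \<bullet> v = u \<bullet> Vop v"
proof -
  obtain f where f: "f \<in> L2rad" "u = toH f" using toH_ex by blast
  obtain g where g: "g \<in> L2rad" "v = toH g" using toH_ex by blast
  show ?thesis
    by (simp add: f g Vop_toH inner_toH potential_mult_L2rad(1)) (simp add: mult_ac)
qed

section \<open>Polynomials in the domain of the closure\<close>

definition poly_class :: "real poly \<Rightarrow> 'n radL2" where
  "poly_class p = toH (\<lambda>x. poly p ((norm x)\<^sup>2))"

lemma tempered_L2rad:
  assumes "tempered q" "q \<in> borel_measurable borel"
  shows "(\<lambda>x :: real ^ 'n. q (norm x)) \<in> L2rad"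
proof -
  obtain C m where "\<And>r. r \<ge> 0 \<Longrightarrow> \<bar>q r\<bar> \<le> C * (1 + r) ^ m"
    using assms(1) unfolding tempered_def by blast
  then show ?thesis using assms(2)
    by (intro poly_bounded_L2rad[where C=C and m=m]) (auto simp: radial_comp_norm)
qed

lemma poly_square_measurable [measurable]: "(\<lambda>r :: real. poly p (r\<^sup>2)) \<in> borel_measurable borel"
  by (intro borel_measurable_continuous_onI continuous_intros)

lemma poly_L2rad: "(\<lambda>x :: real ^ 'n. poly p ((norm x)\<^sup>2)) \<in> L2rad"
  by (rule tempered_L2rad[OF tempered_poly]) measurable

lemma poly_class_add: "poly_class (p + q) = poly_class p + poly_class q"
  by (simp add: poly_class_def toH_add[symmetric] poly_L2rad)

lemma poly_class_smult: "poly_class (smult c p) = c *\<^sub>R poly_class p"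
  by (simp add: poly_class_def toH_scale[symmetric] poly_L2rad)

lemma poly_class_zero: "poly_class 0 = 0"
  by (simp add: poly_class_def toH_zero)

lemma poly_radial_derivs:
  "((\<lambda>r. poly p (r\<^sup>2)) has_real_derivative 2 * r * poly (pderiv p) (r\<^sup>2)) (at r)"
  "((\<lambda>r. 2 * r * poly (pderiv p) (r\<^sup>2)) has_real_derivative
     2 * poly (pderiv p) (r\<^sup>2) + 4 * r\<^sup>2 * poly (pderiv (pderiv p)) (r\<^sup>2)) (at r)"
proof -
  have d: "((\<lambda>r. poly p (r\<^sup>2)) has_real_derivative 2 * r * poly (pderiv p) (r\<^sup>2)) (at r)" for p
  proof -
    have "((\<lambda>r::real. r\<^sup>2) has_real_derivative 2 * r) (at r)" by (auto intro!: derivative_eq_intros)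
    from DERIV_chain2[OF poly_DERIV this] show ?thesis by (simp add: mult.commute)
  qed
  show "((\<lambda>r. poly p (r\<^sup>2)) has_real_derivative 2 * r * poly (pderiv p) (r\<^sup>2)) (at r)" by (rule d)
  have "((\<lambda>r. 2 * r * poly (pderiv p) (r\<^sup>2)) has_real_derivative
     2 * r * (2 * r * poly (pderiv (pderiv p)) (r\<^sup>2)) + 2 * poly (pderiv p) (r\<^sup>2)) (at r)"
    by (rule DERIV_mult'[OF _ d]) (auto intro!: derivative_eq_intros)
  then show "((\<lambda>r. 2 * r * poly (pderiv p) (r\<^sup>2)) has_real_derivative
     2 * poly (pderiv p) (r\<^sup>2) + 4 * r\<^sup>2 * poly (pderiv (pderiv p)) (r\<^sup>2)) (at r)"
    by (rule DERIV_cong) (simp add: power2_eq_square)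
qed

lemma poly_ode:
  assumes "r \<noteq> 0"
  shows "(2 * poly (pderiv p) (r\<^sup>2) + 4 * r\<^sup>2 * poly (pderiv (pderiv p)) (r\<^sup>2))
    + (real n - 1) / r * (2 * r * poly (pderiv p) (r\<^sup>2)) - r / 2 * (2 * r * poly (pderiv p) (r\<^sup>2)) = poly (lag_op n p) (r\<^sup>2)"
proof -
  have e: "(real n - 1) / r * (2 * r * z) = 2 * (real n - 1) * z" "r / 2 * (2 * r * z) = r\<^sup>2 * z" for z
    using assms by (simp_all add: power2_eq_square)
  show ?thesis unfolding lag_op_def e by (simp add: algebra_simps)
qed

lemma tempered_potential: "tempered (potential n)"
proof (rule potential_bounded)
  fix K assume "\<And>r. \<bar>potential n r\<bar> \<le> K"
  then show ?thesis by (rule tempered_bounded)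
qed

lemma poly_in_function_algebra:
  "(\<lambda>x :: real ^ 'n. poly p ((norm x)\<^sup>2)) \<in> function_algebra (cutoff_gens R a b)"
proof (induction p)
  case (pCons c p)
  then show ?case
    by (simp add: function_algebra.add function_algebra.const function_algebra.mult norm_square_in_function_algebra)
qed (simp add: function_algebra.const)

lemma in_closure_L_op_tempered:
  fixes q q1 q2 l :: "real \<Rightarrow> real"
  assumes "\<And>r. r > 0 \<Longrightarrow> (q has_real_derivative q1 r) (at r)"
    and "\<And>r. r > 0 \<Longrightarrow> (q1 has_real_derivative q2 r) (at r)"
    and t: "tempered q" "tempered q1" "tempered l"
    and "q \<in> borel_measurable borel" "l \<in> borel_measurable borel"
    and "\<And>R. R > 0 \<Longrightarrow> (\<lambda>x :: real ^ 'n. q (norm x)) \<in> function_algebra (cutoff_gens R a b)"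
    and "\<And>r. r > 0 \<Longrightarrow> q2 r + (real n - 1) / r * q1 r - r / 2 * q1 r - q r + potential n r * q r = l r"
  shows "(toH (\<lambda>x :: real ^ 'n. q (norm x)), toH (\<lambda>x :: real ^ 'n. l (norm x))) \<in> closure L_op"
proof -
  have abs: "tempered (\<lambda>r. \<bar>f r\<bar>)" if "tempered f" for f using that by (simp add: tempered_def)
  have "tempered (\<lambda>r. \<bar>q r\<bar> + (\<bar>q1 r\<bar> + \<bar>l r\<bar>))" by (intro tempered_add abs t)
  then obtain C m where C: "C \<ge> 0" "\<And>r. r \<ge> 0 \<Longrightarrow> \<bar>\<bar>q r\<bar> + (\<bar>q1 r\<bar> + \<bar>l r\<bar>)\<bar> \<le> C * (1 + r) ^ m"
    unfolding tempered_def by blast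
  have "\<bar>q r\<bar> \<le> C * (1 + r) ^ m" "\<bar>q1 r\<bar> \<le> C * (1 + r) ^ m" "\<bar>l r\<bar> \<le> C * (1 + r) ^ m" if "r \<ge> 0" for r
    using C(2)[OF that] by linarith+
  then show ?thesis
    by (intro in_closure_L_op[where q=q and ?q1.0=q1 and ?q2.0=q2 and l=l and C=C and m=m] assms C(1)) auto
qed

lemma poly_in_closure: "(poly_class p, poly_class (lag_op n p - p) + Vop (poly_class p)) \<in> closure L_op"
proof -
  define l where "l r = poly (lag_op n p - p) (r\<^sup>2) + potential n r * poly p (r\<^sup>2)" for r
  have lm: "l \<in> borel_measurable borel" unfolding l_def[abs_def] by measurable
  have "(toH (\<lambda>x :: real ^ 'n. poly p ((norm x)\<^sup>2)), toH (\<lambda>x :: real ^ 'n. l (norm x))) \<in> closure L_op"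
  proof (rule in_closure_L_op_tempered[where q="\<lambda>r. poly p (r\<^sup>2)"])
    show "tempered (\<lambda>r. 2 * r * poly (pderiv p) (r\<^sup>2))"
      by (intro tempered_mult tempered_id tempered_poly tempered_bounded[of _ 2]) simp
    show "tempered l"
      unfolding l_def by (intro tempered_add tempered_mult tempered_poly tempered_potential)
    show "(\<lambda>x :: real ^ 'n. poly p ((norm x)\<^sup>2)) \<in> function_algebra (cutoff_gens R a b)" for R
      by (rule poly_in_function_algebra)
    fix r :: real assume r: "r > 0"
    show "2 * poly (pderiv p) (r\<^sup>2) + 4 * r\<^sup>2 * poly (pderiv (pderiv p)) (r\<^sup>2) + (real n - 1) / r * (2 * r * poly (pderiv p) (r\<^sup>2))
      - r / 2 * (2 * r * poly (pderiv p) (r\<^sup>2)) - poly p (r\<^sup>2) + potential n r * poly p (r\<^sup>2) = l r"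
      using poly_ode[of r p] r by (simp add: l_def)
  qed (rule poly_radial_derivs tempered_poly poly_square_measurable lm)+
  moreover have "toH (\<lambda>x :: real ^ 'n. l (norm x)) = poly_class (lag_op n p - p) + Vop (poly_class p)"
    by (simp only: l_def poly_class_def Vop_toH[OF poly_L2rad] toH_add[OF poly_L2rad potential_mult_L2rad(1)[OF poly_L2rad]])
  ultimately show ?thesis by (simp add: poly_class_def)
qed

text \<open>Green's identity between a test function and a polynomial: one boundary term vanishes
  through the factor r^(n-1), the other through compact support. Testing against polynomials
  suffices, since they contain the Laguerre basis.\<close>

lemma L_fun_symmetric_poly:
  fixes f :: "real ^ 'n \<Rightarrow> real"
  assumes f: "f \<in> Cc_rad"
  shows "toH (L_fun f) \<bullet> poly_class p = toH f \<bullet> (poly_class (lag_op n p - p) + Vop (poly_class p))"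
proof -
  obtain F F1 F2 R where F: "\<And>x. f x = F (norm x)" "\<And>r. (F has_real_derivative F1 r) (at r)"
    "\<And>r. (F1 has_real_derivative F2 r) (at r)" "continuous_on UNIV F2" "R > 0"
    "\<And>r. \<bar>r\<bar> \<ge> R \<Longrightarrow> F r = 0 \<and> F1 r = 0 \<and> F2 r = 0"
    using Cc_rad_profile[OF f] by blast
  have L: "L_fun f x = F2 (norm x) + (real n - 1) / norm x * F1 (norm x) - norm x / 2 * F1 (norm x)
      - F (norm x) + potential n (norm x) * F (norm x)" if "x \<noteq> 0" for x
    using L_fun_radial[OF F(1) F(2) F(3) that] by (simp only: n_eq)
  note fL = Cc_rad_L2rad[OF f]
  note [measurable] = L2rad_borel[OF fL(1)] L2rad_borel[OF fL(2)]
  define q where "q r = poly p (r\<^sup>2)" for r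
  define q1 where "q1 r = 2 * r * poly (pderiv p) (r\<^sup>2)" for r
  define q2 where "q2 r = 2 * poly (pderiv p) (r\<^sup>2) + 4 * r\<^sup>2 * poly (pderiv (pderiv p)) (r\<^sup>2)" for r
  have dq: "(q has_real_derivative q1 r) (at r)" "(q1 has_real_derivative q2 r) (at r)" for r
    unfolding q_def q1_def q2_def by (rule poly_radial_derivs)+
  have cont: "continuous_on UNIV F" "continuous_on UNIV F1" "continuous_on UNIV q" "continuous_on UNIV q1" "continuous_on UNIV q2"
  proof -
    show "continuous_on UNIV F" by (rule DERIV_continuous_on) (rule F(2))
    show "continuous_on UNIV F1" by (rule DERIV_continuous_on) (rule F(3))
    show "continuous_on UNIV q" by (rule DERIV_continuous_on) (rule dq(1))
    show "continuous_on UNIV q1" by (rule DERIV_continuous_on) (rule dq(2))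
    show "continuous_on UNIV q2" unfolding q2_def by (intro continuous_intros)
  qed
  define l where "l r = poly (lag_op n p - p) (r\<^sup>2) + potential n r * q r" for r
  have lL: "(\<lambda>x :: real ^ 'n. l (norm x)) \<in> L2rad"
    unfolding l_def q_def by (intro L2rad_add poly_L2rad potential_mult_L2rad(1))
  \<comment> \<open>With n - 1 = \<open>Suc N\<close> the power rule meets no truncated
    subtraction.\<close>
  obtain N where N: "n = Suc (Suc N)" using n_ge by (metis Suc_le_D numeral_eq_Suc Suc_le_mono le0 pred_numeral_simps(2) pred_numeral_simps(3))
  \<comment> \<open>The Wronskian of F and q. Its derivative contains no product of first
    derivatives, and times r^(n-1) exp(-r^2/4) it is the primitive \<open>G\<close> of the
    difference of the two integrands.\<close>
  define D where "D r = F1 r * q r - F r * q1 r" for r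
  define D' where "D' r = F2 r * q r - F r * q2 r" for r
  have dD: "(D has_real_derivative D' r) (at r)" for r
    unfolding D_def D'_def
    by (rule DERIV_cong[OF DERIV_diff[OF DERIV_mult'[OF F(3) dq(1)] DERIV_mult'[OF F(2) dq(2)]]]) simp
  define G where "G r = r ^ Suc N * (exp (- (1/4) * r\<^sup>2) * D r)" for r
  define G' where "G' r = r ^ Suc N * (exp (- (1/4) * r\<^sup>2) * D' r + (- r / 2) * exp (- (1/4) * r\<^sup>2) * D r)
      + real (Suc N) * r ^ N * (exp (- (1/4) * r\<^sup>2) * D r)" for r
  define \<phi> where "\<phi> x = L_fun f x * q (norm x) * wgt x - f x * l (norm x) * wgt x" for x :: "real ^ 'n"
  have "(LINT x|lborel. \<phi> x) = 0"
  proof (rule radial_FTC(2)[where G=G and G'=G' and R=R])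
    show "(G has_real_derivative G' r) (at r)" for r
      unfolding G_def
    proof (rule DERIV_cong)
      show "((\<lambda>r. r ^ Suc N * (exp (- (1/4) * r\<^sup>2) * D r)) has_real_derivative
        r ^ Suc N * (exp (- (1/4) * r\<^sup>2) * D' r + (exp (- (1/4) * r\<^sup>2) * (- (1/4) * (2 * r))) * D r)
        + (real (Suc N) * r ^ N) * (exp (- (1/4) * r\<^sup>2) * D r)) (at r)"
      proof (intro DERIV_mult' dD)
        show "((\<lambda>r. r ^ Suc N) has_real_derivative real (Suc N) * r ^ N) (at r)"
          using DERIV_pow[of "Suc N" r] by simp
        show "((\<lambda>r. exp (- (1/4) * r\<^sup>2)) has_real_derivative exp (- (1/4) * r\<^sup>2) * (- (1/4) * (2 * r))) (at r)"
          by (auto intro!: derivative_eq_intros)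
      qed
    qed (simp add: G'_def)
    show "continuous_on UNIV G'"
      unfolding G'_def D_def D'_def
      by (intro continuous_on_add continuous_on_diff continuous_on_mult continuous_on_power continuous_on_exp
          continuous_on_const continuous_on_id continuous_on_divide continuous_on_minus cont F(4)) simp_all
    show "G 0 = 0" by (simp add: G_def)
    show "G R = 0" using F(6)[of R] by (simp add: G_def D_def)
    show "\<phi> \<in> borel_measurable borel"
      using L2rad_borel[OF lL] unfolding \<phi>_def q_def by measurable
    show "\<phi> x = 0" if "norm x > R" for x
    proof -
      have "x \<noteq> 0" using that F(5) by auto
      then show ?thesis using L[of x] F(6)[of "norm x"] that by (simp add: \<phi>_def F(1))
    qed
    fix x :: "real ^ 'n" assume x: "x \<noteq> 0" "norm x \<le> R"
    define r where "r = norm x"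
    have r: "r > 0" using x by (simp add: r_def)
    have l_eq: "l r = q2 r + (real n - 1) / r * q1 r - r / 2 * q1 r - q r + potential n r * q r"
      using poly_ode[of r p] r by (simp add: l_def q_def q1_def q2_def)
    have "\<phi> x = ((F2 r + (real n - 1) / r * F1 r - r / 2 * F1 r - F r + potential n r * F r) * q r
       - F r * (q2 r + (real n - 1) / r * q1 r - r / 2 * q1 r - q r + potential n r * q r)) * exp (- (1/4) * r\<^sup>2)"
      using L[OF x(1)] by (simp add: \<phi>_def F(1) r_def[symmetric] l_eq wgt_eq left_diff_distrib)
    also have "\<dots> = (D' r + (real n - 1) / r * D r - r / 2 * D r) * exp (- (1/4) * r\<^sup>2)"
      by (simp add: D_def D'_def algebra_simps)
    also have "\<dots> * r ^ Suc N = G' r"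
      using r by (simp add: G'_def N field_simps)
    finally show "\<phi> x * norm x ^ (CARD('n) - 1) = G' (norm x)"
      by (simp add: r_def[symmetric] n_eq N)
  qed (rule F(5))
  moreover have "(LINT x|lborel. \<phi> x) = toH (L_fun f) \<bullet> poly_class p - toH f \<bullet> toH (\<lambda>x. l (norm x))"
    unfolding \<phi>_def poly_class_def q_def[symmetric]
    using poly_L2rad[of p, folded q_def] fL lL
    by (simp add: inner_toH L2rad_mult_integrable)
  moreover have "toH (\<lambda>x :: real ^ 'n. l (norm x)) = poly_class (lag_op n p - p) + Vop (poly_class p)"
    unfolding l_def q_def
    by (simp only: poly_class_def Vop_toH[OF poly_L2rad] toH_add[OF poly_L2rad potential_mult_L2rad(1)[OF poly_L2rad]])
  ultimately show ?thesis by simp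
qed

lemma closure_L_op_symmetric_poly:
  assumes "(x, y) \<in> closure L_op"
  shows "y \<bullet> poly_class p = x \<bullet> (poly_class (lag_op n p - p) + Vop (poly_class p))"
proof -
  let ?S = "{z. snd z \<bullet> poly_class p = fst z \<bullet> (poly_class (lag_op n p - p) + Vop (poly_class p))}"
  have "closed ?S" by (intro closed_Collect_eq continuous_intros)
  moreover have "L_op \<subseteq> ?S" by (auto simp: L_op_def L_fun_symmetric_poly)
  ultimately have "closure L_op \<subseteq> ?S" by (intro closure_minimal)
  then show ?thesis using assms by auto
qed

section \<open>The Laguerre basis and the identification of the closure\<close>

definition lag_vec :: "nat \<Rightarrow> 'n radL2" where
  "lag_vec k = poly_class (lag n k)"

definition lag_basis :: "nat \<Rightarrow> 'n radL2" where
  "lag_basis k = lag_vec k /\<^sub>R norm (lag_vec k)"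

text \<open>All indices belong to this set; working with it spares the proof that a nonzero polynomial
  is not zero almost everywhere.\<close>

definition lag_index :: "nat set" where
  "lag_index = {k. lag_vec k \<noteq> 0}"

lemma lag_image: "poly_class (lag_op n (lag n k) - lag n k) = - (real k + 1) *\<^sub>R lag_vec k"
proof -
  have "lag_op n (lag n k) - lag n k = smult (- (real k + 1)) (lag n k)"
    using n_ge by (simp add: lag_eigen smult_diff_left)
  then show ?thesis by (simp only: poly_class_smult lag_vec_def)
qed

lemma lag_vec_in_closure: "(lag_vec k, - (real k + 1) *\<^sub>R lag_vec k + Vop (lag_vec k)) \<in> closure L_op"
  using poly_in_closure[of "lag n k"] by (simp only: lag_image) (simp only: lag_vec_def)

text \<open>The weak eigenvalue equation against \<open>lag_vec k\<close>. It places the closure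
  inside the perturbed diagonal operator, and it also yields the orthogonality of the basis.\<close>

lemma lag_vec_test:
  assumes "(x, y) \<in> closure L_op"
  shows "(y - Vop x) \<bullet> lag_vec k = - (real k + 1) * (x \<bullet> lag_vec k)"
proof -
  have "y \<bullet> lag_vec k = x \<bullet> (- (real k + 1) *\<^sub>R lag_vec k + Vop (lag_vec k))"
    using closure_L_op_symmetric_poly[OF assms, of "lag n k"] by (simp only: lag_image) (simp only: lag_vec_def)
  then show ?thesis
    by (simp only: inner_diff_left inner_add_right inner_scaleR_right Vop_symmetric)
qed

text \<open>The weak equation applied to \<open>lag_vec j\<close> itself assigns two different
  eigenvalues to one inner product; no integral of Laguerre polynomials is computed.\<close>

lemma lag_vec_orthogonal: "j \<noteq> k \<Longrightarrow> lag_vec j \<bullet> lag_vec k = 0"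
  using lag_vec_test[OF lag_vec_in_closure[of j], of k] by simp

text \<open>Induction on a bound for the degree: the leading coefficient
  \<open>lag_coeff n k k\<close> is nonzero, so a multiple of \<open>lag n k\<close> removes the top
  term.\<close>

lemma poly_class_orthogonal_zero:
  assumes x: "\<And>k. x \<bullet> lag_vec k = 0"
  shows "x \<bullet> poly_class p = 0"
proof -
  have "\<forall>p. (\<forall>j\<ge>k. coeff p j = 0) \<longrightarrow> x \<bullet> poly_class p = 0" for k
  proof (induction k)
    case 0
    have "p = 0" if "\<forall>j\<ge>0. coeff p j = 0" for p :: "real poly"
      by (rule poly_eqI) (use that in simp)
    then show ?case by (metis poly_class_zero inner_zero_right)
  next
    case (Suc k)
    show ?case
    proof (intro allI impI)
      fix p :: "real poly" assume p: "\<forall>j\<ge>Suc k. coeff p j = 0"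
      define c where "c = coeff p k / lag_coeff n k k"
      have nz: "lag_coeff n k k \<noteq> 0" using n_ge by (intro lag_coeff_nonzero) auto
      have "\<forall>j\<ge>k. coeff (p + smult (- c) (lag n k)) j = 0"
      proof (intro allI impI)
        fix j assume "k \<le> j"
        then consider "j = k" | "Suc k \<le> j" by linarith
        then show "coeff (p + smult (- c) (lag n k)) j = 0"
          using p nz by cases (auto simp: coeff_lag c_def)
      qed
      then have "x \<bullet> poly_class (p + smult (- c) (lag n k)) = 0" using Suc.IH by blast
      then show "x \<bullet> poly_class p = 0"
        using x[of k] unfolding poly_class_add poly_class_smult inner_add_right inner_scaleR_right lag_vec_def[symmetric] by simp
    qed
  qed
  from this[of "Suc (degree p)"] show ?thesis by (simp add: coeff_eq_0)
qed

lemma lag_total: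
  assumes x: "\<And>k. x \<bullet> lag_vec k = 0"
  shows "x = 0"
proof -
  obtain h where h: "h \<in> L2rad" "x = toH h" using toH_ex by blast
  have "(LINT y|lborel. h y * norm y ^ (2 * k) * wgt y) = 0" for k
  proof -
    have "x \<bullet> poly_class (monom 1 k) = (LINT y|lborel. h y * norm y ^ (2 * k) * wgt y)"
      unfolding poly_class_def h(2) by (subst inner_toH[OF h(1) poly_L2rad]) (simp add: poly_monom power_mult)
    then show ?thesis using poly_class_orthogonal_zero[OF x] by simp
  qed
  then show ?thesis using moments_zero[OF h(1)] h(2) by simp
qed

definition T0 :: "'n radL2 operator" where
  "T0 = {(x, y). \<forall>k\<in>lag_index. y \<bullet> lag_basis k = - (real k + 1) * (x \<bullet> lag_basis k)}"

lemma lag_vec_index: "k \<in> lag_index \<Longrightarrow> x \<bullet> lag_vec k = norm (lag_vec k) * (x \<bullet> lag_basis k)"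
  by (simp add: lag_basis_def lag_index_def)

sublocale lag: diagonal_operator lag_basis lag_index "\<lambda>k. - (real k + 1)" 0 T0
proof unfold_locales
  show "lag_basis i \<bullet> lag_basis j = (if i = j then 1 else 0)" if "i \<in> lag_index" "j \<in> lag_index" for i j
    using that lag_vec_orthogonal[of i j]
    by (auto simp: lag_basis_def lag_index_def power2_norm_eq_inner[symmetric] power2_eq_square field_simps)
  show "x = 0" if "\<And>i. i \<in> lag_index \<Longrightarrow> x \<bullet> lag_basis i = 0" for x
  proof (rule lag_total)
    show "x \<bullet> lag_vec k = 0" for k
      using that[of k] by (cases "k \<in> lag_index") (auto simp: lag_vec_index, simp add: lag_index_def)
  qed
  show "finite {i \<in> lag_index. M \<le> - (real i + 1)}" for M
  proof (rule finite_subset)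
    show "{i \<in> lag_index. M \<le> - (real i + 1)} \<subseteq> {..nat \<lceil>\<bar>M\<bar>\<rceil>}"
    proof safe
      fix i assume "M \<le> - (real i + 1)"
      then have "real i \<le> \<bar>M\<bar>" by linarith
      also have "\<bar>M\<bar> \<le> real (nat \<lceil>\<bar>M\<bar>\<rceil>)" by (rule real_nat_ceiling_ge)
      finally show "i \<le> nat \<lceil>\<bar>M\<bar>\<rceil>" by simp
    qed
  qed simp
qed (auto simp: T0_def)

text \<open>One inclusion is the weak equation. For the other, truncated Laguerre expansions are
  polynomials, whose images under the closure are known; both components of the graph converge, and
  boundedness of V carries the potential along.\<close>

theorem closure_L_op_eq: "closure L_op = {(x, y). (x, y - Vop x) \<in> T0}"
proof (intro equalityI subsetI)
  fix z :: "'n radL2 \<times> 'n radL2" assume z: "z \<in> closure L_op"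
  obtain x y where xy: "z = (x, y)" by (cases z)
  have "(y - Vop x) \<bullet> lag_basis k = - (real k + 1) * (x \<bullet> lag_basis k)" for k
    using lag_vec_test[of x y k] z by (simp add: xy lag_basis_def) 
  then show "z \<in> {(x, y). (x, y - Vop x) \<in> T0}" by (simp add: xy T0_def)
next
  fix z :: "'n radL2 \<times> 'n radL2" assume z: "z \<in> {(x, y). (x, y - Vop x) \<in> T0}"
  obtain x y where xy: "z = (x, y)" by (cases z)
  define w where "w = y - Vop x"
  have w: "w \<bullet> lag_basis k = - (real k + 1) * (x \<bullet> lag_basis k)" if "k \<in> lag_index" for k
    using z that by (auto simp: xy w_def T0_def)
  define X where "X F = (\<Sum>k\<in>F. (x \<bullet> lag_basis k) *\<^sub>R lag_basis k)" for F
  define Y where "Y F = (\<Sum>k\<in>F. (w \<bullet> lag_basis k) *\<^sub>R lag_basis k)" for F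
  have X: "(X \<longlongrightarrow> x) (finite_subsets_at_top lag_index)" and Y: "(Y \<longlongrightarrow> w) (finite_subsets_at_top lag_index)"
    using lag.expansion[of x] lag.expansion[of w] unfolding has_sum_def X_def[abs_def] Y_def[abs_def] by auto
  have V: "((\<lambda>F. Vop (X F)) \<longlongrightarrow> Vop x) (finite_subsets_at_top lag_index)"
    by (rule bounded_linear.tendsto[OF bounded_linear_Vop X])
  have mem: "(X F, Y F + Vop (X F)) \<in> closure L_op" if "finite F" "F \<subseteq> lag_index" for F
  proof -
    \<comment> \<open>A single polynomial has to represent both sums: \<open>X F\<close> is its
      class and \<open>Y F\<close> the class of its image under the unperturbed operator.\<close>
    have "\<exists>p. X F = poly_class p \<and> Y F = poly_class (lag_op n p - p)"
      using that
    proof (induction F rule: finite_induct)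
      case empty
      show ?case by (rule exI[of _ 0]) (simp add: X_def Y_def poly_class_zero lag_op_def)
    next
      case (insert k F)
      then obtain p where p: "X F = poly_class p" "Y F = poly_class (lag_op n p - p)" by auto
      define c where "c = (x \<bullet> lag_basis k) / norm (lag_vec k)"
      have k: "k \<in> lag_index" using insert by simp
      have e1: "X (insert k F) = c *\<^sub>R lag_vec k + X F"
        using insert.hyps by (simp add: X_def c_def lag_basis_def divide_inverse)
      have e2: "Y (insert k F) = c *\<^sub>R (- (real k + 1) *\<^sub>R lag_vec k) + Y F"
        using insert.hyps w[OF k] by (simp add: Y_def c_def lag_basis_def divide_inverse mult_ac)
      have "X (insert k F) = poly_class (smult c (lag n k) + p)"
        by (simp add: e1 p poly_class_add poly_class_smult lag_vec_def)
      moreover have "Y (insert k F) = poly_class (lag_op n (smult c (lag n k) + p) - (smult c (lag n k) + p))"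
      proof -
        have "lag_op n (smult c (lag n k) + p) - (smult c (lag n k) + p)
            = smult c (lag_op n (lag n k) - lag n k) + (lag_op n p - p)"
          by (simp add: lag_op_add lag_op_smult smult_diff_right)
        then show ?thesis by (simp only: poly_class_add poly_class_smult lag_image e2 p)
      qed
      ultimately show ?case by blast
    qed
    then show ?thesis using poly_in_closure by metis
  qed
  have "((\<lambda>F. (X F, Y F + Vop (X F))) \<longlongrightarrow> (x, w + Vop x)) (finite_subsets_at_top lag_index)"
    by (intro tendsto_Pair tendsto_add X Y V)
  moreover have "\<forall>\<^sub>F F in finite_subsets_at_top lag_index. (X F, Y F + Vop (X F)) \<in> closure L_op"
    by (rule eventually_finite_subsets_at_top_weakI) (rule mem)
  ultimately have "(x, w + Vop x) \<in> closure L_op"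
    by (intro Lim_in_closed_set[OF closed_closure, where F="finite_subsets_at_top lag_index"]) simp_all
  then show "z \<in> closure L_op" by (simp add: xy w_def)
qed

end

section \<open>The ground state and the spectral gap\<close>

lemma coeff_a_square: "n \<ge> 4 \<Longrightarrow> (coeff_a n)\<^sup>2 = (real n - 4) / 8"
  by (simp add: coeff_a_def power_divide power_mult_distrib)

text \<open>This form removes the second square root; together with 8 a^2 = n - 4 it makes all later
  identities polynomial in a.\<close>

lemma coeff_b_eq: "n \<ge> 4 \<Longrightarrow> coeff_b n = 3 * (real n - 4) - 2 * coeff_a n * real n"
proof -
  assume n: "n \<ge> 4"
  have "sqrt (2 * real n - 8) = sqrt 2 * sqrt (real n - 4)"
    by (simp add: real_sqrt_mult[symmetric])
  moreover have "1/2 * (sqrt 2 * z) = 2 * (z / (2 * sqrt 2))" for z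
    by (simp add: field_simps)
  ultimately have "1/2 * sqrt (2 * real n - 8) = 2 * coeff_a n"
    by (simp add: coeff_a_def)
  then show ?thesis unfolding coeff_b_def by (simp add: algebra_simps)
qed

text \<open>Conjugation with g: for F = u g, that is u = F D^2, the zero-order terms of L - 1 cancel
  and g (u'' + p u') remains. Here \<open>i\<close> is 1/D, \<open>\<rho>\<close> is 1/r,
  \<open>t\<close> is r/2 and \<open>N\<close> is n - 1; treated as symbols with two relations, they
  turn the claim into polynomial algebra.\<close>

lemma ground_state_identity:
  fixes D i r \<rho> t a N F F1 F2 :: real
  assumes "D * i = 1" "r * \<rho> = 1"
  shows "F2 + N * \<rho> * F1 - t * F1 - F + (2 + (4 * a * (N + 1) - 4 * a * r * t) * i - 24 * a\<^sup>2 * r\<^sup>2 * i\<^sup>2) * F - F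
    = i\<^sup>2 * ((F2 * D\<^sup>2 + 2 * F1 * (4 * a * r * D) + F * (4 * a * D + 8 * a\<^sup>2 * r\<^sup>2))
        + (N * \<rho> - t - 8 * a * r * i) * (F1 * D\<^sup>2 + F * (4 * a * r * D)))"
proof -
  have "i\<^sup>2 * D\<^sup>2 = (D * i)\<^sup>2" "i\<^sup>2 * D = i * (D * i)"
    by (simp_all add: power_mult_distrib power2_eq_square)
  then have i: "i\<^sup>2 * D\<^sup>2 = 1" "i\<^sup>2 * D = i"
    unfolding assms(1) by simp_all
  have "i\<^sup>2 * ((F2 * D\<^sup>2 + 2 * F1 * (4 * a * r * D) + F * (4 * a * D + 8 * a\<^sup>2 * r\<^sup>2))
        + (N * \<rho> - t - 8 * a * r * i) * (F1 * D\<^sup>2 + F * (4 * a * r * D)))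
    = F2 * (i\<^sup>2 * D\<^sup>2) + 8 * a * r * F1 * (i\<^sup>2 * D) + F * (4 * a * (i\<^sup>2 * D) + 8 * a\<^sup>2 * r\<^sup>2 * i\<^sup>2)
      + (N * \<rho> - t - 8 * a * r * i) * F1 * (i\<^sup>2 * D\<^sup>2) + 4 * a * N * (r * \<rho>) * F * (i\<^sup>2 * D)
      + (- t - 8 * a * r * i) * F * 4 * a * r * (i\<^sup>2 * D)"
    by (simp add: algebra_simps)
  then show ?thesis unfolding i assms(2) by (simp add: algebra_simps power2_eq_square)
qed

text \<open>The choice of $r$ as a supersolution of the equation satisfied by $u'$: the expression on the
  right becomes, up to the factor $r^{n-3}$ times the weight, the derivative of $m u'^2 (p + 1/r)$.\<close>

lemma gap_identity:
  fixes r \<rho> p P C u1 u2 N :: real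
  assumes "r * \<rho> = 1" "r * p = P"
  shows "r\<^sup>2 * ((u2 + p * u1)\<^sup>2 - ((u2 - \<rho> * u1)\<^sup>2 + C * u1\<^sup>2))
    = N * (P + 1) * u1\<^sup>2 + (P - N - 1) * (P + 1) * u1\<^sup>2 - C * r\<^sup>2 * u1\<^sup>2 + 2 * r * (P + 1) * u1 * u2"
proof -
  have "r\<^sup>2 * ((u2 + p * u1)\<^sup>2 - ((u2 - \<rho> * u1)\<^sup>2 + C * u1\<^sup>2))
    = (r * u2 + (r * p) * u1)\<^sup>2 - ((r * u2 - (r * \<rho>) * u1)\<^sup>2 + C * r\<^sup>2 * u1\<^sup>2)"
    by (simp add: power2_eq_square algebra_simps)
  then show ?thesis unfolding assms by (simp add: power2_eq_square algebra_simps)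
qed

context weight_coeffs
begin

lemma a_square: "8 * a\<^sup>2 = real n - 4"
  using coeff_a_square[of n] n_ge a_eq by simp

lemma b_formula: "b = 3 * (real n - 4) - 2 * a * real n"
  using coeff_b_eq[of n] n_ge a_eq b_eq by simp

definition D where "D r = a * r\<^sup>2 + b"
definition q where "q r = 1 / (D r)\<^sup>2"

lemma D_pos: "D r > 0" "D r \<noteq> 0"
  using denominator_pos(2)[of r] by (auto simp: D_def)

lemma q_pos: "q r > 0"
  using D_pos by (simp add: q_def)

lemma D_deriv: "(D has_real_derivative 2 * a * r) (at r)"
  unfolding D_def[abs_def] by (auto intro!: derivative_eq_intros)

lemma inverse_D_deriv: "((\<lambda>r. 1 / D r) has_real_derivative - (2 * a * r) * (1 / D r)\<^sup>2) (at r)"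
  using D_pos[of r] by (auto intro!: derivative_eq_intros D_deriv simp: power2_eq_square)

lemma D_continuous: "continuous_on S D"
  unfolding D_def[abs_def] by (intro continuous_intros)

lemma q_continuous: "continuous_on S q"
  unfolding q_def[abs_def] by (intro continuous_intros D_continuous) (use D_pos in auto)

lemma q_measurable [measurable]: "q \<in> borel_measurable borel"
  by (rule borel_measurable_continuous_onI[OF q_continuous])

text \<open>The right side is 2 - g0/g, where g0 is the drifted Laplacian of g without zero-order
  terms, so this form of the potential expresses Lg = g. It agrees with the given one by virtue of n
  = 8 a^2 + 4 and b = 24 a^2 - 2 a n.\<close>

lemma potential_eq:
  "potential n r = 2 + (4 * a * real n - 2 * a * r\<^sup>2) / D r - 24 * a\<^sup>2 * r\<^sup>2 / (D r)\<^sup>2"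
proof -
  have id: "3 * (m - 4) * (2 * B + (2 * a - 1) * s) = 2 * (a * s + B)\<^sup>2 + (4 * a * m - 2 * a * s) * (a * s + B) - 24 * a\<^sup>2 * s"
    if "m = 8 * a\<^sup>2 + 4" "B = 24 * a\<^sup>2 - 2 * a * (8 * a\<^sup>2 + 4)" for m B s
    unfolding that by (simp add: power2_eq_square algebra_simps)
  have n: "real n = 8 * a\<^sup>2 + 4" using a_square by simp
  have b: "b = 24 * a\<^sup>2 - 2 * a * (8 * a\<^sup>2 + 4)" using b_formula unfolding n by simp
  have "3 * (real n - 4) * (2 * b + (2 * a - 1) * r\<^sup>2) = 2 * (D r)\<^sup>2 + (4 * a * real n - 2 * a * r\<^sup>2) * D r - 24 * a\<^sup>2 * r\<^sup>2"
    unfolding D_def by (rule id[OF n b])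
  moreover have "potential n r = 3 * (real n - 4) * (2 * b + (2 * a - 1) * r\<^sup>2) / (D r)\<^sup>2"
    by (simp add: potential_def a_eq b_eq D_def add.commute)
  ultimately have "potential n r = (2 * (D r)\<^sup>2 + (4 * a * real n - 2 * a * r\<^sup>2) * D r - 24 * a\<^sup>2 * r\<^sup>2) / (D r)\<^sup>2"
    by simp
  then show ?thesis
    using D_pos(2)[of r] by (simp add: add_divide_distrib diff_divide_distrib power2_eq_square)
qed

lemma D_ge: "D r \<ge> b" "D r \<ge> a * r\<^sup>2"
  using a_pos b_pos by (auto simp: D_def)

lemma tempered_inverse_D: "tempered (\<lambda>r. 1 / D r)"
proof (rule tempered_bounded)
  show "\<bar>1 / D r\<bar> \<le> 1 / b" for r using D_ge(1)[of r] D_pos[of r] b_pos by (simp add: frac_le)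
qed

text \<open>The cutoff argument used for polynomials applies again, since g is bounded and lies in
  the algebra of \<open>cutoff_gens\<close>. The equation Lg = g reduces to \<open>id\<close>, a
  polynomial identity in \<open>i\<close> = 1/D.\<close>

lemma ground_in_closure:
  "(toH (eigfun_g :: real ^ 'n \<Rightarrow> real), toH eigfun_g) \<in> closure L_op" (is ?A)
  and eigfun_g_eq: "eigfun_g = (\<lambda>x :: real ^ 'n. q (norm x))" (is ?B)
  and eigfun_g_L2rad: "(eigfun_g :: real ^ 'n \<Rightarrow> real) \<in> L2rad" (is ?C)
proof -
  show B: ?B
    by (rule ext) (simp add: eigfun_g_def n_eq a_eq b_eq q_def D_def)
  define q1 where "q1 r = - 4 * a * r * (1 / D r) ^ 3" for r
  define q2 where "q2 r = - 4 * a * (1 / D r) ^ 3 + 24 * a\<^sup>2 * r\<^sup>2 * (1 / D r) ^ 4" for r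
  have qt: "tempered q"
  proof -
    have "tempered (\<lambda>r. 1 / D r * (1 / D r))" by (intro tempered_mult tempered_inverse_D)
    then show ?thesis by (simp add: q_def[abs_def] power2_eq_square)
  qed
  show ?C unfolding B by (rule tempered_L2rad[OF qt]) measurable
  have "(toH (\<lambda>x :: real ^ 'n. q (norm x)), toH (\<lambda>x :: real ^ 'n. q (norm x))) \<in> closure L_op"
  proof (rule in_closure_L_op_tempered)
    show "(q has_real_derivative q1 r) (at r)" for r
    proof -
      have "((\<lambda>r. (1 / D r)\<^sup>2) has_real_derivative real 2 * (- (2 * a * r) * (1 / D r)\<^sup>2 * (1 / D r) ^ (2 - Suc 0))) (at r)"
        by (rule DERIV_power[OF inverse_D_deriv])
      then have "((\<lambda>r. (1 / D r)\<^sup>2) has_real_derivative q1 r) (at r)"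
        by (rule DERIV_cong) (simp add: q1_def power2_eq_square power3_eq_cube)
      then show ?thesis by (simp add: q_def[abs_def] power_divide)
    qed
    show "(q1 has_real_derivative q2 r) (at r)" for r
      unfolding q1_def[abs_def]
    proof (rule DERIV_cong[OF DERIV_mult'[OF _ DERIV_power[OF inverse_D_deriv]]])
      show "((\<lambda>r. - 4 * a * r) has_real_derivative - 4 * a) (at r)" by (auto intro!: derivative_eq_intros)
      have "- 4 * a * r * (real 3 * (- (2 * a * r) * i\<^sup>2 * i ^ (3 - Suc 0))) + - 4 * a * i ^ 3 = - 4 * a * i ^ 3 + 24 * a\<^sup>2 * r\<^sup>2 * i ^ 4" for i
        by (simp add: power2_eq_square power3_eq_cube power4_eq_xxxx)
      then show "- 4 * a * r * (real 3 * (- (2 * a * r) * (1 / D r)\<^sup>2 * (1 / D r) ^ (3 - Suc 0))) + - 4 * a * (1 / D r) ^ 3 = q2 r"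
        unfolding q2_def .
    qed
    show "tempered q1"
    proof -
      have "tempered (\<lambda>r. (- 4 * a) * (r * (1 / D r * (1 / D r * (1 / D r)))))"
        by (intro tempered_mult tempered_inverse_D tempered_id tempered_bounded[of _ "\<bar>- 4 * a\<bar>"]) simp
      then show ?thesis by (simp only: q1_def[abs_def] power3_eq_cube mult.assoc)
    qed
    show "(\<lambda>x :: real ^ 'n. q (norm x)) \<in> function_algebra (cutoff_gens R a b)" for R
    proof -
      have "(\<lambda>x :: real ^ 'n. 1 / (a * (norm x)\<^sup>2 + b) * (1 / (a * (norm x)\<^sup>2 + b))) \<in> function_algebra (cutoff_gens R a b)"
        by (intro function_algebra.mult function_algebra.gen) (auto simp: cutoff_gens_def)
      then show ?thesis by (simp add: q_def D_def power2_eq_square)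
    qed
    fix r :: real assume r: "r > 0"
    have V: "potential n r = 2 + (4 * a * real n - 2 * a * r\<^sup>2) * (1 / D r) - 24 * a\<^sup>2 * r\<^sup>2 * (1 / D r)\<^sup>2"
      unfolding potential_eq by (simp add: power_divide)
    have id: "- 4 * a * i ^ 3 + 24 * a\<^sup>2 * r\<^sup>2 * i ^ 4 + - 4 * a * (real n - 1) * i ^ 3 - - 2 * a * r\<^sup>2 * i ^ 3 - i\<^sup>2
        + (2 + (4 * a * real n - 2 * a * r\<^sup>2) * i - 24 * a\<^sup>2 * r\<^sup>2 * i\<^sup>2) * i\<^sup>2 - i\<^sup>2 = 0" for i
      by (simp add: algebra_simps power2_eq_square power3_eq_cube power4_eq_xxxx)
    have "(real n - 1) / r * q1 r = - 4 * a * (real n - 1) * (1 / D r) ^ 3" using r by (simp add: q1_def)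
    moreover have "r / 2 * q1 r = - 2 * a * r\<^sup>2 * (1 / D r) ^ 3" by (simp add: q1_def power2_eq_square)
    moreover have "q r = (1 / D r)\<^sup>2" by (simp add: q_def power_divide)
    ultimately have "q2 r + (real n - 1) / r * q1 r - r / 2 * q1 r - q r + potential n r * q r - q r = 0"
      unfolding V q2_def using id[of "1 / D r"] by (simp only:)
    then show "q2 r + (real n - 1) / r * q1 r - r / 2 * q1 r - q r + potential n r * q r = q r" by simp
  qed (use qt in auto)
  then show ?A unfolding B .
qed

definition ground :: "'n radL2" where "ground = toH eigfun_g"

lemma ground_nonzero: "ground \<noteq> 0"
proof
  assume "ground = 0"
  then have "AE x in (lborel :: (real ^ 'n) measure). eigfun_g x = 0"
    unfolding ground_def toH_zero[symmetric] using toH_eq_iff[OF eigfun_g_L2rad L2rad_zero] by simp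
  then have "AE x in (lborel :: (real ^ 'n) measure). False"
    by eventually_elim (use q_pos in \<open>simp add: eigfun_g_eq less_imp_neq[symmetric]\<close>)
  then show False by (rule notE[OF not_AE_False])
qed

section \<open>The two quadratic identities on test functions\<close>

text \<open>Only what is needed in the passage to limits is kept: nonnegativity of the form, and the
  excess 16 a b q of C over 1. This excess is why the remaining integral carries q^3, one factor
  more than the weight q^2 inside m.\<close>

lemma gap_inequality:
  fixes f :: "real ^ 'n \<Rightarrow> real"
  assumes f: "f \<in> Cc_rad"
  obtains u u1 where "\<And>r. (u has_real_derivative u1 r) (at r)" "continuous_on UNIV u1"
    "\<And>x. f x = u (norm x) * q (norm x)"
    "integrable lborel (\<lambda>x :: real ^ 'n. (u1 (norm x))\<^sup>2 * q (norm x) ^ 3 * wgt x)"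
    "(toH f - toH (L_fun f)) \<bullet> toH f \<ge> 0"
    "(norm (toH f - toH (L_fun f)))\<^sup>2 \<ge> (toH f - toH (L_fun f)) \<bullet> toH f
       + 16 * a * b * (LINT x|(lborel :: (real ^ 'n) measure). (u1 (norm x))\<^sup>2 * q (norm x) ^ 3 * wgt x)"
proof -
  obtain F F1 F2 R where F: "\<And>x. f x = F (norm x)" "\<And>r. (F has_real_derivative F1 r) (at r)"
    "\<And>r. (F1 has_real_derivative F2 r) (at r)" "continuous_on UNIV F2" "R > 0"
    "\<And>r. \<bar>r\<bar> \<ge> R \<Longrightarrow> F r = 0 \<and> F1 r = 0 \<and> F2 r = 0"
    using Cc_rad_profile[OF f] by blast
  have L: "L_fun f x = F2 (norm x) + (real n - 1) / norm x * F1 (norm x) - norm x / 2 * F1 (norm x)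
      - F (norm x) + potential n (norm x) * F (norm x)" if "x \<noteq> 0" for x
    using L_fun_radial[OF F(1) F(2) F(3) that] by (simp only: n_eq)
  note fL = Cc_rad_L2rad[OF f]
  note [measurable] = L2rad_borel[OF fL(1)] L2rad_borel[OF fL(2)]
  obtain N where N: "n = Suc (Suc (Suc N))" using n_ge by (auto simp: numeral_eq_Suc le_iff_add)
  \<comment> \<open>u = f/g vanishes wherever f does, so no boundary term arises at R.\<close>
  define u where "u r = F r * (D r)\<^sup>2" for r
  define u1 where "u1 r = F1 r * (D r)\<^sup>2 + F r * (4 * a * r * D r)" for r
  define u2 where "u2 r = F2 r * (D r)\<^sup>2 + 2 * F1 r * (4 * a * r * D r) + F r * (4 * a * D r + 8 * a\<^sup>2 * r\<^sup>2)" for r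
  \<comment> \<open>m without its factor r^(n-1); the powers of r are kept apart so that nothing
    singular is differentiated at 0.\<close>
  define M where "M r = exp (- (1/4) * r\<^sup>2) * (q r)\<^sup>2" for r
  define p where "p r = (real n - 1) / r - r / 2 - 8 * a * r / D r" for r
  \<comment> \<open>r p, which unlike p is smooth at r = 0.\<close>
  define P where "P r = (real n - 1) - r\<^sup>2 / 2 - 8 * a * r\<^sup>2 / D r" for r
  define C where "C r = 1 + 16 * a * b * q r" for r
  have du: "(u has_real_derivative u1 r) (at r)" for r
    unfolding u_def[abs_def] u1_def
    by (rule DERIV_cong, rule DERIV_mult'[OF F(2) DERIV_power[OF D_deriv]]) (simp add: algebra_simps)
  have du1: "(u1 has_real_derivative u2 r) (at r)" for r
  proof -
    have "((\<lambda>r. 4 * a * r * D r) has_real_derivative 4 * a * r * (2 * a * r) + 4 * a * D r) (at r)"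
      by (rule DERIV_mult'[OF _ D_deriv]) (auto intro!: derivative_eq_intros)
    from DERIV_add[OF DERIV_mult'[OF F(3) DERIV_power[OF D_deriv, of 2]] DERIV_mult'[OF F(2) this]]
    show ?thesis unfolding u1_def[abs_def]
      by (rule DERIV_cong) (simp add: u2_def power2_eq_square algebra_simps)
  qed
  have dM: "(M has_real_derivative M r * (- (r / 2) - 8 * a * r / D r)) (at r)" for r
  proof -
    have M: "M = (\<lambda>r. exp (- (1/4) * r\<^sup>2) * (1 / D r) ^ 4)"
      by (rule ext) (simp add: M_def q_def power_divide power_mult[symmetric])
    have e: "((\<lambda>r. exp (- (1/4) * r\<^sup>2)) has_real_derivative exp (- (1/4) * r\<^sup>2) * (- (r / 2))) (at r)"
      by (auto intro!: derivative_eq_intros)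
    show ?thesis
      unfolding M
    proof (rule DERIV_cong[OF DERIV_mult'[OF e DERIV_power[OF inverse_D_deriv]]])
      have "x * (real 4 * (- (2 * a * r) * i\<^sup>2 * i ^ (4 - Suc 0))) + x * (- (r / 2)) * i ^ 4 = x * i ^ 4 * (- (r / 2) - 8 * a * r * i)" for x i
        by (simp add: algebra_simps power2_eq_square power3_eq_cube power4_eq_xxxx)
      from this[of "exp (- (1/4) * r\<^sup>2)" "1 / D r"]
      show "exp (- (1/4) * r\<^sup>2) * (real 4 * (- (2 * a * r) * (1 / D r)\<^sup>2 * (1 / D r) ^ (4 - Suc 0))) + exp (- (1/4) * r\<^sup>2) * (- (r / 2)) * (1 / D r) ^ 4
        = exp (- (1/4) * r\<^sup>2) * (1 / D r) ^ 4 * (- (r / 2) - 8 * a * r / D r)"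
        by (simp only: times_divide_eq_right mult_1_right)
    qed
  qed
  have dP: "(P has_real_derivative - C r * r) (at r)" for r
    unfolding P_def[abs_def]
  proof (rule DERIV_cong)
    show "((\<lambda>r. (real n - 1) - r\<^sup>2 / 2 - 8 * a * r\<^sup>2 / D r) has_real_derivative
       0 - r - ((8 * a * (2 * r)) * D r - (8 * a * r\<^sup>2) * (2 * a * r)) / (D r * D r)) (at r)"
      using D_pos[of r] by (auto intro!: derivative_eq_intros D_deriv)
    have "(8 * a * (2 * r)) * D r - (8 * a * r\<^sup>2) * (2 * a * r) = 16 * a * b * r"
      by (simp add: D_def power2_eq_square algebra_simps)
    then show "0 - r - ((8 * a * (2 * r)) * D r - (8 * a * r\<^sup>2) * (2 * a * r)) / (D r * D r) = - C r * r"
      by (simp add: C_def q_def power2_eq_square algebra_simps)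
  qed
  have cont: "continuous_on UNIV u" "continuous_on UNIV u1" "continuous_on UNIV M" "continuous_on UNIV P"
    "continuous_on UNIV u2" "continuous_on UNIV C"
  proof -
    show "continuous_on UNIV u" by (rule DERIV_continuous_on) (rule du)
    show "continuous_on UNIV u1" by (rule DERIV_continuous_on) (rule du1)
    show "continuous_on UNIV M" by (rule DERIV_continuous_on) (rule dM)
    show "continuous_on UNIV P" by (rule DERIV_continuous_on) (rule dP)
    have "continuous_on UNIV F" by (rule DERIV_continuous_on) (rule F(2))
    moreover have "continuous_on UNIV F1" by (rule DERIV_continuous_on) (rule F(3))
    ultimately show "continuous_on UNIV u2"
      unfolding u2_def by (intro continuous_intros D_continuous F(4))
    show "continuous_on UNIV C" unfolding C_def by (intro continuous_intros q_continuous)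
  qed
  note [measurable] = borel_measurable_continuous_onI[OF cont(2)] borel_measurable_continuous_onI[OF cont(5)]
    borel_measurable_continuous_onI[OF cont(6)]
  have rp: "r * p r = P r" if "r > 0" for r
    using that by (simp add: p_def P_def power2_eq_square field_simps)
  have fu: "f x = u (norm x) * q (norm x)" for x
    using D_pos by (simp add: F(1) u_def q_def)
  have Lu: "L_fun f x - f x = q (norm x) * (u2 (norm x) + p (norm x) * u1 (norm x))" if x: "x \<noteq> 0" for x
  proof -
    define r where "r = norm x"
    have r: "r > 0" using x by (simp add: r_def)
    have "F2 r + (real n - 1) * (1 / r) * F1 r - r / 2 * F1 r - F r
        + (2 + (4 * a * (real n - 1 + 1) - 4 * a * r * (r / 2)) * (1 / D r) - 24 * a\<^sup>2 * r\<^sup>2 * (1 / D r)\<^sup>2) * F r - F r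
      = (1 / D r)\<^sup>2 * (u2 r + ((real n - 1) * (1 / r) - r / 2 - 8 * a * r * (1 / D r)) * u1 r)"
      unfolding u2_def u1_def
      by (rule ground_state_identity) (use r D_pos[of r] in auto)
    moreover have "potential n r = 2 + (4 * a * (real n - 1 + 1) - 4 * a * r * (r / 2)) * (1 / D r) - 24 * a\<^sup>2 * r\<^sup>2 * (1 / D r)\<^sup>2"
      unfolding potential_eq by (simp add: power2_eq_square)
    ultimately show ?thesis
      using L[OF x] by (simp add: F(1) r_def[symmetric] p_def q_def power_divide)
  qed
  have out: "F (norm x) = 0" "u1 (norm x) = 0" "u2 (norm x) = 0" "u (norm x) = 0" "L_fun f x = 0" if "norm x > R" for x :: "real ^ 'n"
  proof -
    have "\<bar>norm x\<bar> \<ge> R" "x \<noteq> 0" using that F(5) by auto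
    from F(6)[OF this(1)] L[OF this(2)]
    show "F (norm x) = 0" "u1 (norm x) = 0" "u2 (norm x) = 0" "u (norm x) = 0" "L_fun f x = 0"
      by (simp_all add: u1_def u2_def u_def)
  qed
  have R0: "u1 R = 0" "u R = 0" using F(5) F(6)[of R] by (simp_all add: u1_def u_def)
  have Mx: "M (norm x) = (q (norm x))\<^sup>2 * wgt x" for x :: "real ^ 'n"
    by (simp add: M_def wgt_eq)
  have sub: "s * (- (r / 2) - 8 * a * r / D r) * r = s * (P r - real (Suc (Suc N)))" for s r
    by (simp add: P_def N power2_eq_square algebra_simps)

  \<comment> \<open>First identity: \<open>G1\<close> is -m u u', with derivative -(u'' + p u') u m
    - u'^2 m because m' = p m.\<close>
  define \<phi>1 where "\<phi>1 x = (f x - L_fun f x) * f x * wgt x - (u1 (norm x))\<^sup>2 * ((q (norm x))\<^sup>2 * wgt x)" for x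
  define G1 where "G1 r = - (r ^ Suc (Suc N) * (M r * (u1 r * u r)))" for r
  define G1' where "G1' r = - (r ^ Suc (Suc N) * (M r * (u1 r * u1 r + u2 r * u r) + M r * (- (r / 2) - 8 * a * r / D r) * (u1 r * u r))
     + real (Suc (Suc N)) * r ^ Suc N * (M r * (u1 r * u r)))" for r
  have I1: "integrable lborel \<phi>1 \<and> (LINT x|lborel. \<phi>1 x) = 0"
  proof -
    have d: "(G1 has_real_derivative G1' r) (at r)" for r
      unfolding G1_def G1'_def
    proof (intro DERIV_minus DERIV_mult' du du1 dM)
      show "((\<lambda>r. r ^ Suc (Suc N)) has_real_derivative real (Suc (Suc N)) * r ^ Suc N) (at r)"
        using DERIV_pow[of "Suc (Suc N)" r] by simp
    qed
    have c: "continuous_on UNIV G1'"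
      unfolding G1'_def
      by (intro continuous_on_add continuous_on_diff continuous_on_mult continuous_on_power
          continuous_on_const continuous_on_id continuous_on_divide continuous_on_minus cont D_continuous) (use D_pos in simp_all)
    have m: "\<phi>1 \<in> borel_measurable borel" unfolding \<phi>1_def[abs_def] by measurable
    have e: "\<phi>1 x * norm x ^ (CARD('n) - 1) = G1' (norm x)" if "x \<noteq> 0" for x
    proof -
      define r where "r = norm x"
      have r: "r > 0" using that by (simp add: r_def)
      have ph: "\<phi>1 x = - (u2 r + p r * u1 r) * u r * M r - (u1 r)\<^sup>2 * M r"
        using Lu[OF that] fu[of x]
        by (simp add: \<phi>1_def r_def[symmetric] Mx[of x, folded r_def] power2_eq_square algebra_simps)
      have "\<phi>1 x * r ^ Suc (Suc N) = r ^ Suc N * (- (r * u2 r + (r * p r) * u1 r) * u r * M r - r * (u1 r)\<^sup>2 * M r)"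
        unfolding ph by (simp add: algebra_simps)
      also have "\<dots> = r ^ Suc N * (- (r * u2 r + P r * u1 r) * u r * M r - r * (u1 r)\<^sup>2 * M r)"
        by (simp only: rp[OF r])
      also have "\<dots> = - (r ^ Suc N * (r * (M r * (u1 r * u1 r + u2 r * u r)) + M r * (P r - real (Suc (Suc N))) * (u1 r * u r))
         + real (Suc (Suc N)) * r ^ Suc N * (M r * (u1 r * u r)))"
        by (simp add: power2_eq_square algebra_simps)
      also have "\<dots> = G1' r"
        unfolding G1'_def sub[of "M r" r, symmetric] by (simp add: algebra_simps)
      finally show ?thesis by (simp add: r_def n_eq N)
    qed
    have o: "\<phi>1 x = 0" if "norm x > R" for x
      using out[OF that] by (simp add: \<phi>1_def F(1))
    have z: "G1 0 = 0" "G1 R = 0" using R0 by (simp_all add: G1_def)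
    show ?thesis
      using radial_FTC[OF d c z(1) F(5) z(2) m e o] by simp
  qed

  \<comment> \<open>Second identity: \<open>G2\<close> is m (p + 1/r) u'^2, written with r^(n-2) (P
    + 1) so that it vanishes at 0 without any division.\<close>
  define \<phi>2 where "\<phi>2 x = (f x - L_fun f x) * (f x - L_fun f x) * wgt x
    - (((u2 (norm x) - 1 / norm x * u1 (norm x))\<^sup>2 + C (norm x) * (u1 (norm x))\<^sup>2) * ((q (norm x))\<^sup>2 * wgt x))" for x
  define G2 where "G2 r = r ^ Suc N * (M r * ((P r + 1) * (u1 r * u1 r)))" for r
  define G2' where "G2' r = r ^ Suc N * (M r * ((P r + 1) * (u1 r * u2 r + u2 r * u1 r) + (- C r * r) * (u1 r * u1 r))
       + M r * (- (r / 2) - 8 * a * r / D r) * ((P r + 1) * (u1 r * u1 r)))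
     + real (Suc N) * r ^ N * (M r * ((P r + 1) * (u1 r * u1 r)))" for r
  have I2: "integrable lborel \<phi>2 \<and> (LINT x|lborel. \<phi>2 x) = 0"
  proof -
    have d: "(G2 has_real_derivative G2' r) (at r)" for r
      unfolding G2_def G2'_def
    proof (intro DERIV_mult' du1 dM)
      show "((\<lambda>r. r ^ Suc N) has_real_derivative real (Suc N) * r ^ N) (at r)"
        using DERIV_pow[of "Suc N" r] by simp
      show "((\<lambda>r. P r + 1) has_real_derivative - C r * r) (at r)"
        using DERIV_add[OF dP DERIV_const[of 1]] by simp
    qed
    have c: "continuous_on UNIV G2'"
      unfolding G2'_def
      by (intro continuous_on_add continuous_on_diff continuous_on_mult continuous_on_power
          continuous_on_const continuous_on_id continuous_on_divide continuous_on_minus cont D_continuous) (use D_pos in simp_all)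
    have m: "\<phi>2 \<in> borel_measurable borel" unfolding \<phi>2_def[abs_def] by measurable
    have e: "\<phi>2 x * norm x ^ (CARD('n) - 1) = G2' (norm x)" if "x \<noteq> 0" for x
    proof -
      define r where "r = norm x"
      have r: "r > 0" using that by (simp add: r_def)
      have h: "f x - L_fun f x = - (q r * (u2 r + p r * u1 r))"
        using Lu[OF that] by (simp add: r_def[symmetric])
      have ph: "\<phi>2 x = M r * ((u2 r + p r * u1 r)\<^sup>2 - ((u2 r - 1 / r * u1 r)\<^sup>2 + C r * (u1 r)\<^sup>2))"
        unfolding \<phi>2_def h Mx[symmetric] r_def[symmetric]
        using Mx[of x, folded r_def] by (simp add: power2_eq_square algebra_simps)
      have "\<phi>2 x * r ^ Suc (Suc N) = r ^ N * M r * (r\<^sup>2 * ((u2 r + p r * u1 r)\<^sup>2 - ((u2 r - 1 / r * u1 r)\<^sup>2 + C r * (u1 r)\<^sup>2)))"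
        unfolding ph by (simp add: power2_eq_square)
      also have "r\<^sup>2 * ((u2 r + p r * u1 r)\<^sup>2 - ((u2 r - 1 / r * u1 r)\<^sup>2 + C r * (u1 r)\<^sup>2))
        = real (Suc N) * (P r + 1) * (u1 r)\<^sup>2 + (P r - real (Suc N) - 1) * (P r + 1) * (u1 r)\<^sup>2 - C r * r\<^sup>2 * (u1 r)\<^sup>2 + 2 * r * (P r + 1) * u1 r * u2 r"
        by (rule gap_identity) (use r rp[OF r] in auto)
      also have "r ^ N * M r * \<dots> = r ^ N * (r * (M r * ((P r + 1) * (u1 r * u2 r + u2 r * u1 r) + (- C r * r) * (u1 r * u1 r)))
         + M r * (P r - real (Suc (Suc N))) * ((P r + 1) * (u1 r * u1 r)))
        + real (Suc N) * r ^ N * (M r * ((P r + 1) * (u1 r * u1 r)))"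
        by (simp add: power2_eq_square algebra_simps)
      also have "\<dots> = G2' r"
        unfolding G2'_def sub[of "M r" r, symmetric] by (simp add: algebra_simps)
      finally show ?thesis by (simp add: r_def n_eq N)
    qed
    have o: "\<phi>2 x = 0" if "norm x > R" for x
      using out[OF that] by (simp add: \<phi>2_def F(1))
    have z: "G2 0 = 0" "G2 R = 0" using R0 by (simp_all add: G2_def)
    show ?thesis
      using radial_FTC[OF d c z(1) F(5) z(2) m e o] by simp
  qed

  define h where "h x = f x - L_fun f x" for x
  have hL: "h \<in> L2rad" unfolding h_def[abs_def] by (rule L2rad_minus[OF fL])
  have th: "toH f - toH (L_fun f) = toH h" unfolding h_def[abs_def] by (rule toH_diff[OF fL, symmetric])
  define j1 where "j1 x = (u1 (norm x))\<^sup>2 * ((q (norm x))\<^sup>2 * wgt x)" for x :: "real ^ 'n"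
  define j2 where "j2 x = ((u2 (norm x) - 1 / norm x * u1 (norm x))\<^sup>2 + C (norm x) * (u1 (norm x))\<^sup>2) * ((q (norm x))\<^sup>2 * wgt x)" for x :: "real ^ 'n"
  define j3 where "j3 x = (u1 (norm x))\<^sup>2 * q (norm x) ^ 3 * wgt x" for x :: "real ^ 'n"
  have ihf: "integrable lborel (\<lambda>x. h x * f x * wgt x)" by (rule L2rad_mult_integrable[OF hL fL(1)])
  have ihh: "integrable lborel (\<lambda>x. h x * h x * wgt x)" by (rule L2rad_mult_integrable[OF hL hL])
  have j1i: "integrable lborel j1"
    using Bochner_Integration.integrable_diff[OF ihf conjunct1[OF I1]] by (simp add: \<phi>1_def h_def j1_def[abs_def])
  have j1v: "(LINT x|lborel. j1 x) = toH h \<bullet> toH f"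
  proof -
    have "j1 = (\<lambda>x. h x * f x * wgt x - \<phi>1 x)" by (rule ext) (simp add: \<phi>1_def h_def j1_def)
    then show ?thesis using I1 ihf by (simp add: inner_toH hL fL)
  qed
  have j2i: "integrable lborel j2"
    using Bochner_Integration.integrable_diff[OF ihh conjunct1[OF I2]] by (simp add: \<phi>2_def h_def j2_def[abs_def])
  have j2v: "(LINT x|lborel. j2 x) = (norm (toH h))\<^sup>2"
  proof -
    have "j2 = (\<lambda>x. h x * h x * wgt x - \<phi>2 x)" by (rule ext) (simp add: \<phi>2_def h_def j2_def)
    then show ?thesis using I2 ihh by (simp add: power2_norm_eq_inner inner_toH hL)
  qed
  have q_le: "q r \<le> 1 / b\<^sup>2" for r
    using D_ge(1)[of r] b_pos unfolding q_def by (intro divide_left_mono power_mono mult_pos_pos) (auto simp: D_pos)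
  have j3i: "integrable lborel j3"
  proof (rule Bochner_Integration.integrable_bound[OF integrable_mult_right[OF j1i, of "1 / b\<^sup>2"]])
    show "AE x in lborel. norm (j3 x) \<le> norm (1 / b\<^sup>2 * j1 x)"
    proof (rule AE_I2)
      fix x
      have eq: "j3 x = q (norm x) * j1 x" by (simp add: j3_def j1_def power2_eq_square power3_eq_cube)
      have "j1 x \<ge> 0" using wgt_pos[of x] by (simp add: j1_def)
      then show "norm (j3 x) \<le> norm (1 / b\<^sup>2 * j1 x)"
        unfolding eq using mult_right_mono[OF q_le[of "norm x"] \<open>j1 x \<ge> 0\<close>] q_pos[of "norm x"] by (simp add: abs_mult)
    qed
    show "j3 \<in> borel_measurable lborel" unfolding j3_def[abs_def] by measurable
  qed
  \<comment> \<open>The square of u'' - u'/r is dropped; the rest of \<open>j2\<close> is exactly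
    \<open>j1\<close> plus the excess.\<close>
  have "(LINT x|lborel. j1 x + 16 * a * b * j3 x) \<le> (LINT x|lborel. j2 x)"
  proof (rule integral_mono)
    show "integrable lborel (\<lambda>x. j1 x + 16 * a * b * j3 x)"
      by (intro Bochner_Integration.integrable_add j1i integrable_mult_right j3i)
    show "j1 x + 16 * a * b * j3 x \<le> j2 x" for x
    proof -
      have "j2 x = (u2 (norm x) - 1 / norm x * u1 (norm x))\<^sup>2 * ((q (norm x))\<^sup>2 * wgt x) + (j1 x + 16 * a * b * j3 x)"
        by (simp add: j1_def j2_def j3_def C_def power2_eq_square power3_eq_cube algebra_simps)
      moreover have "0 \<le> (u2 (norm x) - 1 / norm x * u1 (norm x))\<^sup>2 * ((q (norm x))\<^sup>2 * wgt x)"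
        using wgt_pos[of x] by simp
      ultimately show ?thesis by linarith
    qed
  qed (rule j2i)
  then have main: "(norm (toH h))\<^sup>2 \<ge> toH h \<bullet> toH f + 16 * a * b * (LINT x|lborel. j3 x)"
    using j1i j3i by (simp add: j1v j2v)
  have pos: "toH h \<bullet> toH f \<ge> 0"
    unfolding j1v[symmetric] by (rule integral_nonneg_AE) (auto simp: j1_def wgt_def)
  show thesis
    by (rule that[OF du cont(2) fu]) (use main pos j3i in \<open>simp_all add: th j3_def[abs_def]\<close>)
qed

end

section \<open>Eigenvectors and the main theorem\<close>

text \<open>Cauchy-Schwarz, obtained by integrating the square of u' minus its mean slope
  \<open>m\<close>.\<close>

lemma increment_square_le:
  fixes u u1 :: "real \<Rightarrow> real"
  assumes du: "\<And>r. (u has_real_derivative u1 r) (at r)" and c: "continuous_on UNIV u1" and "\<alpha> < \<beta>"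
  shows "(u \<beta> - u \<alpha>)\<^sup>2 \<le> (\<beta> - \<alpha>) * (LINT r|lborel. (u1 r)\<^sup>2 * indicator {\<alpha>..\<beta>} r)"
    and "integrable lborel (\<lambda>r. (u1 r)\<^sup>2 * indicator {\<alpha>..\<beta>} r)"
proof -
  have cc: "isCont g x" if "continuous_on UNIV g" for g :: "real \<Rightarrow> real" and x
    using that by (simp add: continuous_on_eq_continuous_at)
  have i1: "has_bochner_integral lborel (\<lambda>r. u1 r * indicator {\<alpha>..\<beta>} r) (u \<beta> - u \<alpha>)"
    by (rule has_bochner_integral_FTC_Icc_real) (use assms cc in auto)
  have i0: "has_bochner_integral lborel (\<lambda>r. 1 * indicator {\<alpha>..\<beta>} r) (\<beta> - \<alpha>)"
    by (rule has_bochner_integral_FTC_Icc_real[where F="\<lambda>r. r"]) (use assms in \<open>auto intro!: derivative_eq_intros\<close>)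
  have "set_integrable lborel {\<alpha>..\<beta>} (\<lambda>r. (u1 r)\<^sup>2)"
    by (intro borel_integrable_compact[of "{\<alpha>..\<beta>}" "\<lambda>r. (u1 r)\<^sup>2", folded set_integrable_def] continuous_intros continuous_on_subset[OF c]) auto
  then show i2: "integrable lborel (\<lambda>r. (u1 r)\<^sup>2 * indicator {\<alpha>..\<beta>} r)"
    by (simp add: set_integrable_def mult.commute)
  define m where "m = (u \<beta> - u \<alpha>) / (\<beta> - \<alpha>)"
  have "0 \<le> (LINT r|lborel. (u1 r - m)\<^sup>2 * indicator {\<alpha>..\<beta>} r)"
    by (intro integral_nonneg_AE) (auto simp: indicator_def)
  also have "\<dots> = (LINT r|lborel. (u1 r)\<^sup>2 * indicator {\<alpha>..\<beta>} r - 2 * m * (u1 r * indicator {\<alpha>..\<beta>} r) + m\<^sup>2 * (1 * indicator {\<alpha>..\<beta>} r))"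
    by (intro Bochner_Integration.integral_cong) (auto simp: indicator_def power2_eq_square algebra_simps)
  also have "\<dots> = (LINT r|lborel. (u1 r)\<^sup>2 * indicator {\<alpha>..\<beta>} r) - 2 * m * (u \<beta> - u \<alpha>) + m\<^sup>2 * (\<beta> - \<alpha>)"
  proof (rule has_bochner_integral_integral_eq)
    show "has_bochner_integral lborel (\<lambda>r. (u1 r)\<^sup>2 * indicator {\<alpha>..\<beta>} r - 2 * m * (u1 r * indicator {\<alpha>..\<beta>} r) + m\<^sup>2 * (1 * indicator {\<alpha>..\<beta>} r))
      ((LINT r|lborel. (u1 r)\<^sup>2 * indicator {\<alpha>..\<beta>} r) - 2 * m * (u \<beta> - u \<alpha>) + m\<^sup>2 * (\<beta> - \<alpha>))"
      by (intro has_bochner_integral_add has_bochner_integral_diff has_bochner_integral_mult_right i1 i0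
          has_bochner_integral_integrable i2)
  qed
  also have "\<dots> = (LINT r|lborel. (u1 r)\<^sup>2 * indicator {\<alpha>..\<beta>} r) - (u \<beta> - u \<alpha>)\<^sup>2 / (\<beta> - \<alpha>)"
  proof -
    have "m * (\<beta> - \<alpha>) = u \<beta> - u \<alpha>" using assms(3) by (simp add: m_def)
    then have "m\<^sup>2 * (\<beta> - \<alpha>) = m * (u \<beta> - u \<alpha>)" by (simp only: power2_eq_square mult.assoc)
    moreover have "(u \<beta> - u \<alpha>)\<^sup>2 / (\<beta> - \<alpha>) = m * (u \<beta> - u \<alpha>)" by (simp add: m_def power2_eq_square)
    ultimately show ?thesis by simp
  qed
  finally have "(u \<beta> - u \<alpha>)\<^sup>2 / (\<beta> - \<alpha>) \<le> (LINT r|lborel. (u1 r)\<^sup>2 * indicator {\<alpha>..\<beta>} r)" by simp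
  then show "(u \<beta> - u \<alpha>)\<^sup>2 \<le> (\<beta> - \<alpha>) * (LINT r|lborel. (u1 r)\<^sup>2 * indicator {\<alpha>..\<beta>} r)"
    using assms(3) by (simp add: field_simps)
qed

context weight_coeffs
begin

text \<open>On a compact interval away from the origin the radial density of the energy has a
  positive minimum, so the increment of u is controlled with a constant that does not depend on
  u.\<close>

lemma local_energy_bound:
  assumes "0 < \<alpha>" "\<alpha> < \<beta>"
  obtains K where "K \<ge> 0" "\<And>u u1. (\<And>r. (u has_real_derivative u1 r) (at r)) \<Longrightarrow> continuous_on UNIV u1 \<Longrightarrow>
    integrable lborel (\<lambda>x :: real ^ 'n. (u1 (norm x))\<^sup>2 * q (norm x) ^ 3 * wgt x) \<Longrightarrow>
    (u \<beta> - u \<alpha>)\<^sup>2 \<le> K * (LINT x|(lborel :: (real ^ 'n) measure). (u1 (norm x))\<^sup>2 * q (norm x) ^ 3 * wgt x)"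
proof -
  define k where "k = real n * unit_ball_vol (real n)"
  define W where "W r = k * r ^ (n - 1) * (q r ^ 3 * exp (- (1/4) * r\<^sup>2))" for r
  have k: "k > 0" unfolding k_def using n_ge unit_ball_vol_pos[of "real n"] by simp
  have cW: "continuous_on {\<alpha>..\<beta>} W" unfolding W_def by (intro continuous_intros q_continuous)
  obtain r0 where r0: "r0 \<in> {\<alpha>..\<beta>}" "\<And>r. r \<in> {\<alpha>..\<beta>} \<Longrightarrow> W r0 \<le> W r"
    using continuous_attains_inf[OF _ _ cW] assms by auto
  have w: "W r0 > 0" using r0(1) assms k q_pos[of r0] by (simp add: W_def)
  show thesis
  proof (rule that[of "(\<beta> - \<alpha>) / W r0"])
    show "(\<beta> - \<alpha>) / W r0 \<ge> 0" using w assms by simp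
    fix u u1 :: "real \<Rightarrow> real"
    assume du: "\<And>r. (u has_real_derivative u1 r) (at r)" and c: "continuous_on UNIV u1"
      and int: "integrable lborel (\<lambda>x :: real ^ 'n. (u1 (norm x))\<^sup>2 * q (norm x) ^ 3 * wgt x)"
    note [measurable] = borel_measurable_continuous_onI[OF c]
    define j where "j r = (u1 r)\<^sup>2 * q r ^ 3 * exp (- (1/4) * r\<^sup>2)" for r
    have [measurable]: "j \<in> borel_measurable borel" unfolding j_def[abs_def] by measurable
    have je: "(\<lambda>x :: real ^ 'n. (u1 (norm x))\<^sup>2 * q (norm x) ^ 3 * wgt x) = (\<lambda>x. j (norm x))"
      by (rule ext) (simp add: j_def wgt_eq)
    have "integrable lborel (\<lambda>r. radial_density n r * j r)"
      using int unfolding je by (subst (asm) integral_norm_lborel(2)) (simp_all add: n_eq)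
    have "W r0 * (LINT r|lborel. (u1 r)\<^sup>2 * indicator {\<alpha>..\<beta>} r) = (LINT r|lborel. W r0 * ((u1 r)\<^sup>2 * indicator {\<alpha>..\<beta>} r))"
      by simp
    also have "\<dots> \<le> (LINT r|lborel. radial_density n r * j r)"
    proof (rule integral_mono)
      show "integrable lborel (\<lambda>r. W r0 * ((u1 r)\<^sup>2 * indicator {\<alpha>..\<beta>} r))"
        by (intro integrable_mult_right increment_square_le(2)[OF du c assms(2)])
      fix r
      have nn: "0 \<le> radial_density n r * j r"
        using q_pos[of r] by (auto simp: j_def intro!: mult_nonneg_nonneg)
      show "W r0 * ((u1 r)\<^sup>2 * indicator {\<alpha>..\<beta>} r) \<le> radial_density n r * j r"
      proof (cases "r \<in> {\<alpha>..\<beta>}")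
        case True
        then have "W r0 * (u1 r)\<^sup>2 \<le> W r * (u1 r)\<^sup>2" using r0(2) by (intro mult_right_mono) auto
        also have "\<dots> = radial_density n r * j r"
          using True assms by (simp add: W_def radial_density_def j_def k_def)
        finally show ?thesis using True by simp
      qed (use nn in simp)
    qed fact
    also have "\<dots> = (LINT x|(lborel :: (real ^ 'n) measure). (u1 (norm x))\<^sup>2 * q (norm x) ^ 3 * wgt x)"
      unfolding je by (subst integral_norm_lborel(1)) (simp_all add: n_eq)
    finally have "(LINT r|lborel. (u1 r)\<^sup>2 * indicator {\<alpha>..\<beta>} r) \<le>
      (LINT x|(lborel :: (real ^ 'n) measure). (u1 (norm x))\<^sup>2 * q (norm x) ^ 3 * wgt x) / W r0"
      using w by (simp add: pos_le_divide_eq mult.commute)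
    then have "(\<beta> - \<alpha>) * (LINT r|lborel. (u1 r)\<^sup>2 * indicator {\<alpha>..\<beta>} r) \<le>
      (\<beta> - \<alpha>) * ((LINT x|(lborel :: (real ^ 'n) measure). (u1 (norm x))\<^sup>2 * q (norm x) ^ 3 * wgt x) / W r0)"
      using assms by (intro mult_left_mono) auto
    with increment_square_le(1)[OF du c assms(2)]
    show "(u \<beta> - u \<alpha>)\<^sup>2 \<le> (\<beta> - \<alpha>) / W r0 * (LINT x|(lborel :: (real ^ 'n) measure). (u1 (norm x))\<^sup>2 * q (norm x) ^ 3 * wgt x)"
      by simp
  qed
qed

lemma closure_sequence:
  fixes x y :: "'n radL2"
  assumes "(x, y) \<in> closure L_op"
  obtains f where "\<And>k. f k \<in> Cc_rad" "(\<lambda>k. toH (f k)) \<longlonglongrightarrow> x" "(\<lambda>k. toH (L_fun (f k))) \<longlonglongrightarrow> y"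
proof -
  obtain z where z: "\<And>k. z k \<in> L_op" "z \<longlonglongrightarrow> (x, y)"
    using assms unfolding closure_sequential by blast
  have "\<forall>k. \<exists>f. f \<in> Cc_rad \<and> z k = (toH f, toH (L_fun f))" using z(1) unfolding L_op_def by blast
  then obtain f where f: "\<And>k. f k \<in> Cc_rad" "\<And>k. z k = (toH (f k), toH (L_fun (f k)))" by metis
  show thesis
    using that[OF f(1)] tendsto_fst[OF z(2)] tendsto_snd[OF z(2)] by (simp add: f(2))
qed

text \<open>Vanishing energy makes the increments of \<open>u k\<close> between any two positive
  radii tend to 0, and an almost everywhere convergent subsequence fixes the value at one radius.
  Hence \<open>u k\<close> tends to a constant along that subsequence, and the eigenvector is this
  constant times g.\<close>

lemma eigenvector_in_span:
  assumes e: "(e, \<mu> *\<^sub>R e) \<in> closure L_op" and \<mu>: "0 \<le> \<mu>" "\<mu> \<le> 1"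
  obtains c where "e = c *\<^sub>R ground"
proof -
  obtain f where f: "\<And>k. f k \<in> Cc_rad" "(\<lambda>k. toH (f k)) \<longlonglongrightarrow> e" "(\<lambda>k. toH (L_fun (f k))) \<longlonglongrightarrow> \<mu> *\<^sub>R e"
    using closure_sequence[OF e] by blast
  define J where "J u1 = (LINT x|(lborel :: (real ^ 'n) measure). (u1 (norm x))\<^sup>2 * q (norm x) ^ 3 * wgt x)" for u1 :: "real \<Rightarrow> real"
  define h where "h k = toH (f k) - toH (L_fun (f k))" for k
  \<comment> \<open>The function and its derivative are packed into one pair, so that a single
    choice yields both sequences.\<close>
  define Q where "Q k p \<longleftrightarrow> (\<forall>r. (fst p has_real_derivative snd p r) (at r)) \<and> continuous_on UNIV (snd p)
     \<and> (\<forall>x. f k x = fst p (norm x) * q (norm x))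
     \<and> integrable lborel (\<lambda>x :: real ^ 'n. (snd p (norm x))\<^sup>2 * q (norm x) ^ 3 * wgt x)
     \<and> 16 * a * b * J (snd p) \<le> (norm (h k))\<^sup>2 - h k \<bullet> toH (f k)" for k and p :: "(real \<Rightarrow> real) \<times> (real \<Rightarrow> real)"
  have "\<exists>p. Q k p" for k
  proof (rule gap_inequality[OF f(1)[of k]], goal_cases)
    case (1 u u1)
    then have "Q k (u, u1)" by (simp add: Q_def J_def h_def)
    then show ?case by blast
  qed
  then obtain p where p: "\<And>k. Q k (p k)" by metis
  define u where "u k = fst (p k)" for k
  define u1 where "u1 k = snd (p k)" for k
  have u: "(u k has_real_derivative u1 k r) (at r)" "continuous_on UNIV (u1 k)"
    "f k x = u k (norm x) * q (norm x)"
    "integrable lborel (\<lambda>x :: real ^ 'n. (u1 k (norm x))\<^sup>2 * q (norm x) ^ 3 * wgt x)"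
    "16 * a * b * J (u1 k) \<le> (norm (h k))\<^sup>2 - h k \<bullet> toH (f k)" for k r x
    using p[of k] unfolding Q_def u_def u1_def by blast+
  have J0: "J (u1 k) \<ge> 0" for k
    unfolding J_def using q_pos by (intro integral_nonneg_AE) (auto simp: wgt_def less_imp_le)
  have hl: "h \<longlonglongrightarrow> e - \<mu> *\<^sub>R e" unfolding h_def by (intro tendsto_intros f)
  \<comment> \<open>The limit is -\<mu> (1 - \<mu>) |e|^2, not positive for \<mu> in [0, 1], while
    each member of the sequence dominates a nonnegative energy. The limit is therefore 0, and the
    energies tend to 0 with it.\<close>
  have "(\<lambda>k. (norm (h k))\<^sup>2 - h k \<bullet> toH (f k)) \<longlonglongrightarrow> (norm (e - \<mu> *\<^sub>R e))\<^sup>2 - (e - \<mu> *\<^sub>R e) \<bullet> e"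
    by (intro tendsto_intros hl f)
  also have "(norm (e - \<mu> *\<^sub>R e))\<^sup>2 - (e - \<mu> *\<^sub>R e) \<bullet> e = - \<mu> * (1 - \<mu>) * (e \<bullet> e)"
    by (simp add: power2_norm_eq_inner inner_diff_left inner_diff_right algebra_simps)
  finally have lim: "(\<lambda>k. (norm (h k))\<^sup>2 - h k \<bullet> toH (f k)) \<longlonglongrightarrow> - \<mu> * (1 - \<mu>) * (e \<bullet> e)" .
  have "0 \<le> - \<mu> * (1 - \<mu>) * (e \<bullet> e)"
  proof (rule LIMSEQ_le_const[OF lim], intro exI allI impI)
    show "0 \<le> (norm (h k))\<^sup>2 - h k \<bullet> toH (f k)" for k
      using u(5)[of k] mult_nonneg_nonneg[OF _ J0[of k], of "16 * a * b"] a_pos b_pos by simp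
  qed
  moreover have "0 \<le> \<mu> * (1 - \<mu>) * (e \<bullet> e)" using \<mu> by simp
  ultimately have "- \<mu> * (1 - \<mu>) * (e \<bullet> e) = 0" by simp
  with lim have lim0: "(\<lambda>k. (norm (h k))\<^sup>2 - h k \<bullet> toH (f k)) \<longlonglongrightarrow> 0" by (simp only:)
  have "(\<lambda>k. 16 * a * b * J (u1 k)) \<longlonglongrightarrow> 0"
    by (rule tendsto_sandwich[OF _ _ tendsto_const lim0]) (use u(5) J0 a_pos b_pos in auto)
  from tendsto_mult[OF tendsto_const[of "1 / (16 * a * b)"] this]
  have Jlim: "(\<lambda>k. J (u1 k)) \<longlonglongrightarrow> 0" using a_pos b_pos by simp
  have flat: "(\<lambda>k. u k \<beta> - u k \<alpha>) \<longlonglongrightarrow> 0" if ab: "0 < \<alpha>" "\<alpha> < \<beta>" for \<alpha> \<beta>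
  proof -
    have "\<exists>K. \<forall>k. (u k \<beta> - u k \<alpha>)\<^sup>2 \<le> K * J (u1 k)"
    proof (rule local_energy_bound[OF ab], goal_cases)
      case (1 K)
      then show ?case
        by (intro exI[of _ K] allI) (unfold J_def, rule 1(2)[OF u(1) u(2) u(4)])
    qed
    then obtain K where K: "\<And>k. (u k \<beta> - u k \<alpha>)\<^sup>2 \<le> K * J (u1 k)" by blast
    have "(\<lambda>k. (u k \<beta> - u k \<alpha>)\<^sup>2) \<longlonglongrightarrow> 0"
    proof (rule tendsto_sandwich[OF _ _ tendsto_const])
      show "(\<lambda>k. K * J (u1 k)) \<longlonglongrightarrow> 0" using tendsto_mult[OF tendsto_const Jlim, of K] by simp
    qed (use K in auto)
    from tendsto_real_sqrt[OF this] show ?thesis by (simp add: tendsto_rabs_zero_iff)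
  qed
  have flat2: "(\<lambda>k. u k s - u k r) \<longlonglongrightarrow> 0" if "0 < r" "0 < s" for r s
  proof -
    consider "r < s" | "s < r" | "r = s" by linarith
    then show ?thesis
    proof cases
      case 2
      from tendsto_minus[OF flat[OF that(2) 2]] show ?thesis by simp
    qed (use flat that in auto)
  qed
  obtain w where w: "w \<in> L2rad" "e = toH w" using toH_ex by blast
  obtain \<rho> where \<rho>: "strict_mono (\<rho> :: nat \<Rightarrow> nat)" "AE x in lborel. (\<lambda>k. f (\<rho> k) x) \<longlonglongrightarrow> w x"
    by (rule toH_AE_subseq[OF Cc_rad_L2rad(1)[OF f(1)] w(1) f(2)[unfolded w(2)]])
  have "AE x in lborel. (x :: real ^ 'n) \<noteq> 0" by (rule AE_lborel_singleton)
  with \<rho>(2) have AE: "AE x in lborel. x \<noteq> 0 \<and> (\<lambda>k. f (\<rho> k) x) \<longlonglongrightarrow> w x" by eventually_elim simp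
  have "\<exists>x. x \<noteq> 0 \<and> (\<lambda>k. f (\<rho> k) x) \<longlonglongrightarrow> w x"
  proof (rule ccontr)
    assume nex: "\<not> ?thesis"
    from AE have "AE x in (lborel :: (real ^ 'n) measure). False"
      by eventually_elim (use nex in blast)
    then show False by (rule notE[OF not_AE_False])
  qed
  then obtain x0 where x0: "x0 \<noteq> 0" "(\<lambda>k. f (\<rho> k) x0) \<longlonglongrightarrow> w x0" by blast
  \<comment> \<open>One point of convergence off the origin determines the constant; flatness
    transports it to all other radii.\<close>
  define c where "c = w x0 / q (norm x0)"
  have "(\<lambda>k. f (\<rho> k) x0 / q (norm x0)) \<longlonglongrightarrow> c"
    unfolding c_def by (intro tendsto_divide x0(2) tendsto_const) (use q_pos[of "norm x0"] in simp)
  then have ux0: "(\<lambda>k. u (\<rho> k) (norm x0)) \<longlonglongrightarrow> c"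
    using q_pos[of "norm x0"] by (simp add: u(3))
  have "AE x in lborel. w x = c * eigfun_g x"
    using AE
  proof eventually_elim
    case (elim x)
    have "(\<lambda>k. u (\<rho> k) (norm x) - u (\<rho> k) (norm x0)) \<longlonglongrightarrow> 0"
      using LIMSEQ_subseq_LIMSEQ[OF flat2[of "norm x0" "norm x"] \<rho>(1)] elim x0(1) by (simp add: o_def)
    from tendsto_add[OF this ux0] have "(\<lambda>k. u (\<rho> k) (norm x)) \<longlonglongrightarrow> c" by simp
    then have lim_x: "(\<lambda>k. f (\<rho> k) x) \<longlonglongrightarrow> c * q (norm x)"
      unfolding u(3) by (intro tendsto_intros)
    have "w x = c * q (norm x)" by (rule LIMSEQ_unique[OF conjunct2[OF elim] lim_x])
    then show ?case by (simp add: eigfun_g_eq)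
  qed
  then have "e = toH (\<lambda>x. c * eigfun_g x)"
    using toH_eq_iff[OF w(1) L2rad_scale[OF eigfun_g_L2rad]] w(2) by simp
  then have "e = c *\<^sub>R ground" by (simp add: toH_scale[OF eigfun_g_L2rad] ground_def)
  then show thesis by (rule that)
qed

lemma L_op_le_one:
  assumes "(x, y) \<in> closure L_op"
  shows "y \<bullet> x \<le> x \<bullet> (x :: 'n radL2)"
proof -
  obtain f where f: "\<And>k. f k \<in> Cc_rad" "(\<lambda>k. toH (f k)) \<longlonglongrightarrow> x" "(\<lambda>k. toH (L_fun (f k))) \<longlonglongrightarrow> y"
    using closure_sequence[OF assms] by blast
  have lim: "(\<lambda>k. (toH (f k) - toH (L_fun (f k))) \<bullet> toH (f k)) \<longlonglongrightarrow> (x - y) \<bullet> x"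
    by (intro tendsto_intros f)
  have "0 \<le> (toH (f k) - toH (L_fun (f k))) \<bullet> toH (f k)" for k
    by (rule gap_inequality[OF f(1)[of k]])
  then have "0 \<le> (x - y) \<bullet> x" by (intro LIMSEQ_le_const[OF lim] exI allI impI)
  then show ?thesis by (simp add: inner_diff_left)
qed

lemma diagonalization:
  obtains E \<nu> c where "diagonal_operator (\<lambda>v. v) E \<nu> c (closure (L_op :: 'n radL2 operator))"
proof (rule diagonal_operator_perturbation[OF lag.diagonal_operator_axioms bounded_linear_Vop Vop_symmetric closure_L_op_eq])
  fix E \<nu> c
  assume "diagonal_operator (\<lambda>v. v) E \<nu> c (closure (L_op :: 'n radL2 operator))"
  then show thesis by (rule that)
qed

theorem spectral_properties:
  fixes \<L> :: "'n radL2 operator"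
  assumes \<L>: "\<L> = closure L_op"
  shows "selfadjoint_op \<L>
    \<and> compact_resolvent \<L>
    \<and> (\<exists>S. C0_semigroup S \<and> generator S = \<L>)
    \<and> spectrum_op \<L> \<subseteq> complex_of_real ` {\<mu>. eigenvalue_op \<L> \<mu>}
    \<and> spectrum_op \<L> \<subseteq> complex_of_real ` ({..<0} \<union> {1})
    \<and> 1 \<in> spectrum_op \<L>
    \<and> simple_eigenvalue_op \<L> 1
    \<and> eigenfunction \<L> 1 (normalized eigfun_g)"
proof -
  obtain E \<nu> c where "diagonal_operator (\<lambda>v. v) E \<nu> c (closure (L_op :: 'n radL2 operator))"
    by (rule diagonalization)
  then interpret T: diagonal_operator "\<lambda>v. v" E \<nu> c \<L> unfolding \<L> .
  have gT: "(r *\<^sub>R ground, r *\<^sub>R ground) \<in> \<L>" for r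
    using ground_in_closure by (simp add: \<L>[symmetric] T.mem_T ground_def)
  have ev: "eigenvalue_op \<L> 1"
    unfolding eigenvalue_op_def using gT[of 1] ground_nonzero by (intro exI[of _ ground]) simp
  have eigenvalues: "\<mu> < 0 \<or> \<mu> = 1" if ev\<mu>: "eigenvalue_op \<L> \<mu>" for \<mu>
  proof (rule ccontr)
    \<comment> \<open>What remains is [0, 1) and (1, infinity). The form bound excludes the latter;
      in the former the eigenvector would be a multiple of \<open>ground\<close>, whose eigenvalue
      is 1.\<close>
    assume neg: "\<not> (\<mu> < 0 \<or> \<mu> = 1)"
    obtain e where e: "e \<noteq> 0" "(e, \<mu> *\<^sub>R e) \<in> \<L>"
      using ev\<mu> unfolding eigenvalue_op_def by blast
    have "(\<mu> *\<^sub>R e) \<bullet> e \<le> e \<bullet> e" by (rule L_op_le_one) (use e(2) in \<open>unfold \<L>\<close>)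
    then have le1: "\<mu> \<le> 1" using e(1) by simp
    have "(e, \<mu> *\<^sub>R e) \<in> closure L_op" using e(2) unfolding \<L> .
    then obtain r where r: "e = r *\<^sub>R ground"
      by (rule eigenvector_in_span) (use neg le1 in auto)
    have "(e, e) \<in> \<L>" using gT[of r] by (simp add: r)
    then have "\<mu> *\<^sub>R e = e"
      using T.selfadjoint e(2) unfolding selfadjoint_op_def single_valued_def by blast
    then have "(\<mu> - 1) *\<^sub>R e = 0" by (simp add: scaleR_left_diff_distrib)
    then show False using e(1) neg by simp
  qed
  have spec: "spectrum_op \<L> \<subseteq> complex_of_real ` {\<mu>. eigenvalue_op \<L> \<mu>}" by (rule T.spectrum_subset)
  \<comment> \<open>In the resolvent relation at 1 the vector 0 is related to the nonzero pair
    \<open>(ground, 0)\<close>, which no linear \<open>R\<close> permits.\<close>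
  have spec1: "1 \<in> spectrum_op \<L>"
  proof (rule ccontr)
    assume "1 \<notin> spectrum_op \<L>"
    then obtain R where R: "bounded_linear R" "resolvent_op \<L> 1 = {(x, R x) | x. True}"
      by (auto simp: spectrum_op_def resolvent_set_def)
    have "((ground, 0), (ground, 0)) \<in> complexify_op \<L>"
      using gT[of 1] gT[of 0] by (simp add: complexify_op_def)
    then have "(cscale 1 (ground, 0) - (ground, 0), (ground, 0)) \<in> resolvent_op \<L> 1"
      unfolding resolvent_op_def by blast
    then have "R 0 = (ground, 0)" unfolding R(2) by (simp add: cscale_def zero_prod_def)
    then show False
      using linear_0[OF bounded_linear.linear[OF R(1)]] ground_nonzero by (simp add: zero_prod_def)
  qed
  have simple: "simple_eigenvalue_op \<L> 1"
  proof -
    define S where "S = {(x, y - 1 *\<^sub>R x) | x y. (x, y) \<in> \<L>}"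
    have ker: "u \<in> span {ground}" if "(u, 0) \<in> S ^^ k" for u k
      using that
    proof (induction k arbitrary: u)
      case 0
      then show ?case by (simp add: span_zero)
    next
      case (Suc k)
      then obtain w where w: "(u, w) \<in> S" "(w, 0) \<in> S ^^ k" by (meson relpow_Suc_D2)
      from Suc.IH[OF w(2)] obtain r where r: "w = r *\<^sub>R ground" by (auto simp: span_singleton)
      have uw: "(u, u + w) \<in> \<L>" using w(1) by (auto simp: S_def)
      have "(u + w) \<bullet> ground = u \<bullet> ground" using T.symmetric[OF uw gT[of 1]] by simp
      then have "w \<bullet> ground = 0" by (simp add: inner_add_left)
      then have "w = 0" using ground_nonzero by (auto simp: r)
      then have "(u, 1 *\<^sub>R u) \<in> closure L_op" using uw by (simp add: \<L>)
      then obtain s where "u = s *\<^sub>R ground" by (rule eigenvector_in_span) auto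
      then show ?case by (auto simp: span_singleton)
    qed
    have "{u. \<exists>k. (u, 0) \<in> S ^^ k} = span {ground}"
    proof (intro equalityI subsetI)
      fix u assume "u \<in> span {ground}"
      then obtain r where r: "u = r *\<^sub>R ground" by (auto simp: span_singleton)
      have "(u, u - 1 *\<^sub>R u) \<in> S" unfolding S_def r using gT[of r] by blast
      then have "(u, 0) \<in> S ^^ 1" by simp
      then show "u \<in> {u. \<exists>k. (u, 0) \<in> S ^^ k}" by blast
    qed (use ker in blast)
    moreover have "dim (span {ground}) = 1"
      using ground_nonzero by (simp add: dim_eq_card_independent dim_span)
    ultimately show ?thesis using ev by (simp only: simple_eigenvalue_op_def S_def)
  qed
  have eig: "eigenfunction \<L> 1 (normalized eigfun_g)"
  proof -
    define r where "r = 1 / sqrt (LINT y|(lborel :: (real ^ 'n) measure). (eigfun_g y)\<^sup>2 * wgt y)"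
    have n: "normalized eigfun_g = (\<lambda>x :: real ^ 'n. r * eigfun_g x)"
      by (rule ext) (simp add: normalized_def r_def)
    have "r \<noteq> 0"
      using norm_toH[OF eigfun_g_L2rad, symmetric] ground_nonzero by (simp add: r_def ground_def)
    moreover have "toH (normalized eigfun_g) = r *\<^sub>R ground"
      by (simp add: n toH_scale[OF eigfun_g_L2rad] ground_def)
    ultimately show ?thesis
      unfolding eigenfunction_def using L2rad_scale[OF eigfun_g_L2rad, of r] ground_nonzero gT[of r] by (simp add: n)
  qed
  have "spectrum_op \<L> \<subseteq> complex_of_real ` ({..<0} \<union> {1})"
    using spec eigenvalues by blast
  then show ?thesis
    using T.selfadjoint T.compact_resolvent T.C0_exp_semigroup T.generator_exp_semigroup spec spec1 simple eig by blast
qed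

end

text \<open>With 8 a^2 = n - 4 the second coefficient factors as b = 8 a (1 - a) (2 a - 1). For a >
  0 it is positive exactly when 1/2 < a < 1, that is for 6 < n < 12; these five dimensions are
  checked one by one.\<close>

lemma coefficients_positive:
  assumes "7 \<le> n" "n \<le> 11"
  shows "coeff_a n > 0" "coeff_b n > 0"
proof -
  show "coeff_a n > 0" using assms by (simp add: coeff_a_def)
  consider "n = 7" | "n = 8" | "n = 9" | "n = 10" | "n = 11" using assms by linarith
  \<comment> \<open>Dividing b > 0 by n/2 isolates the root, sqrt(2n - 8) < 6 - 24/n; squared, this
    is a comparison of rational numbers.\<close>
  then have "2 * real n - 8 < (6 - 24 / real n)\<^sup>2 \<and> 0 \<le> 6 - 24 / real n"
    by cases (simp_all add: power2_eq_square)
  then have "sqrt (2 * real n - 8) < 6 - 24 / real n"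
    by (intro real_less_lsqrt) auto
  then have "real n * sqrt (2 * real n - 8) < real n * (6 - 24 / real n)"
    using assms by (intro mult_strict_left_mono) auto
  then show "coeff_b n > 0"
    using assms by (simp add: coeff_b_def right_diff_distrib)
qed

theorem proposition3p2:
  fixes d :: nat and \<L> :: "'n::finite radL2 operator"
  assumes d: "5 \<le> d" "d \<le> 9" and n: "CARD('n) = d + 2"
    and \<L>: "\<L> = closure L_op"
  shows "selfadjoint_op \<L>
    \<and> compact_resolvent \<L>
    \<and> (\<exists>S. C0_semigroup S \<and> generator S = \<L>)
    \<and> spectrum_op \<L> \<subseteq> complex_of_real ` {\<mu>. eigenvalue_op \<L> \<mu>}
    \<and> spectrum_op \<L> \<subseteq> complex_of_real ` ({..<0} \<union> {1})
    \<and> 1 \<in> spectrum_op \<L>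
    \<and> simple_eigenvalue_op \<L> 1
    \<and> eigenfunction \<L> 1 (normalized eigfun_g)"
proof -
  have n': "7 \<le> CARD('n)" "CARD('n) \<le> 11" using d n by simp_all
  interpret weight_coeffs "TYPE('n)" "CARD('n)" "coeff_a CARD('n)" "coeff_b CARD('n)"
    by unfold_locales (use n' coefficients_positive[OF n'] in auto)
  show ?thesis by (rule spectral_properties[OF \<L>])
qed

end
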